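(* Let $m\ge2$ and $N\ge2$ be integers and $Q=(-1,1)^m$. Let $p,q>1$ and $\alpha\in(0,1]$ be such that $$q>p+\alpha\max\left\{1,\frac{p-1}{m-1}\right\}.$$ Then there exist $\Lambda\ge1$, a function $0\le a\in C^{0,\alpha}(\overline Q)$, a map $u_0\in C^\infty(\overline Q,\mathrm S^{N-1}_\Lambda)$ and a map $\bar u\in W^{1,\varphi}_{u_0}(Q,\mathrm S^{N-1}_\Lambda)$, where $\varphi(x,t)=t^p+a(x)t^q$, such that $$\inf_{u\in W^{1,\varphi}_{u_0}(Q,\mathrm S^{N-1}_\Lambda)}\int_Q\varphi(x,|Du|)\,dx<\inf_{u\in C^\infty_{u_0}(\overline Q,\mathrm S^{N-1}_\Lambda)}\int_Q\varphi(x,|Du|)\,dx,$$ and there is no sequence $\{u_\ell\}_\ell\subset C^\infty_{u_0}(\overline Q,\mathrm S^{N-1}_\Lambda)$ such that $\int_Q\varphi(x,|Du_\ell-D\bar u|)\,dx\to0$.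
   Context: $\mathrm S^{N-1}_\Lambda=\{y\in\mathbb R^N:|y|=\Lambda\}$ is the $(N-1)$-dimensional sphere of radius $\Lambda$. $W^{1,\varphi}(Q,\mathrm S^{N-1}_\Lambda)$ is the set of $u\in W^{1,1}(Q,\mathbb R^N)$ with $\int_Q\varphi(x,|Du|)\,dx<\infty$ and $u(x)\in\mathrm S^{N-1}_\Lambda$ for a.e. $x\in Q$. For $u_0\in C^\infty(\overline Q,\mathrm S^{N-1}_\Lambda)$, $$C^\infty_{u_0}(\overline Q,\mathrm S^{N-1}_\Lambda)=\{v\in C^\infty(\overline Q,\mathrm S^{N-1}_\Lambda):v=u_0\text{ on }\partial Q\},$$ $$W^{1,\varphi}_{u_0}(Q,\mathrm S^{N-1}_\Lambda)=\{v\in W^{1,\varphi}(Q,\mathrm S^{N-1}_\Lambda):v=u_0\text{ on }\partial Q\},$$ the last boundary condition being in the sense of traces. *)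

theory Defs
  imports "HOL-Analysis.Analysis"
begin

definition cube :: "(real^'m) set" where
  "cube = {x. \<forall>i. -1 < x $ i \<and> x $ i < 1}"

definition holder_on :: "real \<Rightarrow> 'a::metric_space set \<Rightarrow> ('a \<Rightarrow> real) \<Rightarrow> bool" where
  "holder_on \<alpha> S f \<longleftrightarrow> (\<exists>C. \<forall>x\<in>S. \<forall>y\<in>S. \<bar>f x - f y\<bar> \<le> C * dist x y powr \<alpha>)"

definition double_phase :: "real \<Rightarrow> real \<Rightarrow> ('a \<Rightarrow> real) \<Rightarrow> 'a \<Rightarrow> real \<Rightarrow> real" where
  "double_phase p q a x t = t powr p + a x * t powr q"

definition extends_continuously ::
    "'a::euclidean_space set \<Rightarrow> ('a \<Rightarrow> 'b::real_normed_vector) \<Rightarrow> bool" where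
  "extends_continuously \<Omega> f \<longleftrightarrow> (\<exists>g. continuous_on (closure \<Omega>) g \<and> (\<forall>x\<in>\<Omega>. g x = f x))"

text \<open>For open \<open>\<Omega>\<close>: \<open>f\<close> is of class \<open>C\<^sup>k\<close> in \<open>\<Omega>\<close> and all its partial derivatives of order at most
  \<open>k\<close> extend continuously to the closure of \<open>\<Omega>\<close>.\<close>

primrec Ck_closure ::
    "nat \<Rightarrow> 'a::euclidean_space set \<Rightarrow> ('a \<Rightarrow> 'b::real_normed_vector) \<Rightarrow> bool" where
  "Ck_closure 0 \<Omega> f \<longleftrightarrow> extends_continuously \<Omega> f"
| "Ck_closure (Suc k) \<Omega> f \<longleftrightarrow> extends_continuously \<Omega> f \<and> f differentiable_on \<Omega> \<and>
     (\<forall>b\<in>Basis. Ck_closure k \<Omega> (\<lambda>x. frechet_derivative f (at x) b))"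

text \<open>Elements are total functions whose values off the closure of \<open>\<Omega>\<close> are irrelevant; continuity
  on the closure makes the boundary values those of the continuous extension.\<close>

definition smooth_closure ::
    "'a::euclidean_space set \<Rightarrow> ('a \<Rightarrow> 'b::real_normed_vector) set" where
  "smooth_closure \<Omega> = {f. continuous_on (closure \<Omega>) f \<and> (\<forall>k. Ck_closure k \<Omega> f)}"

definition smooth_sphere :: "real \<Rightarrow> (real^'m \<Rightarrow> real^'n) set" where
  "smooth_sphere \<Lambda> = {v \<in> smooth_closure cube. \<forall>x\<in>closure cube. v x \<in> sphere 0 \<Lambda>}"

definition smooth_sphere_bd :: "real \<Rightarrow> (real^'m \<Rightarrow> real^'n) \<Rightarrow> (real^'m \<Rightarrow> real^'n) set" where
  "smooth_sphere_bd \<Lambda> u0 = {v \<in> smooth_sphere \<Lambda>. \<forall>x\<in>frontier cube. v x = u0 x}"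

text \<open>\<open>smooth_closure UNIV\<close> is the space of all smooth functions on the whole space.\<close>

definition test_functions :: "(real^'m) set \<Rightarrow> (real^'m \<Rightarrow> real) set" where
  "test_functions \<Omega> = {\<psi> \<in> smooth_closure UNIV.
     compact (closure {x. \<psi> x \<noteq> 0}) \<and> closure {x. \<psi> x \<noteq> 0} \<subseteq> \<Omega>}"

definition has_weak_gradient ::
    "(real^'m) set \<Rightarrow> (real^'m \<Rightarrow> real^'n) \<Rightarrow> (real^'m \<Rightarrow> real^'m^'n) \<Rightarrow> bool" where
  "has_weak_gradient \<Omega> u G \<longleftrightarrow> integrable (lebesgue_on \<Omega>) G \<and>
     (\<forall>\<psi>\<in>test_functions \<Omega>. \<forall>i j.
        (LINT x|lebesgue_on \<Omega>. u x $ i * frechet_derivative \<psi> (at x) (axis j 1)) =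
        - (LINT x|lebesgue_on \<Omega>. G x $ i $ j * \<psi> x))"

definition W11 :: "(real^'m) set \<Rightarrow> (real^'m \<Rightarrow> real^'n) set" where
  "W11 \<Omega> = {u. integrable (lebesgue_on \<Omega>) u \<and> (\<exists>G. has_weak_gradient \<Omega> u G)}"

text \<open>The weak gradient is unique only up to null sets, so this picks a representative; it is only
  used under integrals. Its norm is the Frobenius norm.\<close>

definition weak_grad ::
    "(real^'m) set \<Rightarrow> (real^'m \<Rightarrow> real^'n) \<Rightarrow> real^'m \<Rightarrow> real^'m^'n" where
  "weak_grad \<Omega> u = (SOME G. has_weak_gradient \<Omega> u G)"

definition modular ::
    "(real^'m \<Rightarrow> real \<Rightarrow> real) \<Rightarrow> (real^'m \<Rightarrow> real^'m^'n) \<Rightarrow> ennreal" where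
  "modular \<phi> G = (\<integral>\<^sup>+ x. ennreal (\<phi> x (norm (G x))) \<partial>lebesgue_on cube)"

definition energy ::
    "(real^'m \<Rightarrow> real \<Rightarrow> real) \<Rightarrow> (real^'m \<Rightarrow> real^'n) \<Rightarrow> ennreal" where
  "energy \<phi> u = modular \<phi> (weak_grad cube u)"

definition W1phi_sphere ::
    "(real^'m \<Rightarrow> real \<Rightarrow> real) \<Rightarrow> real \<Rightarrow> (real^'m \<Rightarrow> real^'n) set" where
  "W1phi_sphere \<phi> \<Lambda> =
     {u \<in> W11 cube. energy \<phi> u < \<infinity> \<and> (AE x in lebesgue_on cube. u x \<in> sphere 0 \<Lambda>)}"

text \<open>Integral over the boundary of the cube with respect to surface measure, as the sum over the
  \<open>2m\<close> faces \<open>x\<^sub>i = s\<close> with \<open>s = \<plusminus>1\<close>. The integrand on a face does not depend on the \<open>i\<close>-th coordinate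
  of the integration variable, which ranges over an interval of length 2; hence the factor 1/2.\<close>

definition boundary_integral :: "(real^'m \<Rightarrow> ennreal) \<Rightarrow> ennreal" where
  "boundary_integral f = (\<Sum>i\<in>UNIV. \<Sum>s\<in>{-1, 1}.
     (\<integral>\<^sup>+ x. f (\<chi> j. if j = i then s else x $ j) \<partial>lebesgue_on cube) / 2)"

text \<open>The trace operator is the continuous extension to \<open>W\<^sup>1\<^sup>,\<^sup>1\<close> of the restriction map
  \<open>w \<mapsto> w|\<partial>Q\<close> from maps smooth up to the boundary, with values in \<open>L\<^sup>1(\<partial>Q)\<close>. So \<open>g\<close> is the trace
  of \<open>v\<close> iff smooth maps converge to \<open>v\<close> in \<open>W\<^sup>1\<^sup>,\<^sup>1\<close> while their restrictions converge to \<open>g\<close>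
  in \<open>L\<^sup>1(\<partial>Q)\<close>.\<close>

definition has_trace :: "(real^'m \<Rightarrow> real^'n) \<Rightarrow> (real^'m \<Rightarrow> real^'n) \<Rightarrow> bool" where
  "has_trace v g \<longleftrightarrow> (\<exists>w :: nat \<Rightarrow> real^'m \<Rightarrow> real^'n.
     (\<forall>k. w k \<in> smooth_closure cube) \<and>
     (\<lambda>k. \<integral>\<^sup>+ x. ennreal (norm (w k x - v x)) \<partial>lebesgue_on cube) \<longlonglongrightarrow> 0 \<and>
     (\<lambda>k. \<integral>\<^sup>+ x. ennreal (norm (weak_grad cube (w k) x - weak_grad cube v x)) \<partial>lebesgue_on cube)
       \<longlonglongrightarrow> 0 \<and>
     (\<lambda>k. boundary_integral (\<lambda>x. ennreal (norm (w k x - g x)))) \<longlonglongrightarrow> 0)"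

definition W1phi_sphere_bd ::
    "(real^'m \<Rightarrow> real \<Rightarrow> real) \<Rightarrow> real \<Rightarrow> (real^'m \<Rightarrow> real^'n) \<Rightarrow> (real^'m \<Rightarrow> real^'n) set" where
  "W1phi_sphere_bd \<phi> \<Lambda> u0 = {v \<in> W1phi_sphere \<phi> \<Lambda>. has_trace v u0}"

end

theory Submission
  imports Defs
begin

text \<open>The exceptional map takes values in a circle: two of its coordinates are \<open>cos (\<pi> f)\<close> and
\<open>sin (\<pi> f)\<close>, the others vanish, and \<open>f\<close> climbs from 0 on the bottom face to 1 on the top face in
the direction of one distinguished coordinate \<open>t\<close>; write \<open>y\<close> for the remaining \<open>m - 1\<close> coordinates.
Let \<open>K\<close> be a Cantor set on the \<open>t\<close>-axis and \<open>S\<close> a product of \<open>m - 1\<close> Cantor sets in the space of the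
\<open>y\<close>. Over a point \<open>y\<close> the profile of \<open>f\<close> is the devil's staircase of \<open>K\<close>, smoothed at the scale
\<open>dist y S\<close>. Hence the gradient of \<open>f\<close> vanishes wherever \<open>dist t K > dist y S\<close>, whereas the weight is
taken to be a multiple of the positive part of \<open>dist t K - dist y S\<close> to the power \<open>\<alpha>\<close>. So the weighted
term contributes nothing to the energy of the exceptional map, however large the multiple is.

A competitor that is smooth up to the boundary with the same boundary values cannot hide its jump in
this way. It is absolutely continuous along curves, \<open>K\<close> is a null set, and so along a curve
\<open>t \<mapsto> (c + s v, t)\<close> with \<open>c \<in> S\<close> and \<open>s\<close> comparable to \<open>dist t K\<close> it has to move from one pole to
the opposite one while the weight is comparable to \<open>(dist t K)\<^sup>\<alpha>\<close>. Averaging over \<open>c\<close> and over \<open>v\<close> in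
the unit box, and splitting the size of the gradient at a power of \<open>dist t K\<close> that is integrable in
\<open>t\<close>, gives a lower bound for the weighted energy that does not depend on the competitor
(\<open>smooth_lower_bound\<close>). A large multiple of the weight lifts this bound above the energy of the
exceptional map, which is the strict inequality between the infima. Since the derivative of the
exceptional map vanishes where the weight is positive, the same bound also applies to the difference
of the derivatives and excludes approximation in the modular.

The exponents enter through \<open>s = 1 - dim K\<close> and \<open>(m - 1) r = (m - 1) - dim S\<close>. The energy of the
exceptional map is finite if \<open>(p - 1) s < (m - 1) r\<close> (\<open>limit_map_energy_finite\<close>), and the lower bound
needs \<open>\<alpha> + (m - 1) r < (q - 1) s\<close>. Eliminating \<open>r \<in> (0, 1)\<close> leaves \<open>s < min 1 ((m - 1) / (p - 1))\<close> and
\<open>\<alpha> < (q - p) s\<close>, which is solvable exactly when \<open>q > p + \<alpha> max 1 ((p - 1) / (m - 1))\<close>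
(\<open>exponents_exist\<close>). The two conditions are open, so \<open>r\<close> and \<open>s\<close> may be rational, and then the sets of
numbers whose digits in a base \<open>L = 2\<^sup>k\<close> are smaller than a power of two have exactly the required
dimensions.

The competitors are handled through their classical derivatives, and the exceptional map through its
smooth approximations \<open>f\<^sub>k\<close>, which are finite sums of products of one-dimensional functions
(\<open>smooth_approximation\<close>). Both are linked to the weak gradients of the statement by uniqueness
(\<open>weak_grad_AE_eq\<close>).\<close>

section \<open>Smooth functions\<close>

text \<open>The derivatives of \<open>exp (- 1 / x)\<close> are linear combinations of these functions, all of which are flat at 0.\<close>

definition flat :: "nat \<Rightarrow> real \<Rightarrow> real" where
  "flat k x = (if x > 0 then exp (- inverse x) * inverse x ^ k else 0)"

text \<open>A class of infinitely differentiable functions that is generated rather than characterised: closure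
under differentiation is then a plain induction on the generation (\<open>smooth1_deriv\<close>). The rule for
antiderivatives admits the step function below.\<close>

inductive smooth1 :: "(real \<Rightarrow> real) \<Rightarrow> bool" where
  const: "smooth1 (\<lambda>x. c)"
| ident: "smooth1 (\<lambda>x. x)"
| flat: "smooth1 (flat k)"
| sin: "smooth1 sin"
| cos: "smooth1 cos"
| add: "smooth1 f \<Longrightarrow> smooth1 g \<Longrightarrow> smooth1 (\<lambda>x. f x + g x)"
| mult: "smooth1 f \<Longrightarrow> smooth1 g \<Longrightarrow> smooth1 (\<lambda>x. f x * g x)"
| comp: "smooth1 f \<Longrightarrow> smooth1 g \<Longrightarrow> smooth1 (\<lambda>x. f (g x))"
| antiderivative: "smooth1 f \<Longrightarrow> (\<And>x. (F has_real_derivative f x) (at x)) \<Longrightarrow> smooth1 F"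

lemma flat_tendsto_0: "(flat k \<longlongrightarrow> 0) (at 0)"
proof -
  have "(flat k \<longlongrightarrow> 0) (at_left 0)"
    by (rule tendsto_eventually) (auto simp: eventually_at_filter flat_def)
  moreover have "(flat k \<longlongrightarrow> 0) (at_right 0)"
  proof -
    have "((\<lambda>y::real. exp (- y) * y ^ k) \<longlongrightarrow> 0) at_top"
      using tendsto_power_div_exp_0[of k] by (simp add: exp_minus field_simps)
    then have "((\<lambda>x::real. exp (- inverse x) * inverse x ^ k) \<longlongrightarrow> 0) (at_right 0)"
      by (rule filterlim_compose[OF _ filterlim_inverse_at_top_right])
    then show ?thesis
      by (rule Lim_transform_eventually) (auto simp: eventually_at_filter flat_def)
  qed
  ultimately show ?thesis
    by (simp add: filterlim_split_at)
qed

lemma flat_deriv: "(flat k has_real_derivative (- real k) * flat (Suc k) x + flat (k + 2) x) (at x)"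
proof (cases "x = 0")
  case True
  have "(\<lambda>h. (flat k (0 + h) - flat k 0) / h) = flat (Suc k)"
    by (auto simp: fun_eq_iff flat_def divide_inverse)
  then show ?thesis
    using True flat_tendsto_0[of "Suc k"] by (simp add: DERIV_def flat_def[of _ 0])
next
  case False
  show ?thesis
  proof (cases "x > 0")
    case True
    have "((\<lambda>x. exp (- inverse x) * inverse x ^ k) has_real_derivative
        exp (- inverse x) * (inverse x ^ 2) * inverse x ^ k
        + exp (- inverse x) * (real k * inverse x ^ (k - 1) * (- (inverse x ^ 2)))) (at x)"
      by (rule derivative_eq_intros refl | use True in \<open>simp add: power2_eq_square\<close>)+
    moreover have "exp (- inverse x) * (inverse x ^ 2) * inverse x ^ k
        + exp (- inverse x) * (real k * inverse x ^ (k - 1) * (- (inverse x ^ 2)))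
      = (- real k) * flat (Suc k) x + flat (k + 2) x"
      using True by (cases k) (simp_all add: flat_def power2_eq_square algebra_simps)
    ultimately have "((\<lambda>x. exp (- inverse x) * inverse x ^ k) has_real_derivative
        (- real k) * flat (Suc k) x + flat (k + 2) x) (at x)" by simp
    then show ?thesis
      by (rule has_field_derivative_transform_within_open[where S="{0<..}"])
        (use True in \<open>auto simp: flat_def\<close>)
  next
    case F: False
    have "((\<lambda>x. 0) has_real_derivative (- real k) * flat (Suc k) x + flat (k + 2) x) (at x)"
      using F by (simp add: flat_def)
    then show ?thesis
      by (rule has_field_derivative_transform_within_open[where S="{..<0}"])
        (use False F in \<open>auto simp: flat_def\<close>)
  qed
qed

lemma smooth1_deriv: "smooth1 f \<Longrightarrow> \<exists>f'. smooth1 f' \<and> (\<forall>x. (f has_real_derivative f' x) (at x))"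
proof (induction rule: smooth1.induct)
  case (const c)
  then show ?case by (intro exI[of _ "\<lambda>x. 0"]) (simp add: smooth1.const)
next
  case ident
  then show ?case by (intro exI[of _ "\<lambda>x. 1"]) (simp add: smooth1.const)
next
  case (flat k)
  then show ?case
    by (intro exI[of _ "\<lambda>x. (- real k) * flat (Suc k) x + flat (k + 2) x"] conjI allI flat_deriv
        smooth1.add smooth1.mult[OF smooth1.const] smooth1.flat)
next
  case sin
  then show ?case by (intro exI[of _ cos]) (simp add: smooth1.cos)
next
  case cos
  show ?case
    by (rule exI[of _ "\<lambda>x. (-1) * sin x"])
      (use smooth1.mult[OF smooth1.const[of "-1"] smooth1.sin] in \<open>auto intro!: derivative_eq_intros\<close>)
next
  case (add f g)
  then obtain f' g' where "smooth1 f'" "smooth1 g'"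
    "\<And>x. (f has_real_derivative f' x) (at x)" "\<And>x. (g has_real_derivative g' x) (at x)" by blast
  then show ?case
    by (intro exI[of _ "\<lambda>x. f' x + g' x"]) (simp add: smooth1.add DERIV_add)
next
  case (mult f g)
  then obtain f' g' where "smooth1 f'" "smooth1 g'"
    "\<And>x. (f has_real_derivative f' x) (at x)" "\<And>x. (g has_real_derivative g' x) (at x)" by blast
  then show ?case using mult.hyps
    by (intro exI[of _ "\<lambda>x. f' x * g x + g' x * f x"]) (simp add: smooth1.add smooth1.mult DERIV_mult)
next
  case (comp f g)
  then obtain f' g' where "smooth1 f'" "smooth1 g'"
    "\<And>x. (f has_real_derivative f' x) (at x)" "\<And>x. (g has_real_derivative g' x) (at x)" by blast
  then show ?case using comp.hyps
    by (intro exI[of _ "\<lambda>x. f' (g x) * g' x"]) (simp add: smooth1.mult smooth1.comp DERIV_chain2)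
next
  case (antiderivative f F)
  then show ?case by blast
qed

lemma smooth1_continuous: "smooth1 f \<Longrightarrow> continuous_on S f"
  using smooth1_deriv[of f] by (meson DERIV_isCont continuous_at_imp_continuous_on)

text \<open>The analogue in several variables, again chosen so that directional derivatives stay in the class.\<close>

inductive smooth_fun :: "(real^'m \<Rightarrow> real) \<Rightarrow> bool" where
  coord: "smooth_fun (\<lambda>x. x $ i)"
| compose: "smooth1 h \<Longrightarrow> smooth_fun f \<Longrightarrow> smooth_fun (\<lambda>x. h (f x))"
| plus: "smooth_fun f \<Longrightarrow> smooth_fun g \<Longrightarrow> smooth_fun (\<lambda>x. f x + g x)"
| times: "smooth_fun f \<Longrightarrow> smooth_fun g \<Longrightarrow> smooth_fun (\<lambda>x. f x * g x)"

lemma smooth_fun_const: "smooth_fun (\<lambda>x::real^'m. c)"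
  using smooth_fun.compose[OF smooth1.const smooth_fun.coord] by fast

lemma smooth_fun_sum: "(\<And>i. i \<in> I \<Longrightarrow> smooth_fun (f i)) \<Longrightarrow> smooth_fun (\<lambda>x. \<Sum>i\<in>I. f i x)"
  by (induction I rule: infinite_finite_induct) (auto intro: smooth_fun_const smooth_fun.plus)

lemma smooth_fun_prod: "(\<And>i. i \<in> I \<Longrightarrow> smooth_fun (f i)) \<Longrightarrow> smooth_fun (\<lambda>x. \<Prod>i\<in>I. f i x)"
  by (induction I rule: infinite_finite_induct) (auto intro: smooth_fun_const smooth_fun.times)

lemma smooth_fun_derivative:
  fixes f :: "real^'m \<Rightarrow> real"
  shows "smooth_fun f \<Longrightarrow> \<exists>f'. (\<forall>x. (f has_derivative f' x) (at x)) \<and> (\<forall>v. smooth_fun (\<lambda>x. f' x v))"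
proof (induction rule: smooth_fun.induct)
  case (coord i)
  show ?case
    by (rule exI[of _ "\<lambda>x v. v $ i"]) (auto intro: smooth_fun_const bounded_linear_imp_has_derivative bounded_linear_vec_nth)
next
  case (compose h f)
  then obtain f' where f': "\<And>x. (f has_derivative f' x) (at x)" "\<And>v. smooth_fun (\<lambda>x. f' x v)" by blast
  obtain h' where h': "smooth1 h'" "\<And>x. (h has_real_derivative h' x) (at x)"
    using smooth1_deriv[OF compose.hyps(1)] by blast
  show ?case
  proof (intro exI[of _ "\<lambda>x v. h' (f x) * f' x v"] conjI allI)
    fix x
    show "((\<lambda>x. h (f x)) has_derivative (\<lambda>v. h' (f x) * f' x v)) (at x)"
      using has_derivative_compose[OF f'(1) h'(2)[unfolded has_field_derivative_def]] by simp
  next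
    fix v show "smooth_fun (\<lambda>x. h' (f x) * f' x v)"
      by (intro smooth_fun.times f'(2) smooth_fun.compose[OF h'(1) compose.hyps(2)])
  qed
next
  case (plus f g)
  then obtain f' g' where "\<And>x. (f has_derivative f' x) (at x)" "\<And>v. smooth_fun (\<lambda>x. f' x v)"
    "\<And>x. (g has_derivative g' x) (at x)" "\<And>v. smooth_fun (\<lambda>x. g' x v)" by blast
  then show ?case
    by (intro exI[of _ "\<lambda>x v. f' x v + g' x v"] conjI allI has_derivative_add smooth_fun.plus)
next
  case (times f g)
  then obtain f' g' where "\<And>x. (f has_derivative f' x) (at x)" "\<And>v. smooth_fun (\<lambda>x. f' x v)"
    "\<And>x. (g has_derivative g' x) (at x)" "\<And>v. smooth_fun (\<lambda>x. g' x v)" by blast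
  then show ?case using times.hyps
    by (intro exI[of _ "\<lambda>x v. f x * g' x v + f' x v * g x"] conjI allI has_derivative_mult
        smooth_fun.plus smooth_fun.times)
qed

text \<open>A property that is inherited by all directional derivatives and implies
differentiability can be iterated, so it implies smoothness up to the boundary of every set.\<close>

lemma smooth_closureI_coinduct:
  fixes f :: "'a::euclidean_space \<Rightarrow> 'b::real_normed_vector"
  assumes P: "P f"
    and step: "\<And>f. P f \<Longrightarrow> (\<forall>x. f differentiable (at x)) \<and> (\<forall>b. P (\<lambda>x. frechet_derivative f (at x) b))"
  shows "f \<in> smooth_closure \<Omega>"
proof -
  have cont: "continuous_on S f" if "P f" for S f
    using step[OF that] by (meson continuous_at_imp_continuous_on differentiable_imp_continuous_within)
  have "Ck_closure k \<Omega> f" if "P f" for k f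
    using that
  proof (induction k arbitrary: f)
    case 0
    then show ?case using cont by (auto simp: extends_continuously_def)
  next
    case (Suc k)
    then show ?case using cont[of f] step[of f]
      by (auto simp: extends_continuously_def differentiable_on_def intro: differentiable_at_withinI)
  qed
  then show ?thesis using P cont by (auto simp: smooth_closure_def)
qed

lemma smooth_fun_differentiable: "smooth_fun f \<Longrightarrow> f differentiable (at x)"
  using smooth_fun_derivative[of f] by (auto simp: differentiable_def)

lemma smooth_fun_frechet: "smooth_fun f \<Longrightarrow> smooth_fun (\<lambda>x. frechet_derivative f (at x) v)"
proof -
  assume "smooth_fun f"
  then obtain f' where f': "\<And>x. (f has_derivative f' x) (at x)" "\<And>v. smooth_fun (\<lambda>x. f' x v)"
    using smooth_fun_derivative by blast
  then show ?thesis
    by (simp add: frechet_derivative_at[OF f'(1), symmetric])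
qed

lemma smooth_fun_smooth_closure: "smooth_fun f \<Longrightarrow> f \<in> smooth_closure \<Omega>"
  by (rule smooth_closureI_coinduct[where P=smooth_fun])
    (auto intro: smooth_fun_differentiable smooth_fun_frechet)

lemma smooth_fun_continuous: "smooth_fun f \<Longrightarrow> continuous_on S f"
  by (meson continuous_at_imp_continuous_on differentiable_imp_continuous_within smooth_fun_differentiable)

lemma smooth_vector_smooth_closure:
  fixes f :: "real^'m \<Rightarrow> real^'n"
  assumes "\<And>i. smooth_fun (\<lambda>x. f x $ i)"
  shows "f \<in> smooth_closure \<Omega>"
proof (rule smooth_closureI_coinduct[where P="\<lambda>f. \<forall>i. smooth_fun (\<lambda>x. f x $ i)"])
  show "\<forall>i. smooth_fun (\<lambda>x. f x $ i)" using assms by blast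
next
  fix f :: "real^'m \<Rightarrow> real^'n" assume f: "\<forall>i. smooth_fun (\<lambda>x. f x $ i)"
  have d: "(f has_derivative (\<lambda>v. \<chi> i. frechet_derivative (\<lambda>x. f x $ i) (at x) v)) (at x)" for x
  proof (subst has_derivative_componentwise_within, intro ballI)
    fix b :: "real^'n" assume "b \<in> Basis"
    then obtain i where b: "b = axis i 1" by (auto simp: Basis_vec_def)
    show "((\<lambda>x. f x \<bullet> b) has_derivative (\<lambda>v. (\<chi> i. frechet_derivative (\<lambda>x. f x $ i) (at x) v) \<bullet> b)) (at x)"
      using smooth_fun_differentiable[of "\<lambda>x. f x $ i" x] f
      by (simp add: b inner_axis frechet_derivative_works)
  qed
  show "(\<forall>x. f differentiable at x) \<and> (\<forall>b i. smooth_fun (\<lambda>x. frechet_derivative f (at x) b $ i))"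
    using d f by (auto simp: differentiable_def frechet_derivative_at[OF d, symmetric] intro: smooth_fun_frechet)
qed

definition step_rate :: "real \<Rightarrow> real" where
  "step_rate s = flat 0 s * flat 0 (1 - s)"

text \<open>Rises smoothly from 0 on the negative half-line to 1 beyond 1.\<close>

definition step :: "real \<Rightarrow> real" where
  "step t = (LBINT s=0..t. step_rate s) / (LBINT s=0..1. step_rate s)"

definition step' :: "real \<Rightarrow> real" where
  "step' t = step_rate t / (LBINT s=0..1. step_rate s)"

lemma smooth1_step_rate: "smooth1 step_rate"
proof -
  have "smooth1 (\<lambda>s. flat 0 s * flat 0 (1 + (-1) * s))"
    by (intro smooth1.mult smooth1.comp[OF smooth1.flat] smooth1.add smooth1.const smooth1.ident smooth1.flat)
  then show ?thesis by (simp add: step_rate_def[abs_def])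
qed

text \<open>The fundamental theorem is available on compact intervals; one that has \<open>t\<close> in its interior yields
the two-sided derivative.\<close>

lemma step_rate_integral_deriv: "((\<lambda>t. LBINT s=0..t. step_rate s) has_real_derivative step_rate t) (at t)"
proof -
  define b where "b = \<bar>t\<bar> + 1"
  have "((\<lambda>u. LBINT y=0..u. step_rate y) has_vector_derivative (step_rate t)) (at t within {-b..b})"
    unfolding zero_ereal_def
    by (rule interval_integral_FTC2) (auto simp: b_def intro: smooth1_continuous smooth1_step_rate)
  moreover have "at t within {-b..b} = at t"
    by (rule at_within_interior) (auto simp: b_def)
  ultimately show ?thesis
    by (simp add: has_real_derivative_iff_has_vector_derivative)
qed

lemma step_rate_integral_pos: "(LBINT s=0..1. step_rate s) > 0"
proof -
  have "(LBINT s=0..ereal 0. step_rate s) < (LBINT s=0..ereal 1. step_rate s)"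
  proof (rule DERIV_pos_imp_increasing_open[of 0 1 "\<lambda>t. LBINT s=0..ereal t. step_rate s"])
    fix x :: real assume "0 < x" "x < 1"
    then have "step_rate x > 0" by (simp add: step_rate_def flat_def)
    then show "\<exists>y. ((\<lambda>t. LBINT s=0..ereal t. step_rate s) has_real_derivative y) (at x) \<and> 0 < y"
      using step_rate_integral_deriv[of x] by blast
  next
    show "continuous_on {0..1} (\<lambda>t. LBINT s=0..ereal t. step_rate s)"
      using step_rate_integral_deriv by (meson DERIV_isCont continuous_at_imp_continuous_on)
  qed simp
  then show ?thesis by (simp add: zero_ereal_def one_ereal_def)
qed

lemma step_deriv: "(step has_real_derivative step' t) (at t)"
  unfolding step_def[abs_def] step'_def using step_rate_integral_deriv by (rule DERIV_cdivide)

lemma smooth1_step: "smooth1 step"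
proof (rule smooth1.antiderivative[OF _ step_deriv])
  show "smooth1 step'"
    using smooth1.mult[OF smooth1_step_rate smooth1.const] by (simp add: step'_def[abs_def] divide_inverse)
qed

lemma step'_nonneg: "0 \<le> step' t"
  using step_rate_integral_pos by (simp add: step'_def step_rate_def flat_def)

lemma step'_eq_0: "t \<le> 0 \<or> t \<ge> 1 \<Longrightarrow> step' t = 0"
  by (auto simp: step'_def step_rate_def flat_def)

lemma step_mono: "s \<le> t \<Longrightarrow> step s \<le> step t"
  by (rule DERIV_nonneg_imp_nondecreasing[of s t]) (use step_deriv step'_nonneg in auto)

lemma step_0: "t \<le> 0 \<Longrightarrow> step t = 0"
proof (rule antisym)
  assume t: "t \<le> 0"
  have 0: "step 0 = 0" by (simp add: step_def flip: zero_ereal_def)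
  then show "step t \<le> 0" using step_mono[OF t] by simp
  show "0 \<le> step t"
    using DERIV_nonpos_imp_nonincreasing[of t 0 step] 0 t step_deriv step'_eq_0
    by (metis order_refl)
qed

lemma step_1: "t \<ge> 1 \<Longrightarrow> step t = 1"
proof (rule antisym)
  assume t: "t \<ge> 1"
  have 1: "step 1 = 1" using step_rate_integral_pos by (simp add: step_def flip: one_ereal_def)
  then show "1 \<le> step t" using step_mono[OF t] by simp
  show "step t \<le> 1"
    using DERIV_nonpos_imp_nonincreasing[of 1 t step] 1 t step_deriv step'_eq_0
    by (metis order_refl)
qed

lemma step_bounds: "0 \<le> step t" "step t \<le> 1"
  using step_mono[of "min t 0" t] step_mono[of t "max t 1"] by (auto simp: step_0 step_1)

lemma smooth1_step': "smooth1 step'"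
  using smooth1.mult[OF smooth1_step_rate smooth1.const] by (simp add: step'_def[abs_def] divide_inverse)

lemma step'_bounded: "\<exists>C>0. \<forall>t. \<bar>step' t\<bar> \<le> C"
proof -
  have "compact (step' ` {0..1})"
    by (rule compact_continuous_image[OF smooth1_continuous[OF smooth1_step'] compact_Icc])
  then obtain C where C: "C > 0" "\<And>t. t \<in> {0..1} \<Longrightarrow> \<bar>step' t\<bar> \<le> C"
    by (metis (no_types, lifting) bounded_pos compact_imp_bounded imageI real_norm_def)
  have "\<bar>step' t\<bar> \<le> C" for t
    using C step'_eq_0[of t] by (cases "t \<in> {0..1}") auto
  then show ?thesis using C by blast
qed

section \<open>The cube and its test functions\<close>

lemma cube_eq_box: "cube = box (\<chi> i. -1) ((\<chi> i. 1)::real^'m)"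
  by (auto simp: cube_def mem_box_cart)

lemma open_cube: "open cube"
  unfolding cube_eq_box by (rule open_box)

lemma closure_cube: "closure cube = cbox (\<chi> i. -1) ((\<chi> i. 1)::real^'m)"
  unfolding cube_eq_box
  by (rule closure_box) (auto simp: interval_ne_empty_cart)

lemma mem_closure_cube: "(x::real^'m) \<in> closure cube \<longleftrightarrow> (\<forall>i. -1 \<le> x $ i \<and> x $ i \<le> 1)"
  by (auto simp: closure_cube mem_box_cart)

lemma compact_closure_cube: "compact (closure cube :: (real^'m) set)"
  by (simp add: closure_cube)

lemma frontier_cube_coord:
  assumes "(x::real^'m) \<in> frontier cube" shows "\<exists>i. x $ i = -1 \<or> x $ i = 1"
proof -
  have "x \<in> closure cube" "x \<notin> cube"
    using assms by (auto simp: frontier_def interior_open[OF open_cube])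
  then have "\<forall>i. -1 \<le> x $ i \<and> x $ i \<le> 1" "\<not> (\<forall>i. -1 < x $ i \<and> x $ i < 1)"
    by (simp add: mem_closure_cube, simp add: cube_def)
  then show ?thesis by (metis less_eq_real_def)
qed

lemma frontier_cubeI:
  assumes "\<And>i. -1 \<le> x $ i" "\<And>i. x $ i \<le> 1" "x $ j = -1 \<or> x $ j = 1"
  shows "(x::real^'m) \<in> frontier cube"
  using assms by (auto simp: frontier_def interior_open[OF open_cube] mem_closure_cube)
    (auto simp: cube_def dest: spec[of _ j])

lemma cube_sets [measurable]: "cube \<in> sets borel" "cube \<in> sets lebesgue"
  by (simp_all add: borel_open open_cube)

lemma cube_lmeasurable: "(cube :: (real^'m) set) \<in> lmeasurable"
  by (simp add: cube_eq_box)

lemma finite_measure_cube: "finite_measure (lebesgue_on (cube :: (real^'m) set))"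
  by (rule finite_measure_lebesgue_on) (rule cube_lmeasurable)

lemma borel_measurable_continuous_on_cube:
  "continuous_on cube f \<Longrightarrow> f \<in> borel_measurable (lebesgue_on cube)"
  by (simp add: continuous_imp_measurable_on_sets_lebesgue)

lemma integrable_continuous_bounded_on_cube:
  fixes f :: "real^'m \<Rightarrow> 'b::{banach,second_countable_topology}"
  assumes "continuous_on cube f" "\<And>x. x \<in> cube \<Longrightarrow> norm (f x) \<le> C"
  shows "integrable (lebesgue_on cube) f"
proof -
  interpret finite_measure "lebesgue_on (cube :: (real^'m) set)" by (rule finite_measure_cube)
  show ?thesis
    by (rule integrable_const_bound[where B=C])
      (auto simp: assms borel_measurable_continuous_on_cube)
qed

lemma integral_lebesgue_on_cube_lborel:
  fixes f :: "real^'m \<Rightarrow> real"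
  assumes "continuous_on cube f"
  shows "(LINT x|lebesgue_on cube. f x) = (LINT x|lborel. indicator cube x * f x)"
proof -
  have "(\<lambda>x. indicator cube x * f x) \<in> borel_measurable borel"
    using borel_measurable_continuous_on_indicator[OF cube_sets(1) assms] by simp
  then show ?thesis
    by (subst integral_restrict_space) (auto simp: integral_completion)
qed

text \<open>This replaces Fubini and the one-dimensional fundamental theorem: the integral of a
difference quotient vanishes because Lebesgue measure is invariant under translations, and the
difference quotients converge boundedly.\<close>

lemma integral_directional_derivative_eq_0:
  fixes g :: "'a::euclidean_space \<Rightarrow> real"
  assumes g': "\<And>x. (g has_derivative g' x) (at x)"
    and C: "\<And>x. \<bar>g' x b\<bar> \<le> C"
    and S: "\<And>x. x \<notin> S \<Longrightarrow> g x = 0" "bounded S"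
  shows "(LINT x|lborel. g' x b) = 0"
proof -
  obtain R where R: "R > 0" "\<And>x. x \<in> S \<Longrightarrow> norm x \<le> R"
    using S(2) bounded_pos by metis
  have cont: "continuous_on UNIV g"
    using g' has_derivative_continuous continuous_at_imp_continuous_on by blast
  then have gm [measurable]: "g \<in> borel_measurable borel"
    by (rule borel_measurable_continuous_onI)
  have intg: "integrable lborel g"
  proof -
    have "set_integrable lborel (cball 0 R) g"
      unfolding set_integrable_def
      by (rule borel_integrable_compact) (auto intro: continuous_on_subset[OF cont])
    moreover have "(\<lambda>x. indicator (cball 0 R) x *\<^sub>R g x) = g"
      using S R by (auto simp: fun_eq_iff indicator_def)
    ultimately show ?thesis by (simp add: set_integrable_def)
  qed
  have trans: "integrable lborel (\<lambda>x. g (c + x))" "(LINT x|lborel. g (c + x)) = (LINT x|lborel. g x)" for c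
    using integrable_distr_eq[of "(+) c" lborel borel g] integral_distr[of "(+) c" lborel borel g] intg
    by (simp_all add: lborel_distr_plus)
  (* The difference quotients in direction b with step 1 / (k + 1). *)
  define s where "s k x = (g (inverse (real (Suc k)) *\<^sub>R b + x) - g x) * real (Suc k)" for k x
  have s0: "(LINT x|lborel. s k x) = 0" for k
    unfolding s_def using trans intg by simp
  have lim: "(\<lambda>k. s k x) \<longlonglongrightarrow> g' x b" for x
  proof -
    have "((\<lambda>t. g (t *\<^sub>R b + x)) has_derivative (\<lambda>t. g' x (t *\<^sub>R b))) (at 0)"
      by (rule has_derivative_compose[of "\<lambda>t. t *\<^sub>R b + x" "\<lambda>t. t *\<^sub>R b"])
        (auto intro!: derivative_eq_intros simp: g')
    then have "((\<lambda>t. g (t *\<^sub>R b + x)) has_real_derivative g' x b) (at 0)"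
      using has_derivative_bounded_linear[OF g'[of x]]
      by (simp add: has_field_derivative_def linear_simps bounded_linear.linear linear_scale mult.commute[of _ "g' _ b"])
    then have "((\<lambda>t. (g (t *\<^sub>R b + x) - g x) / t) \<longlongrightarrow> g' x b) (at 0)"
      by (simp add: DERIV_def)
    moreover have "filterlim (\<lambda>k. inverse (real (Suc k))) (at 0) sequentially"
      by (rule filterlim_atI) (use LIMSEQ_inverse_real_of_nat in auto)
    ultimately have "(\<lambda>k. (g (inverse (real (Suc k)) *\<^sub>R b + x) - g x) / inverse (real (Suc k))) \<longlonglongrightarrow> g' x b"
      by (rule filterlim_compose)
    then show ?thesis by (simp add: s_def divide_inverse)
  qed
  have bd: "\<bar>s k x\<bar> \<le> C * indicator (cball 0 (R + norm b)) x" for k x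
  proof (cases "x \<in> cball 0 (R + norm b)")
    case True
    let ?h = "inverse (real (Suc k))"
    have "((\<lambda>t. g (t *\<^sub>R b + x)) has_real_derivative g' (t *\<^sub>R b + x) b) (at t)" for t
    proof -
      have "((\<lambda>t. g (t *\<^sub>R b + x)) has_derivative (\<lambda>u. g' (t *\<^sub>R b + x) (u *\<^sub>R b))) (at t)"
        by (rule has_derivative_compose[of "\<lambda>t. t *\<^sub>R b + x" "\<lambda>t. t *\<^sub>R b"])
          (auto intro!: derivative_eq_intros simp: g')
      then show ?thesis
        using has_derivative_bounded_linear[OF g'[of "t *\<^sub>R b + x"]]
        by (simp add: has_field_derivative_def linear_simps bounded_linear.linear linear_scale mult.commute[of _ "g' _ b"])
    qed
    from MVT2[OF _ this, of 0 ?h] obtain z where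
      "g (?h *\<^sub>R b + x) - g x = ?h * g' (z *\<^sub>R b + x) b" by auto
    then have "s k x = g' (z *\<^sub>R b + x) b" by (simp add: s_def)
    then show ?thesis using C True by simp
  next
    case False
    have "norm (inverse (real (Suc k)) *\<^sub>R b) \<le> 1 * norm b"
      unfolding norm_scaleR by (rule mult_right_mono) (auto simp: inverse_le_1_iff)
    then have "norm x - norm b \<le> norm (inverse (real (Suc k)) *\<^sub>R b + x)"
      using norm_triangle_ineq4[of "inverse (real (Suc k)) *\<^sub>R b + x" "inverse (real (Suc k)) *\<^sub>R b"] by simp
    then have "inverse (real (Suc k)) *\<^sub>R b + x \<notin> S" "x \<notin> S"
      using False R(2)[of x] R(2)[of "inverse (real (Suc k)) *\<^sub>R b + x"] by (auto intro: add_increasing2)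
    then show ?thesis using False S by (simp add: s_def)
  qed
  have "(\<lambda>k. LINT x|lborel. s k x) \<longlonglongrightarrow> (LINT x|lborel. g' x b)"
  proof (rule integral_dominated_convergence[where w="\<lambda>x. C * indicator (cball 0 (R + norm b)) x"])
    have sm: "s k \<in> borel_measurable lborel" for k unfolding s_def[abs_def] by measurable
    then show "\<And>k. s k \<in> borel_measurable lborel" .
    show "(\<lambda>x. g' x b) \<in> borel_measurable lborel"
      by (rule borel_measurable_LIMSEQ_real[OF lim]) (rule sm)
    show "integrable lborel (\<lambda>x::'a. C * indicat_real (cball 0 (R + norm b)) x)"
      by (intro integrable_mult_right integrable_real_indicator)
        (use emeasure_lborel_cball_finite[of "0::'a"] in auto)
  qed (use lim bd in auto)
  then show ?thesis using s0 LIMSEQ_const_iff[of 0] by (simp add: LIMSEQ_unique)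
qed


text \<open>Smooth functions that tend to the indicator of an open box. The shift by \<open>1\<close> keeps the closed
support inside the open box, so that the box may touch the boundary of the cube.\<close>

definition box_bump :: "real^'m \<Rightarrow> real^'m \<Rightarrow> nat \<Rightarrow> real^'m \<Rightarrow> real" where
  "box_bump l u k x = (\<Prod>i\<in>UNIV. step (real (Suc k) * (x $ i - l $ i) - 1) * step (real (Suc k) * (u $ i - x $ i) - 1))"

lemma smooth_fun_affine_coord:
  assumes "smooth1 h" shows "smooth_fun (\<lambda>x::real^'m. h (c * x $ i + d))"
proof -
  have "smooth1 (\<lambda>t. h (c * t + d))"
    by (rule smooth1.comp[OF assms smooth1.add[OF smooth1.mult[OF smooth1.const smooth1.ident] smooth1.const]])
  from smooth_fun.compose[OF this smooth_fun.coord] show ?thesis .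
qed

lemma smooth_fun_box_bump:
  fixes l u :: "real^'m"
  shows "smooth_fun (box_bump l u k)"
proof -
  have "smooth_fun (\<lambda>x::real^'m. step (real (Suc k) * x $ i + (- real (Suc k) * l $ i - 1)) *
      step (- real (Suc k) * x $ i + (real (Suc k) * u $ i - 1)))" for i
    by (intro smooth_fun.times smooth_fun_affine_coord smooth1_step)
  then show ?thesis
    unfolding box_bump_def[abs_def]
    by (intro smooth_fun_prod) (simp add: algebra_simps del: of_nat_Suc)
qed

lemma box_bump_bounds: "0 \<le> box_bump l u k x" "box_bump l u k x \<le> 1"
  unfolding box_bump_def by (auto intro!: prod_nonneg prod_le_1 mult_le_one simp: step_bounds)

lemma box_bump_support:
  "{x. box_bump l u k x \<noteq> 0} \<subseteq> cbox (\<chi> i. l $ i + 1 / real (Suc k)) (\<chi> i. u $ i - 1 / real (Suc k))"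
proof clarify
  fix x assume "box_bump l u k x \<noteq> 0"
  then have *: "step (real (Suc k) * (x $ i - l $ i) - 1) \<noteq> 0" "step (real (Suc k) * (u $ i - x $ i) - 1) \<noteq> 0" for i
    by (auto simp: box_bump_def)
  have "1 \<le> real (Suc k) * (x $ i - l $ i)" "1 \<le> real (Suc k) * (u $ i - x $ i)" for i
    using *[of i] step_0 by (smt (verit))+
  then have "1 / real (Suc k) \<le> x $ i - l $ i" "1 / real (Suc k) \<le> u $ i - x $ i" for i
    by (simp_all add: pos_divide_le_eq mult.commute del: of_nat_Suc)
  then show "x \<in> cbox (\<chi> i. l $ i + 1 / real (Suc k)) (\<chi> i. u $ i - 1 / real (Suc k))"
    by (auto simp: mem_box_cart algebra_simps)
qed

lemma box_bump_test_function:
  assumes "box l u \<subseteq> \<Omega>" shows "box_bump l u k \<in> test_functions \<Omega>"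
proof -
  have cl: "closure {x. box_bump l u k x \<noteq> 0} \<subseteq> cbox (\<chi> i. l $ i + 1 / real (Suc k)) (\<chi> i. u $ i - 1 / real (Suc k))"
    by (rule closure_minimal[OF box_bump_support closed_cbox])
  also have "\<dots> \<subseteq> box l u"
  proof
    fix x assume "x \<in> cbox (\<chi> i. l $ i + 1 / real (Suc k)) (\<chi> i. u $ i - 1 / real (Suc k))"
    then have "l $ i + 1 / real (Suc k) \<le> x $ i" "x $ i \<le> u $ i - 1 / real (Suc k)" for i
      by (simp_all add: mem_box_cart)
    moreover have "1 / real (Suc k) > 0" by simp
    ultimately have "l $ i < x $ i \<and> x $ i < u $ i" for i
      by (smt (verit))
    then show "x \<in> box l u"
      by (simp add: mem_box_cart)
  qed
  finally have "closure {x. box_bump l u k x \<noteq> 0} \<subseteq> \<Omega>" using assms by blast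
  moreover have "compact (closure {x. box_bump l u k x \<noteq> 0})"
    using cl by (meson bounded_cbox bounded_subset closed_closure compact_eq_bounded_closed)
  ultimately show ?thesis
    by (simp add: test_functions_def smooth_fun_smooth_closure smooth_fun_box_bump)
qed

lemma box_bump_tendsto: "(\<lambda>k. box_bump l u k x) \<longlonglongrightarrow> indicator (box l u) x"
proof (cases "x \<in> box l u")
  case True
  have ev: "\<forall>\<^sub>F k in sequentially. step (real (Suc k) * c - 1) = 1" if "c > 0" for c
  proof -
    obtain N where N: "2 / c < real N" using reals_Archimedean2 by blast
    have "step (real (Suc k) * c - 1) = 1" if "k \<ge> N" for k
    proof (rule step_1)
      have "2 / c \<le> real (Suc k)" using N that by simp
      then have "2 \<le> real (Suc k) * c" using \<open>c > 0\<close> by (simp add: pos_divide_le_eq del: of_nat_Suc)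
      then show "1 \<le> real (Suc k) * c - 1" by simp
    qed
    then show ?thesis by (auto simp: eventually_sequentially)
  qed
  have "\<forall>\<^sub>F k in sequentially. \<forall>i\<in>UNIV. step (real (Suc k) * (x $ i - l $ i) - 1) * step (real (Suc k) * (u $ i - x $ i) - 1) = 1"
  proof (rule eventually_ball_finite, simp, rule ballI)
    fix i :: 'a
    have "0 < x $ i - l $ i" "0 < u $ i - x $ i" using True by (auto simp: mem_box_cart)
    from eventually_conj[OF this[THEN ev]]
    show "\<forall>\<^sub>F k in sequentially. step (real (Suc k) * (x $ i - l $ i) - 1) * step (real (Suc k) * (u $ i - x $ i) - 1) = 1"
      by eventually_elim simp
  qed
  then have "\<forall>\<^sub>F k in sequentially. box_bump l u k x = 1"
    by eventually_elim (simp add: box_bump_def)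
  then show ?thesis using True by (simp add: tendsto_eventually)
next
  case False
  then have "box_bump l u k x = 0" for k
    using box_bump_test_function[of l u "box l u" k] closure_subset[of "{x. box_bump l u k x \<noteq> 0}"]
    by (auto simp: test_functions_def)
  then show ?thesis using False by simp
qed

text \<open>Bumps approximate indicators of boxes, so the integral over every box vanishes; boxes are stable
under intersection and generate the Borel sets, so the integral over every Borel set vanishes.\<close>

lemma AE_eq_0_if_test_integrals_eq_0:
  fixes H :: "real^'m \<Rightarrow> real"
  assumes int: "integrable (lebesgue_on cube) H"
    and 0: "\<And>\<psi>. \<psi> \<in> test_functions cube \<Longrightarrow> (LINT x|lebesgue_on cube. H x * \<psi> x) = 0"
  shows "AE x in lebesgue_on cube. H x = 0"
proof -
  have box0: "(LINT x|lebesgue_on cube. H x * indicator (box l u) x) = 0" if "box l u \<subseteq> cube" for l u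
  proof -
    have "(\<lambda>k. LINT x|lebesgue_on cube. H x * box_bump l u k x) \<longlonglongrightarrow> (LINT x|lebesgue_on cube. H x * indicator (box l u) x)"
    proof (rule integral_dominated_convergence[where w="\<lambda>x. \<bar>H x\<bar>"])
      show "(\<lambda>x. H x * indicat_real (box l u) x) \<in> borel_measurable (lebesgue_on cube)"
        using int by (intro borel_measurable_times borel_measurable_integrable borel_measurable_indicator)
          (auto simp: sets_restrict_space_iff that Int_absorb2)
      show "(\<lambda>x. H x * box_bump l u k x) \<in> borel_measurable (lebesgue_on cube)" for k
        using int by (intro borel_measurable_times borel_measurable_integrable borel_measurable_continuous_on_cube
            smooth_fun_continuous smooth_fun_box_bump)
      show "AE x in lebesgue_on cube. (\<lambda>k. H x * box_bump l u k x) \<longlonglongrightarrow> H x * indicat_real (box l u) x"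
        by (intro AE_I2 tendsto_mult tendsto_const box_bump_tendsto)
      show "AE x in lebesgue_on cube. norm (H x * box_bump l u k x) \<le> \<bar>H x\<bar>" for k
        by (intro AE_I2) (simp add: abs_mult box_bump_bounds mult_left_le)
    qed (use int in simp)
    then show ?thesis
      using 0[OF box_bump_test_function[OF that]] by (simp add: LIMSEQ_const_iff)
  qed
  define f where "f x = indicator cube x * H x" for x
  have intf: "integrable lebesgue f"
    using int by (simp add: f_def[abs_def] integrable_restrict_space)
  (* Lebesgue measurable functions are exchanged for Borel functions, so that boxes generate enough sets. *)
  obtain f' where f'm: "f' \<in> borel_measurable lborel" and f': "AE x in lborel. f x = f' x"
    using completion_ex_borel_measurable_real[OF borel_measurable_integrable[OF intf]] by blast
  have f'L: "AE x in lebesgue. f' x = f x"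
    using AE_completion[OF f'] by (auto simp: eq_commute)
  have "integrable lebesgue f'"
    using intf f'L f'm by (subst integrable_cong_AE[where g=f]) (auto intro: measurable_completion)
  then have intf': "integrable lborel f'"
    using f'm by (simp add: integrable_completion)
  have boxz: "(LINT x:box l u|lborel. f' x) = 0" for l u
  proof -
    have "(LINT x:box l u|lborel. f' x) = (LINT x|lebesgue. indicator (box l u) x * f' x)"
      using f'm by (simp add: set_lebesgue_integral_def integral_completion)
    also have "\<dots> = (LINT x|lebesgue. indicator (box l u) x * f x)"
      using f'L intf f'm by (intro integral_cong_AE) (auto intro!: borel_measurable_times intro: measurable_completion)
    also have "\<dots> = (LINT x|lebesgue_on cube. H x * indicator (box l u \<inter> cube) x)"
      by (simp add: integral_restrict_space f_def indicator_inter_arith mult_ac)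
        (auto intro!: Bochner_Integration.integral_cong simp: indicator_def)
    also have "\<dots> = 0"
    proof -
      obtain l' u' :: "real^'m" where lu: "box l u \<inter> cube = box l' u'"
        unfolding cube_eq_box box_Int_box by blast
      then have "box l' u' \<subseteq> cube" by blast
      then show ?thesis unfolding lu by (rule box0)
    qed
    finally show ?thesis .
  qed
  have all: "(LINT x:A|lborel. f' x) = 0" if "A \<in> sets borel" for A
  proof -
    have A: "A \<in> sigma_sets UNIV (range (\<lambda>(a, b). box a b))"
      using that by (simp add: borel_eq_box)
    have sint: "set_integrable lborel B f'" if "B \<in> sets borel" for B
      unfolding set_integrable_def using that by (intro integrable_mult_indicator intf') auto
    have top: "(LINT x|lborel. f' x) = 0"
    proof -
      have inc: "incseq (\<lambda>n::nat. box (- (real n *\<^sub>R One)) (real n *\<^sub>R One) :: (real^'m) set)"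
      proof (rule incseq_SucI, rule subsetI)
        fix n x assume x: "x \<in> box (- (real n *\<^sub>R One)) (real n *\<^sub>R One :: real^'m)"
        show "x \<in> box (- (real (Suc n) *\<^sub>R One)) (real (Suc n) *\<^sub>R One :: real^'m)"
          unfolding mem_box
        proof
          fix i :: "real^'m" assume i: "i \<in> Basis"
          then have "- real n < x \<bullet> i \<and> x \<bullet> i < real n" using x by (simp add: mem_box)
          then show "- (real (Suc n) *\<^sub>R One) \<bullet> i < x \<bullet> i \<and> x \<bullet> i < (real (Suc n) *\<^sub>R One) \<bullet> i"
            using i by simp
        qed
      qed
      have "(\<lambda>n::nat. LINT x:box (- (real n *\<^sub>R One)) (real n *\<^sub>R One)|lborel. f' x) \<longlonglongrightarrow> (LINT x:(\<Union>n::nat. box (- (real n *\<^sub>R One)) (real n *\<^sub>R One))|lborel. f' x)"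
        by (rule set_integral_cont_up) (auto intro!: sint inc)
      then show ?thesis
        unfolding UN_box_eq_UNIV boxz by (simp add: LIMSEQ_const_iff set_lebesgue_integral_def)
    qed
    have st: "Int_stable (range (\<lambda>(a, b). box a b :: (real^'m) set))"
      by (auto simp: Int_stable_def box_Int_box)
    have sub: "range (\<lambda>(a, b). box a b :: (real^'m) set) \<subseteq> Pow UNIV" by simp
    from st sub A show ?thesis
    proof (induction rule: sigma_sets_induct_disjoint)
      case (basic A) then show ?case using boxz by auto
    next
      case empty show ?case by (simp add: set_lebesgue_integral_def)
    next
      case (compl A)
      then have A: "A \<in> sets borel" by (simp add: borel_eq_box)
      have "(LINT x:UNIV|lborel. f' x) = (LINT x:A \<union> (UNIV - A)|lborel. f' x)" by simp
      also have "\<dots> = (LINT x:A|lborel. f' x) + (LINT x:UNIV - A|lborel. f' x)"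
        by (rule set_integral_Un) (use A sint in auto)
      finally show ?case using compl top by (simp add: set_lebesgue_integral_def)
    next
      case (union A)
      then have A: "A i \<in> sets borel" for i by (auto simp: borel_eq_box)
      have "(LINT x:(\<Union>i. A i)|lborel. f' x) = (\<Sum>i. LINT x:A i|lborel. f' x)"
        using union(1) A by (intro lebesgue_integral_countable_add) (auto simp: disjoint_family_on_def intro!: sint)
      then show ?case using union by simp
    qed
  qed
  have "AE x in lborel. f' x = 0"
    by (rule density_unique_real[OF intf' integrable_zero]) (use all in auto)
  then have "AE x in lborel. f x = 0" using f' by eventually_elim simp
  then have "AE x in lebesgue. f x = 0" by (rule AE_completion)
  then show ?thesis
    by (subst AE_restrict_space_iff) (auto simp: f_def elim: eventually_mono)
qed

section \<open>Weak gradients of smooth maps\<close>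

lemma test_function_facts:
  assumes "\<psi> \<in> test_functions \<Omega>"
  shows "continuous_on UNIV \<psi>" "\<psi> differentiable (at x)"
    "b \<in> Basis \<Longrightarrow> continuous_on UNIV (\<lambda>x. frechet_derivative \<psi> (at x) b)"
    "compact (closure {x. \<psi> x \<noteq> 0})" "closure {x. \<psi> x \<noteq> 0} \<subseteq> \<Omega>"
proof -
  have \<psi>: "\<psi> \<in> smooth_closure UNIV" and *: "compact (closure {x. \<psi> x \<noteq> 0})" "closure {x. \<psi> x \<noteq> 0} \<subseteq> \<Omega>"
    using assms by (auto simp: test_functions_def)
  then have k: "Ck_closure (Suc 0) UNIV \<psi>" unfolding smooth_closure_def by blast
  show "continuous_on UNIV \<psi>" using \<psi> by (simp add: smooth_closure_def)
  show "\<psi> differentiable (at x)" using k by (simp add: differentiable_on_def)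
  show "continuous_on UNIV (\<lambda>x. frechet_derivative \<psi> (at x) b)" if "b \<in> Basis"
    using k that by (auto simp: extends_continuously_def cong: continuous_on_cong)
qed (use assms in \<open>auto simp: test_functions_def\<close>)

lemma test_function_bounded:
  assumes "\<psi> \<in> test_functions \<Omega>"
  obtains C where "C > 0" "\<And>x. \<bar>\<psi> x\<bar> \<le> C"
proof -
  have "bounded (\<psi> ` closure {x. \<psi> x \<noteq> 0})"
    by (intro compact_imp_bounded compact_continuous_image test_function_facts[OF assms]
        continuous_on_subset[OF test_function_facts(1)[OF assms] subset_UNIV])
  then obtain C where C: "C > 0" "\<And>x. x \<in> closure {x. \<psi> x \<noteq> 0} \<Longrightarrow> \<bar>\<psi> x\<bar> \<le> C"
    unfolding bounded_pos by auto
  have "\<bar>\<psi> x\<bar> \<le> C" for x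
    using C closure_subset[of "{x. \<psi> x \<noteq> 0}"] by (cases "\<psi> x = 0") auto
  then show ?thesis using that C by blast
qed

lemma test_function_derivative_bounded:
  fixes \<psi> :: "real^'m \<Rightarrow> real"
  assumes "\<psi> \<in> test_functions cube"
  obtains C where "C > 0" "\<And>x. x \<in> closure cube \<Longrightarrow> \<bar>frechet_derivative \<psi> (at x) (axis j 1)\<bar> \<le> C"
proof -
  have e: "axis j 1 \<in> (Basis :: (real^'m) set)" by (auto simp: Basis_vec_def)
  have "bounded ((\<lambda>x. frechet_derivative \<psi> (at x) (axis j 1)) ` closure cube)"
    by (intro compact_imp_bounded compact_continuous_image compact_closure_cube
        continuous_on_subset[OF test_function_facts(3)[OF assms e] subset_UNIV])
  then show ?thesis using that unfolding bounded_pos by auto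
qed

text \<open>The norm of this matrix is the Frobenius norm, in agreement with the norm of weak gradients.\<close>

definition jac :: "(real^'m \<Rightarrow> real^'n) \<Rightarrow> real^'m \<Rightarrow> real^'m^'n" where
  "jac w x = matrix (frechet_derivative w (at x))"

lemma jac_component: "jac w x $ i $ j = frechet_derivative w (at x) (axis j 1) $ i"
  by (simp add: jac_def matrix_def)

lemma has_derivative_jac:
  assumes "w differentiable (at x)" shows "(w has_derivative (\<lambda>v. jac w x *v v)) (at x)"
  using assms unfolding jac_def frechet_derivative_works
  by (simp add: matrix_works has_derivative_linear)

lemma jac_eqI:
  assumes "(w has_derivative f') (at x)" shows "jac w x $ i $ j = f' (axis j 1) $ i"
  by (simp add: jac_component frechet_derivative_at[OF assms, symmetric])

lemma norm_vec_le_sum: "norm (x::'a::real_normed_vector^'n) \<le> (\<Sum>i\<in>UNIV. norm (x $ i))"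
  unfolding norm_vec_def by (rule L2_set_le_sum) auto

lemma smooth_on_cube_facts:
  fixes w :: "real^'m \<Rightarrow> real^'n"
  assumes "w \<in> smooth_closure cube"
  shows "continuous_on (closure cube) w" "x \<in> cube \<Longrightarrow> w differentiable (at x)"
    "continuous_on cube (jac w)" "\<exists>C>0. \<forall>x\<in>cube. norm (jac w x) \<le> C"
    "\<exists>C>0. \<forall>x\<in>closure cube. norm (w x) \<le> C"
proof -
  have k: "Ck_closure (Suc 0) cube w" using assms unfolding smooth_closure_def by blast
  show c: "continuous_on (closure cube) w" using assms by (simp add: smooth_closure_def)
  show "w differentiable (at x)" if "x \<in> cube"
    using k that by (auto simp: differentiable_on_eq_differentiable_at open_cube)
  have "\<exists>g. continuous_on (closure cube) g \<and> (\<forall>x\<in>cube. g x = frechet_derivative w (at x) (axis j 1))" for j :: 'm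
    using k by (auto simp: extends_continuously_def Basis_vec_def)
  then obtain g where g: "\<And>j. continuous_on (closure cube) (g j)"
    "\<And>j x. x \<in> cube \<Longrightarrow> g j x = frechet_derivative w (at x) (axis j 1)" by metis
  define G where "G x = (\<chi> i j. g j x $ i)" for x
  have G: "continuous_on (closure cube) G"
    unfolding G_def by (intro continuous_intros g)
  have GJ: "G x = jac w x" if "x \<in> cube" for x
    using that g by (simp add: G_def vec_eq_iff jac_component)
  show "continuous_on cube (jac w)"
    using continuous_on_subset[OF G closure_subset] GJ by (simp cong: continuous_on_cong)
  have "bounded (G ` closure cube)" "bounded (w ` closure cube)"
    by (intro compact_imp_bounded compact_continuous_image G c compact_closure_cube)+
  then obtain C C' where C: "C > 0" "C' > 0" "\<And>x. x \<in> closure cube \<Longrightarrow> norm (G x) \<le> C"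
    "\<And>x. x \<in> closure cube \<Longrightarrow> norm (w x) \<le> C'"
    unfolding bounded_pos by blast
  have "norm (jac w x) \<le> C" if "x \<in> cube" for x
    using C(3)[of x] GJ[OF that] closure_subset[of cube] that by auto
  then show "\<exists>C>0. \<forall>x\<in>cube. norm (jac w x) \<le> C" using C by blast
  show "\<exists>C>0. \<forall>x\<in>closure cube. norm (w x) \<le> C" using C by blast
qed

lemma integrable_jac: "w \<in> smooth_closure cube \<Longrightarrow> integrable (lebesgue_on cube) (jac w)"
  using smooth_on_cube_facts(3,4)[of w] integrable_continuous_bounded_on_cube by blast

text \<open>The product of a component of the map with a test function, extended by zero, is differentiable on the
whole space since the test function vanishes near the boundary; its directional derivatives integrate to 0.\<close>

lemma has_weak_gradient_jac:
  fixes w :: "real^'m \<Rightarrow> real^'n"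
  assumes w: "w \<in> smooth_closure cube"
  shows "has_weak_gradient cube w (jac w)"
  unfolding has_weak_gradient_def
proof (intro conjI ballI allI)
  show "integrable (lebesgue_on cube) (jac w)" by (rule integrable_jac[OF w])
next
  fix \<psi> :: "real^'m \<Rightarrow> real" and i :: 'n and j :: 'm
  assume \<psi>: "\<psi> \<in> test_functions cube"
  let ?e = "axis j 1 :: real^'m"
  have e: "?e \<in> Basis" by (auto simp: Basis_vec_def)
  note P = test_function_facts[OF \<psi>]
  note W = smooth_on_cube_facts[OF w]
  let ?T = "closure {x. \<psi> x \<noteq> 0}"
  define g where "g x = (if x \<in> cube then w x $ i * \<psi> x else 0)" for x
  define g' where "g' x v = (if x \<in> cube then w x $ i * frechet_derivative \<psi> (at x) v
      + frechet_derivative w (at x) v $ i * \<psi> x else 0)" for x v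
  have dg: "(g has_derivative g' x) (at x)" for x
  proof (cases "x \<in> cube")
    case True
    have "((\<lambda>x. w x $ i * \<psi> x) has_derivative g' x) (at x)"
      using True W(2)[of x] P(2)[of x] unfolding frechet_derivative_works g'_def
      by (auto intro!: has_derivative_mult bounded_linear.has_derivative[OF bounded_linear_vec_nth])
    then show ?thesis
      by (rule has_derivative_transform_within_open[OF _ open_cube True]) (simp add: g_def)
  next
    case False
    then have x: "x \<in> - ?T" using P(5) by auto
    have z: "g y = 0" if "y \<in> - ?T" for y
      using that closure_subset[of "{x. \<psi> x \<noteq> 0}"] by (auto simp: g_def)
    have "((\<lambda>_. 0) has_derivative (\<lambda>_. 0)) (at x)" by simp
    then have "(g has_derivative (\<lambda>_. 0)) (at x)"
      by (rule has_derivative_transform_within_open[OF _ _ x]) (use z in auto)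
    then show ?thesis using False by (simp add: g'_def[abs_def])
  qed
  have c1: "continuous_on cube (\<lambda>x. w x $ i * frechet_derivative \<psi> (at x) ?e)"
    by (intro continuous_intros continuous_on_subset[OF W(1) closure_subset] continuous_on_subset[OF P(3)[OF e] subset_UNIV])
  have c2: "continuous_on cube (\<lambda>x. jac w x $ i $ j * \<psi> x)"
    by (intro continuous_intros W(3) continuous_on_subset[OF P(1) subset_UNIV])
  obtain C1 where C1: "C1 > 0" "\<And>x. x \<in> closure cube \<Longrightarrow> norm (w x) \<le> C1" using W(5) by blast
  obtain C2 where C2: "C2 > 0" "\<And>x. x \<in> cube \<Longrightarrow> norm (jac w x) \<le> C2" using W(4) by blast
  obtain C3 where C3: "C3 > 0" "\<And>x. \<bar>\<psi> x\<bar> \<le> C3" using test_function_bounded[OF \<psi>] by blast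
  obtain C4 where C4: "C4 > 0" "\<And>x. x \<in> closure cube \<Longrightarrow> \<bar>frechet_derivative \<psi> (at x) ?e\<bar> \<le> C4"
    using test_function_derivative_bounded[OF \<psi>] by blast
  have b1: "\<bar>w x $ i * frechet_derivative \<psi> (at x) ?e\<bar> \<le> C1 * C4" if "x \<in> cube" for x
  proof -
    have "x \<in> closure cube" using that closure_subset by blast
    then show ?thesis unfolding abs_mult
      using C1 C4 component_le_norm_cart[of "w x" i] by (intro mult_mono) force+
  qed
  have b2: "\<bar>jac w x $ i $ j * \<psi> x\<bar> \<le> C2 * C3" if "x \<in> cube" for x
  proof -
    have "\<bar>jac w x $ i $ j\<bar> \<le> C2"
      using component_le_norm_cart[of "jac w x $ i" j] Finite_Cartesian_Product.norm_nth_le[of "jac w x" i] C2(2)[OF that] by linarith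
    then show ?thesis unfolding abs_mult using C2 C3 by (intro mult_mono) auto
  qed
  have g'e: "g' x ?e = indicator cube x * (w x $ i * frechet_derivative \<psi> (at x) ?e + jac w x $ i $ j * \<psi> x)" for x
    by (auto simp: g'_def jac_component)
  have "(LINT x|lborel. g' x ?e) = 0"
  proof (rule integral_directional_derivative_eq_0[OF dg, where S=cube and C="C1 * C4 + C2 * C3"])
    show "\<bar>g' x ?e\<bar> \<le> C1 * C4 + C2 * C3" for x
      using b1[of x] b2[of x] C1 C2 C3 C4 unfolding g'e by (cases "x \<in> cube") auto
  qed (auto simp: g_def cube_eq_box)
  then have "(LINT x|lebesgue_on cube. w x $ i * frechet_derivative \<psi> (at x) ?e + jac w x $ i $ j * \<psi> x) = 0"
    using integral_lebesgue_on_cube_lborel[OF continuous_on_add[OF c1 c2]] by (simp add: g'e)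
  moreover have "integrable (lebesgue_on cube) (\<lambda>x. w x $ i * frechet_derivative \<psi> (at x) ?e)"
    "integrable (lebesgue_on cube) (\<lambda>x. jac w x $ i $ j * \<psi> x)"
    using c1 c2 b1 b2 by (auto intro!: integrable_continuous_bounded_on_cube)
  ultimately show "(LINT x|lebesgue_on cube. w x $ i * frechet_derivative \<psi> (at x) ?e)
      = - (LINT x|lebesgue_on cube. jac w x $ i $ j * \<psi> x)"
    by simp
qed

lemma integrable_vec_nth:
  fixes G :: "'a \<Rightarrow> 'b::euclidean_space^'n"
  shows "integrable M G \<Longrightarrow> integrable M (\<lambda>x. G x $ i)"
  by (rule integrable_bounded_linear[OF bounded_linear_vec_nth])

lemma integrable_mult_test_function:
  assumes f: "integrable (lebesgue_on cube) f" and \<psi>: "\<psi> \<in> test_functions \<Omega>"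
  shows "integrable (lebesgue_on cube) (\<lambda>x. f x * \<psi> x :: real)"
proof -
  obtain C where C: "C > 0" "\<And>x. \<bar>\<psi> x\<bar> \<le> C" using test_function_bounded[OF \<psi>] by blast
  show ?thesis
  proof (rule Bochner_Integration.integrable_bound[of _ "\<lambda>x. C * f x"])
    show "(\<lambda>x. f x * \<psi> x) \<in> borel_measurable (lebesgue_on cube)"
      using f \<psi> by (intro borel_measurable_times borel_measurable_integrable borel_measurable_continuous_on_cube
          continuous_on_subset[OF test_function_facts(1) subset_UNIV])
    have "\<bar>f x\<bar> * \<bar>\<psi> x\<bar> \<le> \<bar>f x\<bar> * C" for x by (rule mult_left_mono) (use C in auto)
    then show "AE x in lebesgue_on cube. norm (f x * \<psi> x) \<le> norm (C * f x)"
      using C by (intro AE_I2) (simp add: abs_mult mult.commute[of C])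
  qed (use f in simp)
qed

lemma has_weak_gradient_unique:
  fixes G H :: "real^'m \<Rightarrow> real^'m^'n"
  assumes "has_weak_gradient cube u G" "has_weak_gradient cube u H"
  shows "AE x in lebesgue_on cube. G x = H x"
proof -
  have "AE x in lebesgue_on cube. G x $ i $ j - H x $ i $ j = 0" for i j
  proof (rule AE_eq_0_if_test_integrals_eq_0)
    have I: "integrable (lebesgue_on cube) (\<lambda>x. G x $ i $ j)" "integrable (lebesgue_on cube) (\<lambda>x. H x $ i $ j)"
      using assms by (auto simp: has_weak_gradient_def intro: integrable_vec_nth)
    then show "integrable (lebesgue_on cube) (\<lambda>x. G x $ i $ j - H x $ i $ j)" by auto
    fix \<psi> :: "real^'m \<Rightarrow> real" assume \<psi>: "\<psi> \<in> test_functions cube"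
    have "(LINT x|lebesgue_on cube. G x $ i $ j * \<psi> x) = (LINT x|lebesgue_on cube. H x $ i $ j * \<psi> x)"
    proof -
      have "(LINT x|lebesgue_on cube. u x $ i * frechet_derivative \<psi> (at x) (axis j 1))
          = - (LINT x|lebesgue_on cube. G x $ i $ j * \<psi> x)"
        "(LINT x|lebesgue_on cube. u x $ i * frechet_derivative \<psi> (at x) (axis j 1))
          = - (LINT x|lebesgue_on cube. H x $ i $ j * \<psi> x)"
        using assms \<psi> unfolding has_weak_gradient_def by blast+
      then show ?thesis by linarith
    qed
    then show "(LINT x|lebesgue_on cube. (G x $ i $ j - H x $ i $ j) * \<psi> x) = 0"
      using I[THEN integrable_mult_test_function, OF \<psi>] by (simp add: left_diff_distrib)
  qed
  then have "AE x in lebesgue_on cube. \<forall>i\<in>UNIV. \<forall>j\<in>UNIV. G x $ i $ j - H x $ i $ j = 0"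
    by (intro AE_finite_allI finite)
  then show ?thesis by eventually_elim (simp add: vec_eq_iff)
qed

lemma weak_grad_AE_eq:
  "has_weak_gradient cube u G \<Longrightarrow> AE x in lebesgue_on cube. weak_grad cube u x = G x"
  unfolding weak_grad_def using has_weak_gradient_unique someI[of "has_weak_gradient cube u"] by blast

section \<open>Limits of smooth maps\<close>

text \<open>The points at which the faces are sampled all lie on the boundary of the cube.\<close>

lemma boundary_integral_eq_0:
  fixes f :: "real^'m \<Rightarrow> ennreal"
  assumes "\<And>x. x \<in> frontier cube \<Longrightarrow> f x = 0"
  shows "boundary_integral f = 0"
proof -
  have "(\<integral>\<^sup>+ x. f (\<chi> j. if j = i then s else x $ j) \<partial>lebesgue_on cube) = 0" if "s \<in> {-1, 1}" for i s
  proof -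
    have z: "f (\<chi> j. if j = i then s else x $ j) = 0" if "x \<in> cube" for x
      using that \<open>s \<in> {-1, 1}\<close>
      by (intro assms frontier_cubeI[where j=i]) (auto simp: cube_def less_imp_le)
    have "(\<integral>\<^sup>+ x. f (\<chi> j. if j = i then s else x $ j) \<partial>lebesgue_on cube) = (\<integral>\<^sup>+ (x::real^'m). 0 \<partial>lebesgue_on cube)"
      by (intro nn_integral_cong) (simp add: z)
    then show ?thesis by simp
  qed
  then show ?thesis by (simp add: boundary_integral_def)
qed

lemma borel_measurable_vec_nth_comp:
  fixes f :: "'a \<Rightarrow> 'b::real_normed_vector^'n"
  assumes "f \<in> borel_measurable M" shows "(\<lambda>x. f x $ i) \<in> borel_measurable M"
  by (rule measurable_compose[OF assms borel_measurable_continuous_onI]) (intro continuous_intros)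

text \<open>Dominated convergence gives convergence of the maps and of their derivatives in the mean, and with it
the weak gradient of the limit. Since the boundary values stay the same along the sequence, the distances
on the boundary are 0, and the common boundary values are the trace.\<close>

lemma smooth_approximation:
  fixes u :: "real^'m \<Rightarrow> real^'n"
  assumes w: "\<And>k. w k \<in> smooth_closure cube" and C: "\<And>k x. norm (w k x) \<le> C"
    and u: "AE x in lebesgue_on cube. (\<lambda>k. w k x) \<longlonglongrightarrow> u x"
    and H: "integrable (lebesgue_on cube) H" "\<And>k. AE x in lebesgue_on cube. norm (jac (w k) x) \<le> H x"
    and G: "AE x in lebesgue_on cube. (\<lambda>k. jac (w k) x) \<longlonglongrightarrow> G x"
    and um: "u \<in> borel_measurable (lebesgue_on cube)" and Gm: "G \<in> borel_measurable (lebesgue_on cube)"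
  shows "u \<in> W11 cube" "has_weak_gradient cube u G"
    "(\<And>k x. x \<in> frontier cube \<Longrightarrow> w k x = g x) \<Longrightarrow> has_trace u g"
proof -
  interpret finite_measure "lebesgue_on (cube :: (real^'m) set)" by (rule finite_measure_cube)
  have wm: "w k \<in> borel_measurable (lebesgue_on cube)" for k
    by (intro borel_measurable_continuous_on_cube continuous_on_subset[OF smooth_on_cube_facts(1)[OF w] closure_subset])
  have Jm: "jac (w k) \<in> borel_measurable (lebesgue_on cube)" for k
    by (intro borel_measurable_continuous_on_cube smooth_on_cube_facts(3)[OF w])
  have C0: "C \<ge> 0" using C[of 0 undefined] norm_ge_zero order_trans by blast
  have intu: "integrable (lebesgue_on cube) u"
    by (rule integrable_dominated_convergence[OF um wm, where w="\<lambda>_. C"]) (use u C in auto)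
  have intG: "integrable (lebesgue_on cube) G"
    by (rule integrable_dominated_convergence[OF Gm Jm, where w=H]) (use H G in auto)
  show wg: "has_weak_gradient cube u G"
    unfolding has_weak_gradient_def
  proof (intro conjI ballI allI intG)
    fix \<psi> :: "real^'m \<Rightarrow> real" and i :: 'n and j :: 'm
    assume \<psi>: "\<psi> \<in> test_functions cube"
    let ?e = "axis j 1 :: real^'m"
    have e: "?e \<in> Basis" by (auto simp: Basis_vec_def)
    note P = test_function_facts[OF \<psi>]
    obtain C3 where C3: "C3 > 0" "\<And>x. \<bar>\<psi> x\<bar> \<le> C3" using test_function_bounded[OF \<psi>] by blast
    obtain C4 where C4: "C4 > 0" "\<And>x. x \<in> closure cube \<Longrightarrow> \<bar>frechet_derivative \<psi> (at x) ?e\<bar> \<le> C4"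
      using test_function_derivative_bounded[OF \<psi>] by blast
    have \<psi>m: "\<psi> \<in> borel_measurable (lebesgue_on cube)"
      "(\<lambda>x. frechet_derivative \<psi> (at x) ?e) \<in> borel_measurable (lebesgue_on cube)"
      by (intro borel_measurable_continuous_on_cube continuous_on_subset[OF P(1) subset_UNIV]
          continuous_on_subset[OF P(3)[OF e] subset_UNIV])+
    have l1: "(\<lambda>k. LINT x|lebesgue_on cube. w k x $ i * frechet_derivative \<psi> (at x) ?e)
        \<longlonglongrightarrow> (LINT x|lebesgue_on cube. u x $ i * frechet_derivative \<psi> (at x) ?e)"
    proof (rule integral_dominated_convergence[where w="\<lambda>_. C * C4"])
      show "(\<lambda>x. w k x $ i * frechet_derivative \<psi> (at x) ?e) \<in> borel_measurable (lebesgue_on cube)" for k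
        by (intro borel_measurable_times borel_measurable_vec_nth_comp wm \<psi>m)
      show "(\<lambda>x. u x $ i * frechet_derivative \<psi> (at x) ?e) \<in> borel_measurable (lebesgue_on cube)"
        by (intro borel_measurable_times borel_measurable_vec_nth_comp um \<psi>m)
      show "AE x in lebesgue_on cube. (\<lambda>k. w k x $ i * frechet_derivative \<psi> (at x) ?e) \<longlonglongrightarrow> u x $ i * frechet_derivative \<psi> (at x) ?e"
        using u by eventually_elim (intro tendsto_intros)
      show "AE x in lebesgue_on cube. norm (w k x $ i * frechet_derivative \<psi> (at x) ?e) \<le> C * C4" for k
      proof (rule AE_I2)
        fix x :: "real^'m" assume "x \<in> space (lebesgue_on cube)"
        then have "x \<in> closure cube" using closure_subset by auto
        then show "norm (w k x $ i * frechet_derivative \<psi> (at x) ?e) \<le> C * C4"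
          using C4(2)[of x] C[of k x] component_le_norm_cart[of "w k x" i] C0
          by (auto simp: abs_mult intro!: mult_mono)
      qed
    qed simp
    have l2: "(\<lambda>k. LINT x|lebesgue_on cube. jac (w k) x $ i $ j * \<psi> x)
        \<longlonglongrightarrow> (LINT x|lebesgue_on cube. G x $ i $ j * \<psi> x)"
    proof (rule integral_dominated_convergence[where w="\<lambda>x. H x * C3"])
      show "(\<lambda>x. jac (w k) x $ i $ j * \<psi> x) \<in> borel_measurable (lebesgue_on cube)" for k
        by (intro borel_measurable_times borel_measurable_vec_nth_comp Jm \<psi>m)
      show "(\<lambda>x. G x $ i $ j * \<psi> x) \<in> borel_measurable (lebesgue_on cube)"
        by (intro borel_measurable_times borel_measurable_vec_nth_comp Gm \<psi>m)
      show "AE x in lebesgue_on cube. (\<lambda>k. jac (w k) x $ i $ j * \<psi> x) \<longlonglongrightarrow> G x $ i $ j * \<psi> x"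
        using G by eventually_elim (intro tendsto_intros)
      show "AE x in lebesgue_on cube. norm (jac (w k) x $ i $ j * \<psi> x) \<le> H x * C3" for k
        using H(2)[of k]
      proof eventually_elim
        case (elim x)
        have "\<bar>jac (w k) x $ i $ j\<bar> \<le> H x"
          using component_le_norm_cart[of "jac (w k) x $ i" j] Finite_Cartesian_Product.norm_nth_le[of "jac (w k) x" i] elim by linarith
        then show ?case using C3(2)[of x] by (auto simp: abs_mult intro!: mult_mono)
      qed
    qed (use H in simp)
    have "(LINT x|lebesgue_on cube. w k x $ i * frechet_derivative \<psi> (at x) ?e)
        = - (LINT x|lebesgue_on cube. jac (w k) x $ i $ j * \<psi> x)" for k
      using has_weak_gradient_jac[OF w[of k]] \<psi> unfolding has_weak_gradient_def by blast
    then show "(LINT x|lebesgue_on cube. u x $ i * frechet_derivative \<psi> (at x) ?e)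
        = - (LINT x|lebesgue_on cube. G x $ i $ j * \<psi> x)"
      using LIMSEQ_unique[OF l1] tendsto_minus[OF l2] by simp
  qed
  show "u \<in> W11 cube" using intu wg by (auto simp: W11_def)
  assume bd: "\<And>k x. x \<in> frontier cube \<Longrightarrow> w k x = g x"
  show "has_trace u g"
    unfolding has_trace_def
  proof (intro exI[of _ w] conjI allI w)
    have fin: "emeasure (lebesgue_on cube) (cube :: (real^'m) set) < top"
      using emeasure_finite[of "cube :: (real^'m) set"] unfolding infinity_ennreal_def less_top .
    have "(\<lambda>k. \<integral>\<^sup>+ x. ennreal (norm (u x - w k x)) \<partial>lebesgue_on cube) \<longlonglongrightarrow> 0"
      by (rule nn_integral_dominated_convergence_norm[where w="\<lambda>_. C"])
        (use wm um C u fin in \<open>auto simp: ennreal_mult_less_top\<close>)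
    then show "(\<lambda>k. \<integral>\<^sup>+ x. ennreal (norm (w k x - u x)) \<partial>lebesgue_on cube) \<longlonglongrightarrow> 0"
      by (simp add: norm_minus_commute)
    have "(\<lambda>k. \<integral>\<^sup>+ x. ennreal (norm (G x - jac (w k) x)) \<partial>lebesgue_on cube) \<longlonglongrightarrow> 0"
    proof (rule nn_integral_dominated_convergence_norm[where w="\<lambda>x. \<bar>H x\<bar>"])
      show "(\<integral>\<^sup>+ x. ennreal \<bar>H x\<bar> \<partial>lebesgue_on cube) < \<infinity>"
        using H(1) by (simp add: integrable_iff_bounded)
      show "AE x in lebesgue_on cube. norm (jac (w k) x) \<le> \<bar>H x\<bar>" for k
        using H(2)[of k] by eventually_elim simp
    qed (use Jm Gm H G in auto)
    moreover have "(\<integral>\<^sup>+ x. ennreal (norm (weak_grad cube (w k) x - weak_grad cube u x)) \<partial>lebesgue_on cube)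
        = (\<integral>\<^sup>+ x. ennreal (norm (G x - jac (w k) x)) \<partial>lebesgue_on cube)" for k
    proof (rule nn_integral_cong_AE)
      show "AE x in lebesgue_on cube. ennreal (norm (weak_grad cube (w k) x - weak_grad cube u x)) = ennreal (norm (G x - jac (w k) x))"
        using weak_grad_AE_eq[OF wg] weak_grad_AE_eq[OF has_weak_gradient_jac[OF w[of k]]]
        by eventually_elim (simp add: norm_minus_commute)
    qed
    ultimately show "(\<lambda>k. \<integral>\<^sup>+ x. ennreal (norm (weak_grad cube (w k) x - weak_grad cube u x)) \<partial>lebesgue_on cube) \<longlonglongrightarrow> 0"
      by simp
    have "boundary_integral (\<lambda>x. ennreal (norm (w k x - g x))) = 0" for k
      by (rule boundary_integral_eq_0) (simp add: bd)
    then show "(\<lambda>k. boundary_integral (\<lambda>x. ennreal (norm (w k x - g x)))) \<longlonglongrightarrow> 0" by simp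
  qed
qed

section \<open>Cantor sets as sets of restricted digit expansions\<close>

text \<open>The numbers with \<open>n\<close> digits in base \<open>L\<close>, all of them smaller than \<open>M\<close>. Dividing by \<open>L\<^sup>n\<close> gives
the left end points of the \<open>n\<close>-th stage of a self-similar set of dimension \<open>log M / log L\<close>. Adjacent
intervals of a stage may touch.\<close>

primrec digits :: "nat \<Rightarrow> nat \<Rightarrow> nat \<Rightarrow> nat set" where
  "digits L M 0 = {0}"
| "digits L M (Suc n) = (\<Union>a\<in>digits L M n. (\<lambda>j. L * a + j) ` {..<M})"

lemma finite_digits [simp]: "finite (digits L M n)"
  by (induction n) auto

lemma digits_less: "M \<le> L \<Longrightarrow> a \<in> digits L M n \<Longrightarrow> a < L ^ n"
proof (induction n arbitrary: a)
  case (Suc n)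
  then obtain b j where b: "b \<in> digits L M n" "j < M" "a = L * b + j" by auto
  then have "Suc b \<le> L ^ n" using Suc by (simp add: Suc_leI)
  then have "L * Suc b \<le> L * L ^ n" by (rule mult_left_mono) simp
  then show ?case using b Suc.prems by simp
qed simp

lemma digit_blocks_disjoint:
  fixes a b :: nat
  assumes "M \<le> L" "a \<noteq> b"
  shows "(\<lambda>j. L * a + j) ` {..<M} \<inter> (\<lambda>j. L * b + j) ` {..<M} = {}"
proof (rule ccontr)
  assume "(\<lambda>j. L * a + j) ` {..<M} \<inter> (\<lambda>j. L * b + j) ` {..<M} \<noteq> {}"
  then obtain i j where ij: "i < M" "j < M" "L * a + i = L * b + j" by blast
  then have "i < L" "j < L" using assms by auto
  then have "(L * a + i) div L = a" "(L * b + j) div L = b" by simp_all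
  then show False using ij assms(2) by metis
qed

lemma card_digits:
  assumes "M \<le> L" shows "card (digits L M n) = M ^ n"
proof (induction n)
  case (Suc n)
  have "card (digits L M (Suc n)) = (\<Sum>a\<in>digits L M n. card ((\<lambda>j. L * a + j) ` {..<M}))"
    unfolding digits.simps
    by (rule card_UN_disjoint) (use assms digit_blocks_disjoint in auto)
  also have "\<dots> = (\<Sum>a\<in>digits L M n. M)"
    by (intro sum.cong refl) (simp add: card_image inj_on_def)
  finally show ?case using Suc by simp
qed simp

lemma div_Suc_digit: "(j::nat) < L \<Longrightarrow> (L * a + j) div L ^ Suc k = a div L ^ k"
proof -
  assume "j < L"
  then have "(L * a + j) div L = a" by (simp add: div_mult_self4)
  then show ?thesis by (simp add: div_mult2_eq)
qed

lemma digits_div: "M \<le> L \<Longrightarrow> a \<in> digits L M (n + k) \<Longrightarrow> a div L ^ k \<in> digits L M n"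
proof (induction k arbitrary: a)
  case (Suc k)
  then obtain b j where "b \<in> digits L M (n + k)" "j < M" "a = L * b + j" by auto
  then show ?case using Suc div_Suc_digit[of j L b k] by simp
qed simp

text \<open>The fibre consists of the continuations of \<open>b\<close> by \<open>k\<close> further digits.\<close>

lemma card_digits_fiber:
  assumes "M \<le> L"
  shows "card {a \<in> digits L M (n + k). a div L ^ k = b} \<le> M ^ k"
proof (induction k)
  case 0
  have "{a \<in> digits L M (n + 0). a div L ^ 0 = b} \<subseteq> {b}" by auto
  then show ?case using card_mono[of "{b}"] by fastforce
next
  case (Suc k)
  let ?F = "{a \<in> digits L M (n + k). a div L ^ k = b}"
  have "{a \<in> digits L M (n + Suc k). a div L ^ Suc k = b} \<subseteq> (\<Union>a\<in>?F. (\<lambda>j. L * a + j) ` {..<M})"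
  proof
    fix x assume x: "x \<in> {a \<in> digits L M (n + Suc k). a div L ^ Suc k = b}"
    then obtain a j where a: "a \<in> digits L M (n + k)" "j < M" "x = L * a + j" by auto
    moreover have "a div L ^ k = b" using x a div_Suc_digit[of j L a k] assms by simp
    ultimately show "x \<in> (\<Union>a\<in>?F. (\<lambda>j. L * a + j) ` {..<M})" by auto
  qed
  then have "card {a \<in> digits L M (n + Suc k). a div L ^ Suc k = b} \<le> card (\<Union>a\<in>?F. (\<lambda>j. L * a + j) ` {..<M})"
    by (intro card_mono) auto
  also have "\<dots> \<le> (\<Sum>a\<in>?F. card ((\<lambda>j. L * a + j) ` {..<M}))"
    by (rule card_UN_le) auto
  also have "\<dots> \<le> (\<Sum>a\<in>?F. M)"
    by (intro sum_mono) (use card_image_le[of "{..<M}"] in auto)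
  also have "\<dots> \<le> M ^ Suc k" using Suc by (simp add: mult.commute)
  finally show ?case .
qed

lemma digits_extend: "0 < M \<Longrightarrow> a \<in> digits L M n \<Longrightarrow> L ^ k * a \<in> digits L M (n + k)"
proof (induction k)
  case (Suc k)
  then have "L * (L ^ k * a) + 0 \<in> digits L M (Suc (n + k))" unfolding digits.simps by blast
  then show ?case by (simp add: mult.assoc)
qed simp

text \<open>The reciprocal of the scale of the \<open>n\<close>-th stage. The factor 16 shrinks the whole set into the interval
from 0 to 1/16 and leaves enough room inside the cube for all cutoffs, including those of stage 0.\<close>

definition res :: "nat \<Rightarrow> nat \<Rightarrow> real" where
  "res L n = 16 * real L ^ n"

definition corner_points :: "nat \<Rightarrow> nat \<Rightarrow> nat \<Rightarrow> real set" where
  "corner_points L M n = (\<lambda>a. real a / res L n) ` digits L M n"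

lemma res_pos: "0 < L \<Longrightarrow> 0 < res L n"
  by (simp add: res_def)

lemma res_Suc: "res L (Suc n) = real L * res L n"
  by (simp add: res_def)

lemma res_add: "res L (n + k) = real L ^ k * res L n"
  by (simp add: res_def power_add)

lemma corner_points_mono: "0 < M \<Longrightarrow> 0 < L \<Longrightarrow> n \<le> k \<Longrightarrow> corner_points L M n \<subseteq> corner_points L M k"
proof clarify
  fix x assume *: "0 < M" "0 < L" "n \<le> k" "x \<in> corner_points L M n"
  then obtain a where a: "a \<in> digits L M n" "x = real a / res L n" by (auto simp: corner_points_def)
  have "x = real (L ^ (k - n) * a) / res L k"
    using a * res_add[of L n "k - n"] by simp
  moreover have "L ^ (k - n) * a \<in> digits L M k" using digits_extend[OF *(1) a(1), of "k - n"] * by simp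
  ultimately show "x \<in> corner_points L M k" unfolding corner_points_def by blast
qed

text \<open>For a coarser stage \<open>n\<close> the trailing digits are dropped, for a finer one zeros are appended.\<close>

lemma corner_points_cover:
  assumes "0 < M" "M \<le> L" "e \<in> corner_points L M k"
  shows "\<exists>a\<in>digits L M n. 0 \<le> e * res L n - real a \<and> e * res L n - real a \<le> 1"
proof -
  have L: "0 < L" using assms by simp
  show ?thesis
  proof (cases "k \<le> n")
    case True
    then have "e \<in> corner_points L M n" using corner_points_mono[OF assms(1) L] assms by blast
    then show ?thesis using res_pos[OF L, of n] by (auto simp: corner_points_def)
  next
    case False
    then obtain d where k: "k = n + d" using le_Suc_ex[of n k] by auto
    obtain a where a: "a \<in> digits L M k" "e = real a / res L k" using assms(3) by (auto simp: corner_points_def)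
    let ?b = "a div L ^ d"
    have e: "e * res L n = real a / real L ^ d"
      using a k L res_pos[OF L, of n] by (simp add: res_add)
    have "?b * L ^ d \<le> a" "a < (Suc ?b) * L ^ d"
      using L dividend_less_div_times[of "L ^ d" a] by auto
    then have "real ?b * real L ^ d \<le> real a" "real a \<le> (real ?b + 1) * real L ^ d"
      by (metis of_nat_le_iff of_nat_mult of_nat_power, metis less_imp_le of_nat_Suc add.commute of_nat_le_iff of_nat_mult of_nat_power)
    then have "real ?b \<le> e * res L n" "e * res L n \<le> real ?b + 1"
      using L unfolding e by (simp_all add: pos_le_divide_eq pos_divide_le_eq)
    moreover have "?b \<in> digits L M n" using digits_div a k assms by blast
    ultimately show ?thesis by force
  qed
qed

lemma card_nat_interval:
  assumes "\<And>a. a \<in> A \<Longrightarrow> x \<le> real a \<and> real a \<le> y"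
  shows "finite A \<and> card A \<le> nat (\<lfloor>y\<rfloor> - \<lceil>x\<rceil> + 1)"
proof -
  have sub: "int ` A \<subseteq> {\<lceil>x\<rceil>..\<lfloor>y\<rfloor>}" using assms by (auto simp: ceiling_le_iff le_floor_iff)
  then have fin: "finite (int ` A)" using finite_subset by blast
  then have "finite A" by (simp add: finite_image_iff)
  moreover have "card A = card (int ` A)" by (simp add: card_image)
  ultimately show ?thesis using card_mono[OF _ sub] by simp
qed

text \<open>At most six integers lie in a closed interval of length 5.\<close>

lemma sum_localized_bound:
  fixes h :: "real \<Rightarrow> real"
  assumes A: "finite A" and C: "\<And>v. \<bar>h v\<bar> \<le> C" and z: "\<And>v. v < -2 \<or> v > 3 \<Longrightarrow> h v = 0"
  shows "\<bar>\<Sum>a\<in>A. h (u - real a)\<bar> \<le> 6 * C"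
proof -
  let ?B = "{a \<in> A. -2 \<le> u - real a \<and> u - real a \<le> 3}"
  have "card ?B \<le> nat (\<lfloor>u + 2\<rfloor> - \<lceil>u - 3\<rceil> + 1)"
    using card_nat_interval[of ?B "u - 3" "u + 2"] by auto
  also have "\<dots> \<le> 6"
    using ceiling_correct[of "u - 3"] floor_correct[of "u + 2"] by linarith
  finally have c: "card ?B \<le> 6" .
  have "(\<Sum>a\<in>A. h (u - real a)) = (\<Sum>a\<in>?B. h (u - real a))"
    by (rule sum.mono_neutral_right) (use A z in \<open>auto simp: not_le[symmetric] intro: ccontr\<close>)
  then have "\<bar>\<Sum>a\<in>A. h (u - real a)\<bar> \<le> (\<Sum>a\<in>?B. \<bar>h (u - real a)\<bar>)"
    by (simp only: sum_abs)
  also have "\<dots> \<le> (\<Sum>a\<in>?B. C)"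
    by (intro sum_mono C)
  also have "\<dots> \<le> 6 * C"
    using c C[of 0] abs_ge_zero[of "h 0"] by (simp add: mult_right_mono)
  finally show ?thesis .
qed

text \<open>A window no longer than the scale of stage \<open>n\<close> meets the continuations of at most two numbers of
that stage. This is the upper mass bound of the Cantor measure, in terms of counts.\<close>

lemma card_digits_window:
  assumes le: "M \<le> L" "0 < L" and n: "n \<le> N" and zeta: "\<zeta> * res L n \<le> 1"
  shows "card {a \<in> digits L M N. 0 \<le> y - real a / res L N \<and> y - real a / res L N \<le> \<zeta>} \<le> 2 * M ^ (N - n)"
    (is "card ?W \<le> _")
proof -
  let ?d = "N - n"
  let ?v = "y * res L n"
  let ?B = "(\<lambda>a. a div L ^ ?d) ` ?W"
  have N: "res L N = real L ^ ?d * res L n" using res_add[of L n ?d] n by simp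
  have b: "?v - 2 < real b \<and> real b \<le> ?v" if bB: "b \<in> ?B" for b
  proof -
    obtain a where a: "b = a div L ^ ?d" "0 \<le> y - real a / res L N" "y - real a / res L N \<le> \<zeta>" using bB by blast
    have e: "real a / res L N * res L n = real a / real L ^ ?d"
      using res_pos[OF le(2), of n] le by (simp add: N)
    have "b * L ^ ?d \<le> a" "a < (Suc b) * L ^ ?d"
      using le dividend_less_div_times[of "L ^ ?d" a] unfolding a(1) by simp_all
    then have "real b * real L ^ ?d \<le> real a" "real a < (real b + 1) * real L ^ ?d"
      by (metis of_nat_le_iff of_nat_mult of_nat_power, metis of_nat_Suc add.commute of_nat_less_iff of_nat_mult of_nat_power)
    then have 1: "real b \<le> real a / real L ^ ?d" "real a / real L ^ ?d < real b + 1"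
      using le by (simp_all add: pos_le_divide_eq pos_divide_less_eq)
    have "(y - real a / res L N) * res L n \<le> \<zeta> * res L n"
      using a res_pos[OF le(2), of n] by (intro mult_right_mono) auto
    then have 2: "?v - real a / real L ^ ?d \<le> 1" using zeta e by (simp add: left_diff_distrib)
    have "0 \<le> (y - real a / res L N) * res L n"
      using a res_pos[OF le(2), of n] by simp
    then have "real a / real L ^ ?d \<le> ?v" using e by (simp add: left_diff_distrib)
    then show ?thesis using 1 2 by linarith
  qed
  (* The quotients lie in a half-open interval of length 2. *)
  have "card ?B \<le> nat (\<lfloor>?v\<rfloor> - \<lceil>real_of_int (\<lfloor>?v\<rfloor> - 1)\<rceil> + 1)"
  proof (rule card_nat_interval[THEN conjunct2])
    fix a assume "a \<in> ?B"
    from b[OF this] have "?v - 2 < real a" "real a \<le> ?v" by auto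
    then have "\<lfloor>?v\<rfloor> - 2 < int a" by linarith
    then have "\<lfloor>?v\<rfloor> - 1 \<le> int a" by linarith
    then show "real_of_int (\<lfloor>?v\<rfloor> - 1) \<le> real a \<and> real a \<le> ?v" using \<open>real a \<le> ?v\<close> by linarith
  qed
  then have cB: "card ?B \<le> 2" by simp
  have "?W \<subseteq> (\<Union>b\<in>?B. {a \<in> digits L M (n + ?d). a div L ^ ?d = b})"
    using n by auto
  then have "card ?W \<le> card (\<Union>b\<in>?B. {a \<in> digits L M (n + ?d). a div L ^ ?d = b})"
    by (intro card_mono) auto
  also have "\<dots> \<le> (\<Sum>b\<in>?B. card {a \<in> digits L M (n + ?d). a div L ^ ?d = b})"
    by (rule card_UN_le) auto
  also have "\<dots> \<le> (\<Sum>b\<in>?B. M ^ ?d)"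
    by (intro sum_mono card_digits_fiber le)
  also have "\<dots> \<le> 2 * M ^ ?d" using cB by simp
  finally show ?thesis .
qed

section \<open>Smoothed staircases and cutoffs\<close>

lemma smooth1_affine: "smooth1 h \<Longrightarrow> smooth1 (\<lambda>t. h (c * t + d))"
  by (rule smooth1.comp[OF _ smooth1.add[OF smooth1.mult[OF smooth1.const smooth1.ident] smooth1.const]])

lemma smooth1_sum: "(\<And>i. i \<in> I \<Longrightarrow> smooth1 (f i)) \<Longrightarrow> smooth1 (\<lambda>t. \<Sum>i\<in>I. f i t)"
proof (induction I rule: infinite_finite_induct)
  case (insert x F)
  then show ?case by (simp add: smooth1.add)
qed (simp_all add: smooth1.const)

lemma smooth1_minus: "smooth1 f \<Longrightarrow> smooth1 g \<Longrightarrow> smooth1 (\<lambda>t. f t - g t)"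
  using smooth1.add[OF _ smooth1.mult[OF smooth1.const[of "-1"]], of f g] by simp

lemma smooth1_divide: "smooth1 f \<Longrightarrow> smooth1 (\<lambda>t. f t / c)"
  using smooth1.mult[OF _ smooth1.const[of "inverse c"], of f] by (simp add: divide_inverse)

text \<open>The \<open>n\<close>-th stage of the Cantor set, a finite union of closed intervals.\<close>

definition near :: "nat \<Rightarrow> nat \<Rightarrow> nat \<Rightarrow> real \<Rightarrow> bool" where
  "near L M n t \<longleftrightarrow> (\<exists>a\<in>digits L M n. 0 \<le> t * res L n - real a \<and> t * res L n - real a \<le> 1)"

text \<open>A neighbourhood of the \<open>n\<close>-th stage that is large enough for the supports of all functions of that stage.\<close>

definition around :: "nat \<Rightarrow> nat \<Rightarrow> nat \<Rightarrow> real \<Rightarrow> bool" where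
  "around L M n t \<longleftrightarrow> (\<exists>a\<in>digits L M n. -2 \<le> t * res L n - real a \<and> t * res L n - real a \<le> 3)"

lemma near_imp_around: "near L M n t \<Longrightarrow> around L M n t"
  unfolding near_def around_def by (meson order_trans neg_le_0_iff_le zero_le_numeral one_le_numeral)

lemma near_Suc:
  assumes "M \<le> L" "0 < L" "near L M (Suc n) t" shows "near L M n t"
proof -
  obtain a j where a: "a \<in> digits L M n" "j < M"
    "0 \<le> t * res L (Suc n) - real (L * a + j)" "t * res L (Suc n) - real (L * a + j) \<le> 1"
    using assms(3) by (auto simp: near_def)
  have "real j + 1 \<le> real L" using a assms by simp
  moreover define X where "X = t * res L n - real a"
  moreover have "t * res L (Suc n) - real (L * a + j) = real L * X - real j"
    by (simp add: X_def res_Suc algebra_simps)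
  ultimately have "0 \<le> real L * X" "real L * X \<le> real L * 1"
    using a by linarith+
  then have "0 \<le> X" "X \<le> 1"
    using assms(2) by (simp add: zero_le_mult_iff, simp only: mult_le_cancel_left_pos of_nat_0_less_iff)
  then show ?thesis using a by (auto simp: near_def X_def)
qed

lemma near_antimono:
  assumes "M \<le> L" "0 < L" "n \<le> k" "near L M k t" shows "near L M n t"
  using assms(3,4) by (induction rule: dec_induct) (use near_Suc[OF assms(1,2)] in blast)+

text \<open>A smoothed distribution function of the uniform measure on the \<open>n\<close>-th stage; the limit is the devil's
staircase.\<close>

definition stair :: "nat \<Rightarrow> nat \<Rightarrow> nat \<Rightarrow> real \<Rightarrow> real" where
  "stair L M n t = (\<Sum>a\<in>digits L M n. step (t * res L n - real a)) / real M ^ n"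

definition stair' :: "nat \<Rightarrow> nat \<Rightarrow> nat \<Rightarrow> real \<Rightarrow> real" where
  "stair' L M n t = (\<Sum>a\<in>digits L M n. step' (t * res L n - real a)) * res L n / real M ^ n"

lemma smooth1_stair: "smooth1 (stair L M n)"
  unfolding stair_def[abs_def]
proof (intro smooth1_divide smooth1_sum)
  fix a show "smooth1 (\<lambda>t. step (t * res L n - real a))"
    using smooth1_affine[OF smooth1_step, of "res L n" "- real a"] by (simp add: mult.commute)
qed

lemma stair_deriv: "(stair L M n has_real_derivative stair' L M n t) (at t)"
  unfolding stair_def[abs_def] stair'_def sum_distrib_right
proof (intro DERIV_cdivide DERIV_sum)
  fix a
  have "((\<lambda>t. t * res L n - real a) has_real_derivative res L n) (at t)"
    by (auto intro!: derivative_eq_intros)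
  from DERIV_chain2[OF step_deriv this]
  show "((\<lambda>t. step (t * res L n - real a)) has_real_derivative step' (t * res L n - real a) * res L n) (at t)" .
qed

lemma stair_0: "t \<le> 0 \<Longrightarrow> 0 < L \<Longrightarrow> stair L M n t = 0"
proof -
  assume t: "t \<le> 0" "0 < L"
  then have "t * res L n \<le> 0" using res_pos[of L n] by (simp add: mult_le_0_iff)
  then have "step (t * res L n - real a) = 0" for a by (intro step_0) linarith
  then show ?thesis by (simp add: stair_def)
qed

lemma stair_1:
  assumes "t \<ge> 1 / 16" "0 < M" "M \<le> L" shows "stair L M n t = 1"
proof -
  have "step (t * res L n - real a) = 1" if "a \<in> digits L M n" for a
  proof (rule step_1)
    have "real a + 1 \<le> real L ^ n" using digits_less[OF assms(3) that] by (metis Suc_leI of_nat_Suc of_nat_le_iff of_nat_power add.commute)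
    also have "\<dots> = 1 / 16 * res L n" by (simp add: res_def)
    also have "\<dots> \<le> t * res L n" using assms by (intro mult_right_mono) (auto simp: res_def)
    finally show "1 \<le> t * res L n - real a" by simp
  qed
  then show ?thesis using assms card_digits[OF assms(3), of n] by (simp add: stair_def)
qed

text \<open>Of the summands at most six are nonzero, and each of them is \<open>O(L\<^sup>n / M\<^sup>n)\<close>.\<close>

lemma stair'_bound:
  "\<exists>C>0. \<forall>L M n t. 0 < M \<longrightarrow> \<bar>stair' L M n t\<bar> \<le> C * (real L / real M) ^ n"
proof -
  obtain C where C: "C > 0" "\<And>t. \<bar>step' t\<bar> \<le> C" using step'_bounded by blast
  have "\<bar>stair' L M n t\<bar> \<le> 6 * C * 16 * (real L / real M) ^ n" if "0 < M" for L M n t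
  proof -
    have "\<bar>\<Sum>a\<in>digits L M n. step' (t * res L n - real a)\<bar> \<le> 6 * C"
      by (rule sum_localized_bound) (use C step'_eq_0 in auto)
    then have "\<bar>\<Sum>a\<in>digits L M n. step' (t * res L n - real a)\<bar> * (res L n / real M ^ n) \<le> 6 * C * (res L n / real M ^ n)"
      by (intro mult_right_mono) (auto simp: res_def)
    then show ?thesis by (simp add: stair'_def res_def power_divide abs_mult)
  qed
  then show ?thesis using C by (intro exI[of _ "6 * C * 16"]) auto
qed

lemma stair'_eq_0: "\<not> near L M n t \<Longrightarrow> stair' L M n t = 0"
proof -
  assume n: "\<not> near L M n t"
  have "step' (t * res L n - real a) = 0" if "a \<in> digits L M n" for a
    using n that by (intro step'_eq_0) (auto simp: near_def)
  then show ?thesis by (simp add: stair'_def)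
qed

text \<open>The change that is caused in one step of the staircase by subdividing it into \<open>M\<close> smaller steps. It
vanishes on both sides of the unit interval, which keeps the corrections inside the stages.\<close>

definition refine :: "nat \<Rightarrow> nat \<Rightarrow> real \<Rightarrow> real" where
  "refine L M u = (\<Sum>j<M. step (real L * u - real j)) / real M - step u"

lemma refine_bound: "0 < M \<Longrightarrow> \<bar>refine L M u\<bar> \<le> 1"
proof -
  assume M: "0 < M"
  have "(\<Sum>j<M. step (real L * u - real j)) \<le> (\<Sum>j<M. 1)" by (intro sum_mono step_bounds)
  moreover have "0 \<le> (\<Sum>j<M. step (real L * u - real j))" by (intro sum_nonneg step_bounds)
  ultimately have "0 \<le> (\<Sum>j<M. step (real L * u - real j)) / real M" "(\<Sum>j<M. step (real L * u - real j)) / real M \<le> 1"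
    using M by (simp_all add: divide_le_eq)
  then show ?thesis using step_bounds[of u] unfolding refine_def by linarith
qed

lemma refine_eq_0: "0 < M \<Longrightarrow> M \<le> L \<Longrightarrow> u \<le> 0 \<or> u \<ge> 1 \<Longrightarrow> refine L M u = 0"
proof (elim disjE)
  assume "0 < M" "M \<le> L" "u \<le> 0"
  then have "real L * u \<le> 0" by (simp add: mult_le_0_iff)
  then have "step (real L * u - real j) = 0" for j by (intro step_0) linarith
  then show ?thesis using \<open>u \<le> 0\<close> by (simp add: refine_def step_0)
next
  assume *: "0 < M" "M \<le> L" "u \<ge> 1"
  have "step (real L * u - real j) = 1" if "j < M" for j
  proof (rule step_1)
    have "real L * 1 \<le> real L * u" using * by (intro mult_left_mono) auto
    moreover have "real j + 1 \<le> real L" using that * by simp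
    ultimately show "1 \<le> real L * u - real j" by linarith
  qed
  then show ?thesis using * by (simp add: refine_def step_1)
qed

definition stair_diff :: "nat \<Rightarrow> nat \<Rightarrow> nat \<Rightarrow> real \<Rightarrow> real" where
  "stair_diff L M n t = stair L M (Suc n) t - stair L M n t"

lemma stair_diff_eq:
  assumes "0 < M" "M \<le> L"
  shows "stair_diff L M n t = (\<Sum>a\<in>digits L M n. refine L M (t * res L n - real a)) / real M ^ n"
proof -
  have "(\<Sum>b\<in>digits L M (Suc n). step (t * res L (Suc n) - real b))
      = (\<Sum>a\<in>digits L M n. \<Sum>b\<in>(\<lambda>j. L * a + j) ` {..<M}. step (t * res L (Suc n) - real b))"
    unfolding digits.simps
    by (rule sum.UNION_disjoint) (use assms digit_blocks_disjoint in auto)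
  also have "\<dots> = (\<Sum>a\<in>digits L M n. \<Sum>j<M. step (real L * (t * res L n - real a) - real j))"
  proof (rule sum.cong[OF refl])
    fix a
    have "(\<Sum>b\<in>(\<lambda>j. L * a + j) ` {..<M}. step (t * res L (Suc n) - real b))
        = (\<Sum>j<M. step (t * res L (Suc n) - real (L * a + j)))"
      by (subst sum.reindex) (auto simp: inj_on_def)
    then show "(\<Sum>b\<in>(\<lambda>j. L * a + j) ` {..<M}. step (t * res L (Suc n) - real b))
        = (\<Sum>j<M. step (real L * (t * res L n - real a) - real j))"
      by (simp add: res_Suc algebra_simps)
  qed
  finally show ?thesis
    using assms by (simp add: stair_diff_def stair_def refine_def sum_subtractf diff_divide_distrib sum_divide_distrib)
qed

lemma stair_diff_bound:
  assumes "0 < M" "M \<le> L" shows "\<bar>stair_diff L M n t\<bar> \<le> 6 / real M ^ n"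
proof -
  have "\<bar>\<Sum>a\<in>digits L M n. refine L M (t * res L n - real a)\<bar> \<le> 6 * 1"
    by (rule sum_localized_bound) (use assms refine_bound refine_eq_0 in auto)
  then show ?thesis using assms by (simp add: stair_diff_eq abs_divide divide_right_mono)
qed

lemma stair_diff_eq_0: "0 < M \<Longrightarrow> M \<le> L \<Longrightarrow> \<not> near L M n t \<Longrightarrow> stair_diff L M n t = 0"
proof -
  assume *: "0 < M" "M \<le> L" "\<not> near L M n t"
  have "refine L M (t * res L n - real a) = 0" if "a \<in> digits L M n" for a
    using * that by (intro refine_eq_0) (auto simp: near_def)
  then show ?thesis using * by (simp add: stair_diff_eq)
qed

text \<open>Equal to 1 from -1 to 2 and to 0 outside the interval from -2 to 3, hence equal to 1 near the unit interval with a
margin of one unit on both sides.\<close>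

definition bump :: "real \<Rightarrow> real" where
  "bump v = step (v + 2) * step (3 - v)"

definition bump' :: "real \<Rightarrow> real" where
  "bump' v = step' (v + 2) * step (3 - v) - step (v + 2) * step' (3 - v)"

lemma bump_bounds: "0 \<le> bump v" "bump v \<le> 1"
  using step_bounds[of "v + 2"] step_bounds[of "3 - v"] by (auto simp: bump_def intro: mult_le_one)

lemma bump_deriv: "(bump has_real_derivative bump' v) (at v)"
proof -
  have "((\<lambda>v. step (v + 2)) has_real_derivative step' (v + 2) * 1) (at v)"
    by (rule DERIV_chain2[OF step_deriv]) (auto intro!: derivative_eq_intros)
  moreover have "((\<lambda>v. step (3 - v)) has_real_derivative step' (3 - v) * (-1)) (at v)"
    by (rule DERIV_chain2[OF step_deriv]) (auto intro!: derivative_eq_intros)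
  ultimately show ?thesis
    unfolding bump_def[abs_def] bump'_def by (auto intro!: derivative_eq_intros)
qed

lemma smooth1_bump: "smooth1 bump"
  using smooth1.mult[OF smooth1_affine[OF smooth1_step, of 1 2] smooth1_affine[OF smooth1_step, of "-1" 3]]
  by (simp add: bump_def[abs_def])

text \<open>A cutoff around the \<open>n\<close>-th stage. Composing the sum of the overlapping bumps with \<open>step\<close> makes it
locally constant wherever some bump equals 1.\<close>

definition cut :: "nat \<Rightarrow> nat \<Rightarrow> nat \<Rightarrow> real \<Rightarrow> real" where
  "cut L M n t = step (\<Sum>a\<in>digits L M n. bump (t * res L n - real a))"

definition cut' :: "nat \<Rightarrow> nat \<Rightarrow> nat \<Rightarrow> real \<Rightarrow> real" where
  "cut' L M n t = step' (\<Sum>a\<in>digits L M n. bump (t * res L n - real a)) *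
     ((\<Sum>a\<in>digits L M n. bump' (t * res L n - real a)) * res L n)"

lemma smooth1_cut: "smooth1 (cut L M n)"
  unfolding cut_def[abs_def]
proof (intro smooth1.comp[OF smooth1_step] smooth1_sum)
  fix a show "smooth1 (\<lambda>t. bump (t * res L n - real a))"
    using smooth1_affine[OF smooth1_bump, of "res L n" "- real a"] by (simp add: mult.commute)
qed

lemma cut_deriv: "(cut L M n has_real_derivative cut' L M n t) (at t)"
  unfolding cut_def[abs_def] cut'_def
proof (intro DERIV_chain2[OF step_deriv])
  show "((\<lambda>t. \<Sum>a\<in>digits L M n. bump (t * res L n - real a)) has_real_derivative
      (\<Sum>a\<in>digits L M n. bump' (t * res L n - real a)) * res L n) (at t)"
    unfolding sum_distrib_right
  proof (intro DERIV_sum)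
    fix a
    have "((\<lambda>t. t * res L n - real a) has_real_derivative res L n) (at t)"
      by (auto intro!: derivative_eq_intros)
    from DERIV_chain2[OF bump_deriv this]
    show "((\<lambda>t. bump (t * res L n - real a)) has_real_derivative bump' (t * res L n - real a) * res L n) (at t)" .
  qed
qed

lemma cut_bounds: "0 \<le> cut L M n t" "cut L M n t \<le> 1"
  by (simp_all add: cut_def step_bounds)

lemma bump'_eq_0: "v < -2 \<or> v > 3 \<Longrightarrow> bump' v = 0"
  by (auto simp: bump'_def step_0 step'_eq_0)

lemma cut'_bound: "\<exists>C>0. \<forall>L M n t. \<bar>cut' L M n t\<bar> \<le> C * real L ^ n"
proof -
  obtain C where C: "C > 0" "\<And>t. \<bar>step' t\<bar> \<le> C" using step'_bounded by blast
  have b: "\<bar>bump' v\<bar> \<le> 2 * C" for v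
  proof -
    have "\<bar>step' (v + 2) * step (3 - v)\<bar> \<le> C * 1" "\<bar>step (v + 2) * step' (3 - v)\<bar> \<le> 1 * C"
      unfolding abs_mult using C step_bounds by (intro mult_mono; auto)+
    then show ?thesis unfolding bump'_def by linarith
  qed
  have "\<bar>cut' L M n t\<bar> \<le> C * (6 * (2 * C) * 16) * real L ^ n" for L M n t
  proof -
    have "\<bar>\<Sum>a\<in>digits L M n. bump' (t * res L n - real a)\<bar> \<le> 6 * (2 * C)"
      by (rule sum_localized_bound) (use b bump'_eq_0 in auto)
    then have "\<bar>cut' L M n t\<bar> \<le> C * (6 * (2 * C) * res L n)"
      unfolding cut'_def abs_mult using C by (intro mult_mono) (auto simp: res_def)
    then show ?thesis by (simp add: res_def mult_ac)
  qed
  then show ?thesis using C by (intro exI[of _ "C * (6 * (2 * C) * 16)"]) auto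
qed

lemma cut_eq_0:
  assumes "\<not> around L M n t" shows "cut L M n t = 0" "cut' L M n t = 0"
proof -
  have "bump (t * res L n - real a) = 0" if "a \<in> digits L M n" for a
    using assms that by (auto simp: bump_def around_def step_0 not_le)
  then show "cut L M n t = 0" "cut' L M n t = 0" by (simp_all add: cut_def cut'_def step_0 step'_eq_0)
qed

lemma cut_eq_1:
  assumes "a \<in> digits L M n" "-1 \<le> t * res L n - real a" "t * res L n - real a \<le> 2"
  shows "cut L M n t = 1" "cut' L M n t = 0"
proof -
  have "1 = bump (t * res L n - real a)"
    using assms by (simp add: bump_def step_1)
  also have "\<dots> \<le> (\<Sum>a\<in>digits L M n. bump (t * res L n - real a))"
    by (rule member_le_sum[OF assms(1)]) (auto simp: bump_bounds)
  finally show "cut L M n t = 1" "cut' L M n t = 0"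
    by (simp_all add: cut_def cut'_def step_1 step'_eq_0)
qed

section \<open>Layers around the product Cantor set\<close>

text \<open>The coordinate \<open>i0\<close> is the distinguished one. Its Cantor set admits the digits below \<open>M2\<close>, those of the
other coordinates the digits below \<open>M1\<close>, in the common base \<open>L\<close>.\<close>

locale cantor_scheme =
  fixes L M1 M2 :: nat and i0 :: "'m::finite"
  assumes M1: "0 < M1" "M1 \<le> L" and M2: "0 < M2" "M2 < L"
begin

definition base :: "'m \<Rightarrow> nat" where
  "base i = (if i = i0 then M2 else M1)"

text \<open>Product structure of the correction of stage \<open>n\<close>: the refinement of the staircase in the distinguished
coordinate, localised by cutoffs in all the others.\<close>

definition factor :: "nat \<Rightarrow> 'm \<Rightarrow> real \<Rightarrow> real" where
  "factor n i t = (if i = i0 then stair_diff L M2 n t else cut L M1 n t)"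

definition factor' :: "nat \<Rightarrow> 'm \<Rightarrow> real \<Rightarrow> real" where
  "factor' n i t = (if i = i0 then stair' L M2 (Suc n) t - stair' L M2 n t else cut' L M1 n t)"

definition piece :: "nat \<Rightarrow> real^'m \<Rightarrow> real" where
  "piece n x = (\<Prod>i\<in>UNIV. factor n i (x $ i))"

definition grad :: "nat \<Rightarrow> real^'m \<Rightarrow> real^'m" where
  "grad n x = (\<chi> i. factor' n i (x $ i) * (\<Prod>k\<in>UNIV - {i}. factor n k (x $ k)))"

definition layer :: "nat \<Rightarrow> (real^'m) set" where
  "layer n = {x. \<forall>i. around L (base i) n (x $ i)}"

text \<open>The growth rate of the slopes of the staircase from one stage to the next.\<close>

definition ratio :: real where "ratio = real L / real M2"

text \<open>The decay rate of the volume of the layers.\<close>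

definition thinning :: real where "thinning = real M1 ^ (CARD('m) - 1) * real M2 / real L ^ CARD('m)"

lemma L_pos: "0 < L" and M2_le: "M2 \<le> L"
  using M2 by auto

lemma ratio_gt_1: "1 < ratio"
  using M2 by (simp add: ratio_def)

lemma factor_deriv: "(factor n i has_real_derivative factor' n i t) (at t)"
proof (cases "i = i0")
  case True
  have "((\<lambda>t. stair L M2 (Suc n) t - stair L M2 n t) has_real_derivative stair' L M2 (Suc n) t - stair' L M2 n t) (at t)"
    by (intro DERIV_diff stair_deriv)
  then show ?thesis using True by (simp add: factor_def[abs_def] factor'_def stair_diff_def[abs_def])
next
  case False
  then show ?thesis using cut_deriv by (simp add: factor_def[abs_def] factor'_def)
qed

lemma smooth1_factor: "smooth1 (factor n i)"
  by (cases "i = i0") (auto simp: factor_def[abs_def] stair_diff_def[abs_def]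
      intro: smooth1_minus smooth1_stair smooth1_cut)

lemma smooth_fun_piece: "smooth_fun (piece n)"
  unfolding piece_def[abs_def] by (intro smooth_fun_prod smooth_fun.compose[OF smooth1_factor smooth_fun.coord])

lemma piece_deriv: "(piece n has_derivative (\<lambda>v. grad n x \<bullet> v)) (at x)"
proof -
  have "((\<lambda>x. factor n i (x $ i)) has_derivative (\<lambda>v. factor' n i (x $ i) * v $ i)) (at x)" for i
    using has_derivative_compose[OF bounded_linear_imp_has_derivative[OF bounded_linear_vec_nth]
        factor_deriv[unfolded has_field_derivative_def]] .
  then have "((\<lambda>x. \<Prod>i\<in>UNIV. factor n i (x $ i)) has_derivative
      (\<lambda>v. \<Sum>i\<in>UNIV. (factor' n i (x $ i) * v $ i) * (\<Prod>j\<in>UNIV - {i}. factor n j (x $ j)))) (at x)"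
    by (rule has_derivative_prod)
  then show ?thesis by (simp add: piece_def[abs_def] grad_def inner_vec_def mult_ac)
qed

lemma not_around_factor:
  assumes "\<not> around L (base i) n t" shows "factor n i t = 0" "factor' n i t = 0"
proof -
  have "factor n i t = 0 \<and> factor' n i t = 0"
  proof (cases "i = i0")
    case True
    then have n: "\<not> near L M2 n t" using assms near_imp_around by (auto simp: base_def)
    then have "\<not> near L M2 (Suc n) t" using near_Suc[OF M2_le L_pos] by blast
    then show ?thesis using True n stair_diff_eq_0[OF M2(1) M2_le n] by (simp add: factor_def factor'_def stair'_eq_0)
  next
    case False
    then show ?thesis using assms cut_eq_0[of L M1 n t] by (simp add: base_def factor_def factor'_def)
  qed
  then show "factor n i t = 0" "factor' n i t = 0" by auto
qed

lemma piece_grad_eq_0: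
  assumes "factor n k (x $ k) = 0" "factor' n k (x $ k) = 0"
  shows "piece n x = 0" "grad n x = 0"
proof -
  show "piece n x = 0" unfolding piece_def using assms by (intro prod_zero) auto
  have "factor' n i (x $ i) * (\<Prod>k\<in>UNIV - {i}. factor n k (x $ k)) = 0" for i
    using assms by (cases "i = k") (auto intro!: prod_zero)
  then show "grad n x = 0" by (simp add: grad_def vec_eq_iff)
qed

lemma off_layer: "x \<notin> layer n \<Longrightarrow> piece n x = 0 \<and> grad n x = 0"
  unfolding layer_def using not_around_factor piece_grad_eq_0 by blast

text \<open>A derivative costs a factor \<open>L\<^sup>n\<close>, and the correction in the distinguished coordinate has size
\<open>1 / M2\<^sup>n\<close>. Off the layer some factor vanishes together with its derivative.\<close>

lemma grad_bound: "\<exists>C>0. \<forall>n x. norm (grad n x) \<le> C * ratio ^ n * indicator (layer n) x"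
proof -
  obtain C1 where C1: "C1 > 0" "\<And>M n t. \<bar>cut' L M n t\<bar> \<le> C1 * real L ^ n" using cut'_bound by blast
  obtain C2 where C2: "C2 > 0" "\<And>n t. \<bar>stair' L M2 n t\<bar> \<le> C2 * ratio ^ n" using stair'_bound M2 ratio_def by metis
  let ?c = "C1 * 6 + C2 * (ratio + 1)"
  have r: "ratio ^ n = real L ^ n / real M2 ^ n" for n by (simp add: ratio_def power_divide)
  have comp: "\<bar>grad n x $ i\<bar> \<le> ?c * ratio ^ n" for n x i
  proof (cases "i = i0")
    case True
    have "\<bar>factor' n i (x $ i)\<bar> \<le> C2 * ratio ^ Suc n + C2 * ratio ^ n"
      using C2(2)[of "Suc n" "x $ i"] C2(2)[of n "x $ i"] True by (simp add: factor'_def)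
    moreover have "\<bar>\<Prod>k\<in>UNIV - {i}. factor n k (x $ k)\<bar> \<le> 1"
      unfolding abs_prod using True cut_bounds by (intro prod_le_1) (auto simp: factor_def)
    ultimately have "\<bar>factor' n i (x $ i)\<bar> * \<bar>\<Prod>k\<in>UNIV - {i}. factor n k (x $ k)\<bar>
        \<le> (C2 * ratio ^ Suc n + C2 * ratio ^ n) * 1"
      using C2(1) ratio_gt_1 by (intro mult_mono) auto
    then have "\<bar>grad n x $ i\<bar> \<le> (C2 * ratio ^ Suc n + C2 * ratio ^ n) * 1"
      by (simp add: grad_def abs_mult)
    also have "\<dots> \<le> ?c * ratio ^ n" using C1 ratio_gt_1 by (simp add: algebra_simps)
    finally show ?thesis .
  next
    case False
    have "\<bar>factor' n i (x $ i)\<bar> \<le> C1 * real L ^ n"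
      using C1(2)[of M1 n "x $ i"] False by (simp add: factor'_def)
    moreover have "\<bar>\<Prod>k\<in>UNIV - {i}. factor n k (x $ k)\<bar> \<le> 6 / real M2 ^ n"
    proof -
      have "(\<Prod>k\<in>UNIV - {i}. \<bar>factor n k (x $ k)\<bar>) = \<bar>factor n i0 (x $ i0)\<bar> * (\<Prod>k\<in>UNIV - {i} - {i0}. \<bar>factor n k (x $ k)\<bar>)"
        by (rule prod.remove) (use False in auto)
      also have "\<dots> \<le> 6 / real M2 ^ n * 1"
        using stair_diff_bound[OF M2(1) M2_le, of n "x $ i0"] cut_bounds
        by (intro mult_mono prod_le_1) (auto simp: factor_def intro!: prod_nonneg)
      finally show ?thesis by (simp add: abs_prod)
    qed
    ultimately have "\<bar>factor' n i (x $ i)\<bar> * \<bar>\<Prod>k\<in>UNIV - {i}. factor n k (x $ k)\<bar>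
        \<le> (C1 * real L ^ n) * (6 / real M2 ^ n)"
      using C1(1) by (intro mult_mono) auto
    then have "\<bar>grad n x $ i\<bar> \<le> (C1 * real L ^ n) * (6 / real M2 ^ n)"
      by (simp add: grad_def abs_mult)
    also have "\<dots> = C1 * 6 * ratio ^ n" by (simp add: r)
    also have "\<dots> \<le> ?c * ratio ^ n" using C2 ratio_gt_1 by (intro mult_right_mono) auto
    finally show ?thesis .
  qed
  have "norm (grad n x) \<le> (real CARD('m) * ?c) * ratio ^ n * indicator (layer n) x" for n x
  proof (cases "x \<in> layer n")
    case True
    have "norm (grad n x) \<le> (\<Sum>i\<in>UNIV. \<bar>grad n x $ i\<bar>)" using norm_vec_le_sum[of "grad n x"] by simp
    also have "\<dots> \<le> (\<Sum>i\<in>(UNIV::'m set). ?c * ratio ^ n)" by (intro sum_mono comp)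
    finally show ?thesis using True by (simp add: mult_ac)
  qed (simp add: off_layer)
  then show ?thesis using C1 C2 ratio_gt_1 by (intro exI[of _ "real CARD('m) * ?c"]) (auto intro!: mult_pos_pos add_pos_pos)
qed

lemma layer_eq_boxes:
  "layer n = (\<Union>a\<in>PiE UNIV (\<lambda>i. digits L (base i) n).
     cbox (\<chi> i. (real (a i) - 2) / res L n) (\<chi> i. (real (a i) + 3) / res L n))"
proof -
  have r: "0 < res L n" by (rule res_pos[OF L_pos])
  have eq: "(-2 \<le> t * res L n - c \<and> t * res L n - c \<le> 3) \<longleftrightarrow> (c - 2) / res L n \<le> t \<and> t \<le> (c + 3) / res L n" for t c
    using r by (auto simp: pos_divide_le_eq pos_le_divide_eq)
  show ?thesis
  proof (intro set_eqI iffI)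
    fix x assume "x \<in> layer n"
    then have "\<forall>i. \<exists>a. a \<in> digits L (base i) n \<and> -2 \<le> x $ i * res L n - real a \<and> x $ i * res L n - real a \<le> 3"
      by (auto simp: layer_def around_def)
    then obtain a where "\<And>i. a i \<in> digits L (base i) n \<and> -2 \<le> x $ i * res L n - real (a i) \<and> x $ i * res L n - real (a i) \<le> 3"
      by metis
    then show "x \<in> (\<Union>a\<in>PiE UNIV (\<lambda>i. digits L (base i) n).
     cbox (\<chi> i. (real (a i) - 2) / res L n) (\<chi> i. (real (a i) + 3) / res L n))"
      unfolding eq by (auto simp: mem_box_cart PiE_def)
  next
    fix x assume "x \<in> (\<Union>a\<in>PiE UNIV (\<lambda>i. digits L (base i) n).
     cbox (\<chi> i. (real (a i) - 2) / res L n) (\<chi> i. (real (a i) + 3) / res L n))"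
    then show "x \<in> layer n"
      unfolding layer_def around_def eq by (fastforce simp: mem_box_cart PiE_def)
  qed
qed

lemma prod_base: "(\<Prod>i\<in>UNIV. base i) = M1 ^ (CARD('m) - 1) * M2"
proof -
  have "(\<Prod>i\<in>UNIV. base i) = base i0 * (\<Prod>i\<in>UNIV - {i0}. base i)"
    by (rule prod.remove) auto
  also have "(\<Prod>i\<in>UNIV - {i0}. base i) = (\<Prod>i\<in>UNIV - {i0}. M1)"
    by (rule prod.cong) (auto simp: base_def)
  finally show ?thesis by (simp add: base_def card_Diff_singleton)
qed

lemma layer_borel [measurable]: "layer n \<in> sets borel"
  unfolding layer_eq_boxes by (intro sets.finite_UN finite_PiE) auto

lemma emeasure_layer: "emeasure lborel (layer n) \<le> ennreal (thinning ^ n)"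
proof -
  let ?P = "PiE UNIV (\<lambda>i. digits L (base i) n)"
  let ?B = "\<lambda>a::'m\<Rightarrow>nat. cbox (\<chi> i. (real (a i) - 2) / res L n) (\<chi> i. (real (a i) + 3) / res L n)"
  have r: "0 < res L n" by (rule res_pos[OF L_pos])
  have fin: "finite ?P" by (intro finite_PiE) auto
  have box: "emeasure lborel (?B a) = ennreal ((5 / res L n) ^ CARD('m))" for a
  proof -
    have "measure lborel (?B a) = (\<Prod>i\<in>UNIV. (real (a i) + 3) / res L n - (real (a i) - 2) / res L n)"
      using r by (subst content_cbox_cart) (auto simp: interval_ne_empty_cart divide_right_mono)
    also have "\<dots> = (5 / res L n) ^ CARD('m)"
      by (simp flip: diff_divide_distrib)
    finally have m: "measure lborel (?B a) = (5 / res L n) ^ CARD('m)" .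
    have "emeasure lborel (?B a) \<noteq> top"
      using emeasure_lborel_cbox_finite by (simp add: less_top)
    from emeasure_eq_ennreal_measure[OF this] m show ?thesis by simp
  qed
  have "emeasure lborel (layer n) \<le> (\<Sum>a\<in>?P. emeasure lborel (?B a))"
    unfolding layer_eq_boxes by (intro emeasure_subadditive_finite fin) auto
  also have "\<dots> = ennreal (real (card ?P) * (5 / res L n) ^ CARD('m))"
    using r by (simp add: box ennreal_mult ennreal_of_nat_eq_real_of_nat)
  also have "card ?P = (M1 ^ (CARD('m) - 1) * M2) ^ n"
  proof -
    have "card ?P = (\<Prod>i\<in>UNIV. card (digits L (base i) n))" by (rule card_PiE) simp
    also have "\<dots> = (\<Prod>i\<in>UNIV. base i ^ n)"
      using M1 M2_le by (intro prod.cong refl card_digits) (simp add: base_def)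
    finally show ?thesis by (simp add: prod_power_distrib[symmetric] prod_base)
  qed
  also have "ennreal (real ((M1 ^ (CARD('m) - 1) * M2) ^ n) * (5 / res L n) ^ CARD('m)) \<le> ennreal (thinning ^ n)"
  proof (rule ennreal_leI)
    have "(5 / res L n) ^ CARD('m) \<le> (1 / real L ^ n) ^ CARD('m)"
      using L_pos by (intro power_mono) (auto simp: res_def field_simps)
    also have "\<dots> = (1 / real L ^ CARD('m)) ^ n"
      by (simp add: power_one_over flip: power_mult) (simp add: mult.commute)
    finally have "real ((M1 ^ (CARD('m) - 1) * M2) ^ n) * (5 / res L n) ^ CARD('m)
        \<le> real ((M1 ^ (CARD('m) - 1) * M2) ^ n) * (1 / real L ^ CARD('m)) ^ n"
      by (intro mult_left_mono) auto
    also have "\<dots> = thinning ^ n" by (simp add: thinning_def power_divide power_mult_distrib)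
    finally show "real ((M1 ^ (CARD('m) - 1) * M2) ^ n) * (5 / res L n) ^ CARD('m) \<le> thinning ^ n" .
  qed
  finally show ?thesis .
qed

end

section \<open>The staircase function off the Cantor set\<close>

lemma not_around_pm1:
  assumes "M \<le> L" "0 < L" "t = -1 \<or> t = 1" shows "\<not> around L M n t"
proof
  assume "around L M n t"
  then obtain a where a: "a \<in> digits L M n" "-2 \<le> t * res L n - real a" "t * res L n - real a \<le> 3"
    by (auto simp: around_def)
  have "a < L ^ n" using digits_less[OF assms(1) a(1)] .
  then have "real a < real L ^ n" by (metis of_nat_less_iff of_nat_power)
  moreover have "1 \<le> real L ^ n" using assms(2) by (intro one_le_power) simp
  moreover have "t * res L n = res L n \<or> t * res L n = - res L n" using assms(3) by auto
  ultimately show False using a unfolding res_def by linarith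
qed

definition corner_set :: "nat \<Rightarrow> nat \<Rightarrow> real set" where
  "corner_set L M = (\<Union>n. corner_points L M n)"

lemma corner_set_nonempty: "corner_set L M \<noteq> {}"
  by (auto simp: corner_set_def corner_points_def intro!: exI[of _ 0])

lemma near_infdist:
  assumes "0 < L" "near L M n t" "corner_set L M \<subseteq> E" shows "infdist t E \<le> 1 / res L n"
proof -
  have r: "0 < res L n" by (rule res_pos[OF assms(1)])
  obtain a where a: "a \<in> digits L M n" "0 \<le> t * res L n - real a" "t * res L n - real a \<le> 1"
    using assms(2) by (auto simp: near_def)
  have "real a / res L n \<in> E" using a assms(3) by (auto simp: corner_set_def corner_points_def)
  then have "infdist t E \<le> dist t (real a / res L n)" by (rule infdist_le)
  also have "\<dots> = \<bar>t * res L n - real a\<bar> / res L n"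
    using r by (simp add: dist_real_def field_simps abs_if)
  also have "\<dots> \<le> 1 / res L n" using a r by (intro divide_right_mono) auto
  finally show ?thesis .
qed

lemma infdist_less_res:
  assumes "0 < M" "M \<le> L" "infdist t (corner_set L M) < 1 / res L n"
  shows "\<exists>a\<in>digits L M n. -1 \<le> t * res L n - real a \<and> t * res L n - real a \<le> 2"
proof -
  have L: "0 < L" using assms by simp
  have r: "0 < res L n" by (rule res_pos[OF L])
  obtain e where e: "e \<in> corner_set L M" "dist t e < 1 / res L n"
  proof -
    have "(INF e\<in>corner_set L M. dist t e) < 1 / res L n"
      using assms(3) by (simp add: infdist_notempty corner_set_nonempty)
    then have "\<exists>e\<in>corner_set L M. dist t e < 1 / res L n"
      by (subst (asm) cINF_less_iff) (auto intro: bdd_belowI2[where m=0] simp: corner_set_nonempty)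
    then show ?thesis using that by blast
  qed
  obtain k where "e \<in> corner_points L M k" using e by (auto simp: corner_set_def)
  from corner_points_cover[OF assms(1,2) this] obtain a where
    a: "a \<in> digits L M n" "0 \<le> e * res L n - real a" "e * res L n - real a \<le> 1" by blast
  have "dist t e * res L n < 1" using e(2) r by (simp add: pos_less_divide_eq)
  then have "\<bar>t * res L n - e * res L n\<bar> < 1"
    using r by (simp add: dist_real_def abs_mult flip: left_diff_distrib)
  then show ?thesis using a by (intro bexI[of _ a]) auto
qed

context cantor_scheme
begin

text \<open>The cutoffs of stage \<open>n\<close> equal 1 where \<open>y\<close> is closer to \<open>S\<close> than the scale of stage \<open>n\<close>. So the sum
telescopes to the staircase of the stage whose scale is comparable to the distance of \<open>y\<close> from \<open>S\<close>.\<close>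

definition fpart :: "nat \<Rightarrow> real^'m \<Rightarrow> real" where
  "fpart k x = stair L M2 0 (x $ i0) + (\<Sum>n<k. piece n x)"

definition gpart :: "nat \<Rightarrow> real^'m \<Rightarrow> real^'m" where
  "gpart k x = stair' L M2 0 (x $ i0) *\<^sub>R axis i0 1 + (\<Sum>n<k. grad n x)"

text \<open>Almost every point lies in finitely many layers only, and there the series is a finite sum.\<close>

definition flim :: "real^'m \<Rightarrow> real" where
  "flim x = stair L M2 0 (x $ i0) + (\<Sum>n. piece n x)"

definition glim :: "real^'m \<Rightarrow> real^'m" where
  "glim x = stair' L M2 0 (x $ i0) *\<^sub>R axis i0 1 + (\<Sum>n. grad n x)"

text \<open>The points \<open>\<plusminus>1\<close> are added so that the curves considered later start and end exactly on the faces
of the cube.\<close>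

definition sdist :: "real \<Rightarrow> real" where
  "sdist t = infdist t (corner_set L M2 \<union> {-1, 1})"

text \<open>The distance from the product Cantor set in the sum norm.\<close>

definition ydist :: "real^'m \<Rightarrow> real" where
  "ydist x = (\<Sum>i\<in>UNIV - {i0}. infdist (x $ i) (corner_set L M1))"

lemma fpart_deriv: "(fpart k has_derivative (\<lambda>v. gpart k x \<bullet> v)) (at x)"
proof -
  have "((\<lambda>x. stair L M2 0 (x $ i0)) has_derivative (\<lambda>v. stair' L M2 0 (x $ i0) * v $ i0)) (at x)"
    using has_derivative_compose[OF bounded_linear_imp_has_derivative[OF bounded_linear_vec_nth]
        stair_deriv[unfolded has_field_derivative_def]] .
  moreover have "((\<lambda>x. \<Sum>n<k. piece n x) has_derivative (\<lambda>v. \<Sum>n<k. grad n x \<bullet> v)) (at x)"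
    by (intro has_derivative_sum piece_deriv)
  ultimately have "(fpart k has_derivative (\<lambda>v. stair' L M2 0 (x $ i0) * v $ i0 + (\<Sum>n<k. grad n x \<bullet> v))) (at x)"
    unfolding fpart_def[abs_def] by (rule has_derivative_add)
  then show ?thesis
    by (simp add: gpart_def inner_add_left inner_sum_left inner_axis' )
qed

lemma smooth_fun_fpart: "smooth_fun (fpart k)"
  unfolding fpart_def[abs_def]
  by (intro smooth_fun.plus smooth_fun.compose[OF smooth1_stair smooth_fun.coord] smooth_fun_sum smooth_fun_piece)

lemma fpart_frontier:
  assumes "x \<in> frontier cube" shows "fpart k x = stair L M2 0 (x $ i0)"
proof -
  obtain i where "x $ i = -1 \<or> x $ i = 1" using frontier_cube_coord[OF assms] by blast
  then have "\<not> around L (base i) n (x $ i)" for n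
    using M1 M2_le L_pos by (intro not_around_pm1) (auto simp: base_def)
  then have "x \<notin> layer n" for n by (auto simp: layer_def)
  then show ?thesis by (simp add: fpart_def off_layer)
qed

lemma continuous_grad: "continuous_on UNIV (grad n)"
proof -
  have c: "continuous_on UNIV (factor' n i)" for i
  proof -
    obtain f' where f': "smooth1 f'" "\<And>t. (factor n i has_real_derivative f' t) (at t)"
      using smooth1_deriv[OF smooth1_factor] by blast
    then have "factor' n i = f'" using factor_deriv DERIV_unique by blast
    then show ?thesis using smooth1_continuous[OF f'(1)] by simp
  qed
  have "continuous_on UNIV (\<lambda>x::real^'m. factor' n i (x $ i))"
    "continuous_on UNIV (\<lambda>x::real^'m. factor n i (x $ i))" for i
    by (auto intro!: continuous_on_compose2[OF c] continuous_on_compose2[OF smooth1_continuous[OF smooth1_factor, of UNIV]] continuous_intros)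
  then show ?thesis unfolding grad_def[abs_def]
    by (intro continuous_intros)
qed

lemma measurable_flim [measurable]: "flim \<in> borel_measurable borel"
proof -
  have [measurable]: "piece n \<in> borel_measurable borel" for n
    by (intro borel_measurable_continuous_onI smooth_fun_continuous smooth_fun_piece)
  have [measurable]: "(\<lambda>x. stair L M2 0 (x $ i0)) \<in> borel_measurable borel"
    by (intro borel_measurable_continuous_onI smooth_fun_continuous smooth_fun.compose[OF smooth1_stair smooth_fun.coord])
  show ?thesis unfolding flim_def[abs_def] by measurable
qed

lemma continuous_stair': "continuous_on UNIV (stair' L M n)"
proof -
  obtain f' where f': "smooth1 f'" "\<And>t. (stair L M n has_real_derivative f' t) (at t)"
    using smooth1_deriv[OF smooth1_stair] by blast
  then have "stair' L M n = f'" using stair_deriv DERIV_unique by blast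
  then show ?thesis using smooth1_continuous[OF f'(1)] by simp
qed

lemma measurable_glim [measurable]: "glim \<in> borel_measurable borel"
proof -
  have [measurable]: "grad n \<in> borel_measurable borel" for n
    by (intro borel_measurable_continuous_onI continuous_grad)
  have [measurable]: "(\<lambda>x::real^'m. stair' L M2 0 (x $ i0)) \<in> borel_measurable borel"
    by (intro borel_measurable_continuous_onI continuous_on_compose2[OF continuous_stair'] continuous_intros) auto
  show ?thesis unfolding glim_def[abs_def] by measurable
qed

lemma thinning_nonneg: "0 \<le> thinning"
  by (simp add: thinning_def)

lemma thinning_less_1: "thinning < 1"
proof -
  have "real M1 ^ (CARD('m) - 1) * real M2 \<le> real L ^ (CARD('m) - 1) * real M2"
    using M1 by (intro mult_right_mono power_mono) auto
  also have "\<dots> < real L ^ (CARD('m) - 1) * real L"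
    using M2 L_pos by (intro mult_strict_left_mono) auto
  also have "\<dots> = real L ^ CARD('m)"
    by (metis mult.commute power_minus_mult zero_less_card_finite)
  finally show ?thesis using L_pos by (simp add: thinning_def)
qed

text \<open>Borel--Cantelli: the volumes of the layers are summable.\<close>

lemma AE_eventually_off_layer: "AE x in lborel. \<forall>\<^sub>F n in sequentially. x \<notin> layer n"
proof -
  have fin: "emeasure lborel (layer n) < \<infinity>" for n
    using emeasure_layer[of n] by (simp add: order.strict_trans1)
  have "AE x in lborel. \<forall>\<^sub>F n in sequentially. x \<in> space lborel - layer n"
  proof (rule borel_cantelli_AE1)
    have "measure lborel (layer n) \<le> thinning ^ n" for n
      using emeasure_layer[of n] thinning_nonneg by (simp add: measure_def enn2real_leI)
    then show "summable (\<lambda>n. measure lborel (layer n))"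
      by (intro summable_comparison_test[OF _ summable_geometric[of thinning]])
        (use thinning_less_1 thinning_nonneg in auto)
  qed (use fin in auto)
  then show ?thesis by simp
qed

lemma eventually_off_layer_limits:
  assumes "\<forall>\<^sub>F n in sequentially. x \<notin> layer n"
  shows "\<forall>\<^sub>F k in sequentially. fpart k x = flim x \<and> gpart k x = glim x"
proof -
  obtain N where N: "\<And>n. n \<ge> N \<Longrightarrow> x \<notin> layer n" using assms by (auto simp: eventually_sequentially)
  have "fpart k x = flim x \<and> gpart k x = glim x" if "k \<ge> N" for k
  proof -
    have z: "piece n x = 0 \<and> grad n x = 0" if "n \<notin> {..<k}" for n
      using off_layer[OF N[of n]] that \<open>N \<le> k\<close> by auto
    have "(\<Sum>n. piece n x) = (\<Sum>n<k. piece n x)" "(\<Sum>n. grad n x) = (\<Sum>n<k. grad n x)"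
      using z by (auto intro!: suminf_finite)
    then show ?thesis by (simp add: fpart_def flim_def gpart_def glim_def)
  qed
  then show ?thesis by (auto simp: eventually_sequentially)
qed

text \<open>Let \<open>n1\<close> be the first stage that \<open>t\<close> has left. Later corrections vanish near the point. At all
earlier stages the cutoffs are locally equal to 1, because \<open>y\<close> is closer to \<open>S\<close> than \<open>t\<close> is to \<open>K\<close>;
so near the point the function is the staircase of stage \<open>n1\<close>, which is locally constant there.\<close>

lemma glim_eq_0:
  assumes "ydist x < sdist (x $ i0)" shows "glim x = 0"
proof -
  let ?t = "x $ i0"
  have M1L: "0 < M1" "M1 \<le> L" by (fact M1)+
  have y0: "0 \<le> ydist x" by (simp add: ydist_def sum_nonneg infdist_nonneg)
  have far: "\<exists>n. \<not> near L M2 n ?t"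
  proof -
    have "(\<lambda>n. inverse (real L ^ n)) \<longlonglongrightarrow> 0"
      using M2 by (intro LIMSEQ_inverse_realpow_zero) auto
    then have "\<forall>\<^sub>F n in sequentially. inverse (real L ^ n) < sdist ?t"
      using y0 assms by (intro order_tendstoD(2)[where y=0]) auto
    then obtain n where n: "inverse (real L ^ n) < sdist ?t" by (auto simp: eventually_sequentially)
    have "1 / res L n \<le> inverse (real L ^ n)" using L_pos by (simp add: res_def field_simps)
    then have "\<not> near L M2 n ?t" using n near_infdist[OF L_pos, of M2 n ?t "corner_set L M2 \<union> {-1, 1}"]
      by (auto simp: sdist_def)
    then show ?thesis by blast
  qed
  define n1 where "n1 = (LEAST n. \<not> near L M2 n ?t)"
  have n1: "\<not> near L M2 n1 ?t" unfolding n1_def using far by (rule LeastI_ex)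
  have near: "near L M2 n ?t" if "n < n1" for n using that not_less_Least n1_def by blast
  have notnear: "\<not> near L M2 n ?t" if "n \<ge> n1" for n using near_antimono[OF M2_le L_pos that] n1 by blast
  have ge: "grad n x = 0" if "n \<ge> n1" for n
  proof (rule piece_grad_eq_0(2)[where k=i0])
    show "factor n i0 ?t = 0" using stair_diff_eq_0[OF M2(1) M2_le notnear[OF that]] by (simp add: factor_def)
    show "factor' n i0 ?t = 0" using stair'_eq_0 notnear[of n] notnear[of "Suc n"] that by (simp add: factor'_def)
  qed
  have lt: "grad n x = (stair' L M2 (Suc n) ?t - stair' L M2 n ?t) *\<^sub>R axis i0 1" if "n < n1" for n
  proof -
    have c: "cut L M1 n (x $ i) = 1 \<and> cut' L M1 n (x $ i) = 0" if "i \<noteq> i0" for i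
    proof -
      have "infdist (x $ i) (corner_set L M1) \<le> ydist x"
        unfolding ydist_def using that by (intro member_le_sum) (auto simp: infdist_nonneg)
      also have "\<dots> < 1 / res L n"
        using assms near_infdist[OF L_pos near[OF \<open>n < n1\<close>] Un_upper1, of "{-1, 1}"]
        unfolding sdist_def by linarith
      finally obtain a where "a \<in> digits L M1 n" "-1 \<le> x $ i * res L n - real a" "x $ i * res L n - real a \<le> 2"
        using infdist_less_res[OF M1L] by blast
      then show ?thesis using cut_eq_1 by blast
    qed
    have "grad n x $ i = ((stair' L M2 (Suc n) ?t - stair' L M2 n ?t) *\<^sub>R axis i0 1) $ i" for i
    proof (cases "i = i0")
      case True
      have "(\<Prod>k\<in>UNIV - {i0}. factor n k (x $ k)) = 1" using c by (intro prod.neutral) (auto simp: factor_def)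
      then show ?thesis using True by (simp add: grad_def factor'_def)
    next
      case False
      then show ?thesis using c by (simp add: grad_def factor'_def axis_def)
    qed
    then show ?thesis by (simp add: vec_eq_iff)
  qed
  have "(\<Sum>n. grad n x) = (\<Sum>n<n1. grad n x)"
    using ge by (intro suminf_finite) auto
  also have "\<dots> = (\<Sum>n<n1. stair' L M2 (Suc n) ?t - stair' L M2 n ?t) *\<^sub>R axis i0 1"
    by (simp add: lt scaleR_sum_left)
  also have "(\<Sum>n<n1. stair' L M2 (Suc n) ?t - stair' L M2 n ?t) = stair' L M2 n1 ?t - stair' L M2 0 ?t"
    by (rule sum_lessThan_telescope)
  also have "stair' L M2 n1 ?t = 0" by (rule stair'_eq_0[OF n1])
  finally show ?thesis by (simp add: glim_def)
qed

end

section \<open>Integrability of the gradient\<close>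

lemma nn_integral_lebesgue_on_cube:
  "(\<integral>\<^sup>+ x. f x \<partial>lebesgue_on cube) = (\<integral>\<^sup>+ x. f x * indicator cube x \<partial>lborel)"
  by (simp add: nn_integral_restrict_space nn_integral_completion)

lemma emeasure_cube_finite: "emeasure lborel (cube :: (real^'m) set) < \<infinity>"
  unfolding cube_eq_box by (rule emeasure_lborel_box_finite)

lemma AE_lebesgue_on_cube: "AE x in lborel. P x \<Longrightarrow> AE x in lebesgue_on cube. P x"
  by (subst AE_restrict_space_iff) (auto dest: AE_completion)

lemma measurable_lebesgue_on_cube: "f \<in> borel_measurable borel \<Longrightarrow> f \<in> borel_measurable (lebesgue_on cube)"
  by (intro measurable_restrict_space1 measurable_completion) simp

text \<open>The row vectors of a matrix are covered as well, hence the general type of the entries.\<close>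

definition pair_vec :: "'n \<Rightarrow> 'n \<Rightarrow> 'a::zero \<Rightarrow> 'a \<Rightarrow> 'a^'n" where
  "pair_vec j1 j2 a b = (\<chi> j. if j = j1 then a else if j = j2 then b else 0)"

lemma pair_vec_nth: "pair_vec j1 j2 a b $ j = (if j = j1 then a else if j = j2 then b else 0)"
  by (simp add: pair_vec_def)

lemma norm_pair_vec:
  fixes a b :: "'a::real_normed_vector"
  assumes "j1 \<noteq> j2" shows "norm (pair_vec j1 j2 a b :: 'a^'n) = sqrt ((norm a)\<^sup>2 + (norm b)\<^sup>2)"
proof -
  have "(\<Sum>j\<in>UNIV. (norm (pair_vec j1 j2 a b $ j :: 'a))\<^sup>2) = (\<Sum>j\<in>{j1, j2}. (norm (pair_vec j1 j2 a b $ j))\<^sup>2)"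
    by (rule sum.mono_neutral_right) (auto simp: pair_vec_nth)
  also have "\<dots> = (norm a)\<^sup>2 + (norm b)\<^sup>2" using assms by (simp add: pair_vec_nth)
  finally show ?thesis unfolding norm_vec_def L2_set_def by (rule arg_cong)
qed

context cantor_scheme
begin

definition good :: "real^'m \<Rightarrow> bool" where
  "good x \<longleftrightarrow> (\<forall>\<^sub>F n in sequentially. x \<notin> layer n)"

lemma good_finite: "good x \<Longrightarrow> finite {n. x \<in> layer n}"
proof -
  assume "good x"
  then obtain N where "\<And>n. n \<ge> N \<Longrightarrow> x \<notin> layer n" by (auto simp: good_def eventually_sequentially)
  then have "{n. x \<in> layer n} \<subseteq> {..<N}" by (auto simp flip: not_le)
  then show ?thesis by (rule finite_subset) simp
qed

lemma stair'_0_bound: "\<exists>C>0. \<forall>t. \<bar>stair' L M2 0 t\<bar> \<le> C"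
proof -
  obtain C where C: "C > 0" "\<forall>L M n t. 0 < M \<longrightarrow> \<bar>stair' L M n t\<bar> \<le> C * (real L / real M) ^ n"
    using stair'_bound by blast
  have "\<bar>stair' L M2 0 t\<bar> \<le> C * (real L / real M2) ^ 0" for t using C(2) M2(1) by blast
  then show ?thesis using C(1) by auto
qed

lemma gpart_dominated:
  assumes rt: "ratio * thinning < 1"
  shows "\<exists>H. integrable (lebesgue_on cube) H \<and> (\<forall>k x. good x \<longrightarrow> norm (gpart k x) \<le> H x)"
proof -
  obtain C where C: "C > 0" "\<And>n x. norm (grad n x) \<le> C * ratio ^ n * indicator (layer n) x"
    using grad_bound by blast
  obtain C0 where C0: "C0 > 0" "\<And>t. \<bar>stair' L M2 0 t\<bar> \<le> C0" using stair'_0_bound by blast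
  let ?h = "\<lambda>n x. ratio ^ n * indicat_real (layer n) x"
  define H where "H x = C0 + C * (\<Sum>n. ?h n x)" for x
  have r0: "0 \<le> ratio" "0 \<le> ratio * thinning" using ratio_gt_1 thinning_nonneg by auto
  have fin: "emeasure lborel (layer n) < \<infinity>" for n
    using emeasure_layer[of n] by (simp add: order.strict_trans1)
  have sm: "summable (\<lambda>n. ?h n x)" if "good x" for x
    by (rule summable_finite[OF good_finite[OF that]]) auto
  have "integrable lborel (\<lambda>x. \<Sum>n. ?h n x)"
  proof (rule integrable_suminf)
    show "integrable lborel (\<lambda>x. ?h n x)" for n
      using fin[of n] by (intro integrable_mult_right integrable_real_indicator) auto
    show "AE x in lborel. summable (\<lambda>n. norm (?h n x))"
      using AE_eventually_off_layer by eventually_elim (use sm r0 in \<open>simp add: good_def\<close>)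
    have "measure lborel (layer n) \<le> thinning ^ n" for n
      using emeasure_layer[of n] thinning_nonneg by (simp add: measure_def enn2real_leI)
    then have "ratio ^ n * measure lborel (layer n) \<le> (ratio * thinning) ^ n" for n
      unfolding power_mult_distrib using r0 by (intro mult_left_mono) auto
    then show "summable (\<lambda>n. LINT x|lborel. norm (?h n x))"
      using r0 rt by (intro summable_comparison_test[OF _ summable_geometric[of "ratio * thinning"]])
        (auto intro!: exI[of _ 0])
  qed
  then have "integrable lebesgue (\<lambda>x. \<Sum>n. ?h n x)"
    by (simp add: integrable_completion borel_measurable_integrable)
  then have "integrable (lebesgue_on cube) (\<lambda>x. \<Sum>n. ?h n x)"
    by (simp add: integrable_restrict_space integrable_mult_indicator del: scaleR_conv_of_real real_scaleR_def)
  moreover have "integrable (lebesgue_on (cube::(real^'m) set)) (\<lambda>_. C0)"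
    by (rule finite_measure.integrable_const[OF finite_measure_cube])
  ultimately have "integrable (lebesgue_on cube) H"
    unfolding H_def by auto
  moreover have "norm (gpart k x) \<le> H x" if "good x" for k x
  proof -
    have "norm (gpart k x) \<le> \<bar>stair' L M2 0 (x $ i0)\<bar> + norm (\<Sum>n<k. grad n x)"
      unfolding gpart_def by (rule order_trans[OF norm_triangle_ineq]) (simp add: norm_axis_1)
    also have "norm (\<Sum>n<k. grad n x) \<le> (\<Sum>n<k. C * ?h n x)"
      by (rule order_trans[OF norm_sum]) (intro sum_mono, use C in \<open>simp add: mult.assoc\<close>)
    also have "\<dots> \<le> C * (\<Sum>n. ?h n x)"
      unfolding sum_distrib_left[symmetric] using C r0 by (intro mult_left_mono sum_le_suminf sm that) auto
    finally show ?thesis using C0(2)[of "x $ i0"] by (simp add: H_def)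
  qed
  ultimately show ?thesis by blast
qed

text \<open>The bounds of the corrections grow geometrically, so their sum is controlled by the last term that
is present, and the power of the sum by the sum of the powers.\<close>

lemma glim_powr_bound:
  assumes p: "0 < p"
  shows "\<exists>K. \<forall>x. good x \<longrightarrow>
    ennreal (norm (glim x) powr p) \<le> ennreal K * (1 + (\<Sum>n. ennreal ((ratio powr p) ^ n) * indicator (layer n) x))"
proof -
  obtain C where C: "C > 0" "\<And>n x. norm (grad n x) \<le> C * ratio ^ n * indicator (layer n) x"
    using grad_bound by blast
  obtain C0 where C0: "C0 > 0" "\<And>t. \<bar>stair' L M2 0 t\<bar> \<le> C0" using stair'_0_bound by blast
  have r: "1 < ratio" by (rule ratio_gt_1)
  define D where "D = C0 + C * (ratio / (ratio - 1))"
  have D0: "0 < D" using C C0 r by (simp add: D_def add_pos_pos)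
  have pw: "(ratio powr p) ^ n = (ratio ^ n) powr p" for n
    using r by (simp add: powr_realpow[symmetric] powr_powr powr_power mult.commute)
  have "ennreal (norm (glim x) powr p) \<le> ennreal (D powr p) * (1 + (\<Sum>n. ennreal ((ratio powr p) ^ n) * indicator (layer n) x))"
    if g: "good x" for x
  proof -
    let ?S = "{n. x \<in> layer n}"
    have S: "finite ?S" by (rule good_finite[OF g])
    have "norm (glim x) \<le> \<bar>stair' L M2 0 (x $ i0)\<bar> + norm (\<Sum>n. grad n x)"
      unfolding glim_def by (rule order_trans[OF norm_triangle_ineq]) (simp add: norm_axis_1)
    also have "(\<Sum>n. grad n x) = (\<Sum>n\<in>?S. grad n x)"
      using off_layer by (intro suminf_finite S) auto
    also have "norm (\<Sum>n\<in>?S. grad n x) \<le> (\<Sum>n\<in>?S. C * ratio ^ n)"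
    proof (rule order_trans[OF norm_sum], rule sum_mono)
      fix n assume "n \<in> ?S"
      then show "norm (grad n x) \<le> C * ratio ^ n" using C(2)[of n x] by simp
    qed
    finally have 1: "norm (glim x) \<le> C0 + C * (\<Sum>n\<in>?S. ratio ^ n)"
      using C0(2)[of "x $ i0"] by (simp add: sum_distrib_left)
    show ?thesis
    proof (cases "?S = {}")
      case True
      then have "norm (glim x) \<le> C0" using 1 by (simp add: True)
      also have "\<dots> \<le> D" using C r by (simp add: D_def)
      finally have "norm (glim x) powr p \<le> D powr p" using p by (intro powr_mono2) auto
      then have "ennreal (norm (glim x) powr p) \<le> ennreal (D powr p) * 1" by (simp add: ennreal_leI)
      also have "\<dots> \<le> ennreal (D powr p) * (1 + (\<Sum>n. ennreal ((ratio powr p) ^ n) * indicator (layer n) x))"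
        by (intro mult_left_mono) auto
      finally show ?thesis .
    next
      case False
      (* The deepest layer that contains the point; it dominates the geometric sum. *)
      define N where "N = Max ?S"
      have N: "N \<in> ?S" unfolding N_def using S False by (rule Max_in)
      have "(\<Sum>n\<in>?S. ratio ^ n) \<le> (\<Sum>n<Suc N. ratio ^ n)"
        using S r by (intro sum_mono2) (auto simp: N_def less_Suc_eq_le)
      also have "\<dots> = (ratio ^ Suc N - 1) / (ratio - 1)" using r by (subst geometric_sum) auto
      also have "\<dots> \<le> ratio ^ Suc N / (ratio - 1)" using r by (intro divide_right_mono) auto
      finally have "(\<Sum>n\<in>?S. ratio ^ n) \<le> ratio / (ratio - 1) * ratio ^ N" by simp
      then have "C * (\<Sum>n\<in>?S. ratio ^ n) \<le> C * (ratio / (ratio - 1) * ratio ^ N)" using C by (intro mult_left_mono) auto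
      moreover have "C0 * 1 \<le> C0 * ratio ^ N" using C0 r by (intro mult_left_mono one_le_power) auto
      ultimately have "norm (glim x) \<le> D * ratio ^ N" using 1 by (simp add: D_def distrib_right mult.assoc)
      then have "norm (glim x) powr p \<le> (D * ratio ^ N) powr p" using p by (intro powr_mono2) auto
      also have "\<dots> = D powr p * (ratio powr p) ^ N" by (simp add: powr_mult pw)
      finally have "ennreal (norm (glim x) powr p) \<le> ennreal (D powr p) * ennreal ((ratio powr p) ^ N)"
        by (simp add: ennreal_mult[symmetric] ennreal_leI)
      also have "ennreal ((ratio powr p) ^ N) = (\<Sum>n\<in>{N}. ennreal ((ratio powr p) ^ n) * indicator (layer n) x)"
        using N by simp
      also have "\<dots> \<le> (\<Sum>n. ennreal ((ratio powr p) ^ n) * indicator (layer n) x)"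
        by (rule sum_le_suminf) auto
      also have "ennreal (D powr p) * \<dots> \<le> ennreal (D powr p) * (1 + (\<Sum>n. ennreal ((ratio powr p) ^ n) * indicator (layer n) x))"
        by (intro mult_left_mono) (auto intro: add_increasing)
      finally show ?thesis by (simp add: mult_left_mono)
    qed
  qed
  then show ?thesis by blast
qed

text \<open>This is where the energy of the limit map restricts the exponents: with
\<open>L / M2 = L\<^sup>s\<close> the geometric series converges iff \<open>(p - 1) s < (m - 1) r\<close>.\<close>

lemma glim_powr_integral_finite:
  assumes p: "0 < p" and rt: "ratio powr p * thinning < 1"
  shows "(\<integral>\<^sup>+ x. ennreal (norm (glim x) powr p) \<partial>lebesgue_on cube) < \<infinity>"
proof -
  obtain K where K: "\<And>x. good x \<Longrightarrow> ennreal (norm (glim x) powr p) \<le>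
      ennreal K * (1 + (\<Sum>n. ennreal ((ratio powr p) ^ n) * indicator (layer n) x))"
    using glim_powr_bound[OF p] by blast
  have "(\<integral>\<^sup>+ x. ennreal (norm (glim x) powr p) \<partial>lebesgue_on cube)
      \<le> (\<integral>\<^sup>+ x. ennreal K * (indicator cube x + (\<Sum>n. ennreal ((ratio powr p) ^ n) * indicator (layer n) x)) \<partial>lborel)"
    unfolding nn_integral_lebesgue_on_cube
  proof (rule nn_integral_mono_AE)
    show "AE x in lborel. ennreal (norm (glim x) powr p) * indicator cube x
        \<le> ennreal K * (indicator cube x + (\<Sum>n. ennreal ((ratio powr p) ^ n) * indicator (layer n) x))"
      using AE_eventually_off_layer
    proof eventually_elim
      case (elim x)
      then show ?case using K[of x] by (cases "x \<in> cube") (auto simp: good_def)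
    qed
  qed
  also have "\<dots> = ennreal K * (emeasure lborel (cube :: (real^'m) set) + (\<Sum>n. ennreal ((ratio powr p) ^ n) * emeasure lborel (layer n)))"
  proof -
    have m: "(\<lambda>x. ennreal ((ratio powr p) ^ n) * indicator (layer n) x) \<in> borel_measurable lborel" for n
      by (intro borel_measurable_times_ennreal borel_measurable_const borel_measurable_indicator) simp
    have c: "(indicator cube :: (real^'m) \<Rightarrow> ennreal) \<in> borel_measurable lborel"
      by (intro borel_measurable_indicator) simp
    have sm: "(\<lambda>x. \<Sum>n. ennreal ((ratio powr p) ^ n) * indicator (layer n) x) \<in> borel_measurable lborel"
      by (rule borel_measurable_suminf_order[OF m])
    have each: "(\<integral>\<^sup>+ x. ennreal ((ratio powr p) ^ n) * indicator (layer n) x \<partial>lborel)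
        = ennreal ((ratio powr p) ^ n) * emeasure lborel (layer n)" for n
      by (rule nn_integral_cmult_indicator) simp
    have cub: "(\<integral>\<^sup>+ (x::real^'m). indicator cube x \<partial>lborel) = emeasure lborel (cube :: (real^'m) set)"
      by (rule nn_integral_indicator) simp
    show ?thesis
      unfolding nn_integral_cmult[OF borel_measurable_add[OF c sm]] nn_integral_add[OF c sm] cub
        nn_integral_suminf[OF m] each ..
  qed
  also have "\<dots> < \<infinity>"
  proof -
    have "(\<Sum>n. ennreal ((ratio powr p) ^ n) * emeasure lborel (layer n)) \<le> (\<Sum>n. ennreal ((ratio powr p * thinning) ^ n))"
    proof (intro suminf_le summableI)
      fix n
      have "ennreal ((ratio powr p) ^ n) * emeasure lborel (layer n) \<le> ennreal ((ratio powr p) ^ n) * ennreal (thinning ^ n)"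
        by (intro mult_left_mono emeasure_layer) auto
      then show "ennreal ((ratio powr p) ^ n) * emeasure lborel (layer n) \<le> ennreal ((ratio powr p * thinning) ^ n)"
        using thinning_nonneg by (simp add: ennreal_mult[symmetric] power_mult_distrib)
    qed
    also have "\<dots> < top"
      unfolding less_top[symmetric]
    proof (rule ennreal_suminf_neq_top)
      show "summable (\<lambda>n. (ratio powr p * thinning) ^ n)"
        using rt thinning_nonneg by (intro summable_geometric) simp
    qed (use thinning_nonneg in simp)
    finally have "emeasure lborel (cube :: (real^'m) set) + (\<Sum>n. ennreal ((ratio powr p) ^ n) * emeasure lborel (layer n)) < top"
      using emeasure_cube_finite[where 'm='m] by (simp only: ennreal_add_less_top infinity_ennreal_def)
    then show ?thesis by (simp add: ennreal_mult_less_top)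
  qed
  finally show ?thesis .
qed

definition angle_map :: "'n \<Rightarrow> 'n \<Rightarrow> (real^'m \<Rightarrow> real) \<Rightarrow> real^'m \<Rightarrow> real^'n" where
  "angle_map j1 j2 f x = pair_vec j1 j2 (cos (pi * f x)) (sin (pi * f x))"

definition angle_grad :: "'n \<Rightarrow> 'n \<Rightarrow> real \<Rightarrow> real^'m \<Rightarrow> real^'m^'n" where
  "angle_grad j1 j2 \<theta> g = pair_vec j1 j2 ((- sin (pi * \<theta>) * pi) *\<^sub>R g) ((cos (pi * \<theta>) * pi) *\<^sub>R g)"

lemma norm_angle_map: "j1 \<noteq> j2 \<Longrightarrow> norm (angle_map j1 j2 f x) = 1"
  by (simp add: angle_map_def norm_pair_vec)

lemma norm_angle_grad:
  assumes "j1 \<noteq> j2" shows "norm (angle_grad j1 j2 \<theta> g) = pi * norm g"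
proof -
  have "(norm ((- sin (pi * \<theta>) * pi) *\<^sub>R g))\<^sup>2 + (norm ((cos (pi * \<theta>) * pi) *\<^sub>R g))\<^sup>2
      = (pi * norm g)\<^sup>2 * ((sin (pi * \<theta>))\<^sup>2 + (cos (pi * \<theta>))\<^sup>2)"
    by (simp only: norm_scaleR abs_mult abs_minus_cancel power_mult_distrib power2_abs distrib_left mult_ac)
  also have "\<dots> = (pi * norm g)\<^sup>2" by simp
  finally show ?thesis
    unfolding angle_grad_def norm_pair_vec[OF assms] by simp
qed

lemma smooth_fun_angle_map: "smooth_fun (\<lambda>x. angle_map j1 j2 (fpart k) x $ j)"
proof -
  have "smooth_fun (\<lambda>x. pi * fpart k x)"
    by (intro smooth_fun.times smooth_fun_const smooth_fun_fpart)
  then have "smooth_fun (\<lambda>x. cos (pi * fpart k x))" "smooth_fun (\<lambda>x. sin (pi * fpart k x))"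
    by (auto intro: smooth_fun.compose[OF smooth1.cos] smooth_fun.compose[OF smooth1.sin])
  then show ?thesis
    by (cases "j = j1"; cases "j = j2") (simp_all add: angle_map_def pair_vec_nth smooth_fun_const)
qed

lemma jac_angle_map:
  fixes j1 j2 :: "'n::finite"
  shows "jac (angle_map j1 j2 (fpart k)) x = angle_grad j1 j2 (fpart k x) (gpart k x)"
proof -
  let ?g = "gpart k x" and ?\<theta> = "pi * fpart k x"
  have d: "((\<lambda>x. pi * fpart k x) has_derivative (\<lambda>v. pi * (?g \<bullet> v))) (at x)"
    using fpart_deriv by (intro has_derivative_mult_right)
  have c: "((\<lambda>x. cos (pi * fpart k x)) has_derivative (\<lambda>v. - sin ?\<theta> * (pi * (?g \<bullet> v)))) (at x)"
    using has_derivative_compose[OF d DERIV_cos[unfolded has_field_derivative_def]] .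
  have s: "((\<lambda>x. sin (pi * fpart k x)) has_derivative (\<lambda>v. cos ?\<theta> * (pi * (?g \<bullet> v)))) (at x)"
    using has_derivative_compose[OF d DERIV_sin[unfolded has_field_derivative_def]] .
  have "(angle_map j1 j2 (fpart k) has_derivative
      (\<lambda>v. pair_vec j1 j2 (- sin ?\<theta> * (pi * (?g \<bullet> v))) (cos ?\<theta> * (pi * (?g \<bullet> v))) :: real^'n)) (at x)"
  proof (subst has_derivative_componentwise_within, intro ballI)
    fix b :: "real^'n" assume "b \<in> Basis"
    then obtain i where b: "b = axis i 1" by (auto simp: Basis_vec_def)
    show "((\<lambda>x. angle_map j1 j2 (fpart k) x \<bullet> b) has_derivative
       (\<lambda>v. pair_vec j1 j2 (- sin ?\<theta> * (pi * (?g \<bullet> v))) (cos ?\<theta> * (pi * (?g \<bullet> v))) \<bullet> b)) (at x)"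
      using c s by (cases "i = j1"; cases "i = j2") (simp_all add: b inner_axis angle_map_def pair_vec_nth)
  qed
  from jac_eqI[OF this] show ?thesis
    by (simp add: vec_eq_iff angle_grad_def pair_vec_nth inner_axis)
qed

end

section \<open>The circle-valued limit map\<close>

lemma continuous_on_pair_vec:
  fixes a b :: "'a::topological_space \<Rightarrow> 'b::real_normed_vector"
  assumes "continuous_on S a" "continuous_on S b"
  shows "continuous_on S (\<lambda>x. pair_vec j1 j2 (a x) (b x) :: 'b^'n)"
  unfolding pair_vec_def
proof (rule continuous_on_vec_lambda)
  fix j show "continuous_on S (\<lambda>x. if j = j1 then a x else if j = j2 then b x else 0)"
    using assms by (cases "j = j1"; cases "j = j2") simp_all
qed

context cantor_scheme
begin

text \<open>The partial sums coincide on the boundary of the cube and are eventually constant in the index almost everywhere inside.\<close>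

lemma limit_map:
  fixes j1 j2 :: "'n::finite"
  assumes j: "j1 \<noteq> j2" and rt: "ratio * thinning < 1"
  defines "G \<equiv> (\<lambda>x. angle_grad j1 j2 (flim x) (glim x))"
  shows "angle_map j1 j2 (fpart 0) \<in> smooth_sphere 1"
    "angle_map j1 j2 flim \<in> W11 cube" "has_weak_gradient cube (angle_map j1 j2 flim) G"
    "has_trace (angle_map j1 j2 flim) (angle_map j1 j2 (fpart 0))"
proof -
  let ?w = "\<lambda>k. angle_map j1 j2 (fpart k) :: real^'m \<Rightarrow> real^'n"
  let ?u = "angle_map j1 j2 flim"
  have sm: "?w k \<in> smooth_closure cube" for k
    by (intro smooth_vector_smooth_closure smooth_fun_angle_map)
  then show "?w 0 \<in> smooth_sphere 1"
    by (simp add: smooth_sphere_def norm_angle_map[OF j])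
  obtain H where H: "integrable (lebesgue_on cube) H" "\<And>k x. good x \<Longrightarrow> norm (gpart k x) \<le> H x"
    using gpart_dominated[OF rt] by blast
  have good: "AE x in lebesgue_on cube. good x"
    using AE_lebesgue_on_cube[OF AE_eventually_off_layer] by (simp add: good_def)
  have ev: "\<forall>\<^sub>F k in sequentially. fpart k x = flim x \<and> gpart k x = glim x" if "good x" for x
    using eventually_off_layer_limits that by (simp add: good_def)
  have um: "?u \<in> borel_measurable (lebesgue_on cube)"
  proof (rule measurable_lebesgue_on_cube)
    have "continuous_on UNIV (\<lambda>t. pair_vec j1 j2 (cos (pi * t)) (sin (pi * t)) :: real^'n)"
      by (intro continuous_on_pair_vec continuous_intros)
    from measurable_compose[OF measurable_flim borel_measurable_continuous_onI[OF this]]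
    show "?u \<in> borel_measurable borel" by (simp add: angle_map_def[abs_def])
  qed
  have Gm: "G \<in> borel_measurable (lebesgue_on cube)"
  proof (rule measurable_lebesgue_on_cube)
    have "continuous_on UNIV (\<lambda>z. angle_grad j1 j2 (fst z) (snd z) :: real^'m^'n)"
      unfolding angle_grad_def by (intro continuous_on_pair_vec continuous_intros)
    from borel_measurable_continuous_Pair[OF measurable_flim measurable_glim this]
    show "G \<in> borel_measurable borel" by (simp add: G_def)
  qed
  note app = smooth_approximation[where w="?w" and u="?u" and G=G and C=1 and H="\<lambda>x. pi * H x", OF sm]
  have 1: "norm (?w k x) \<le> 1" for k x by (simp add: norm_angle_map[OF j])
  have 2: "AE x in lebesgue_on cube. (\<lambda>k. ?w k x) \<longlonglongrightarrow> ?u x"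
    using good
  proof eventually_elim
    case (elim x)
    show ?case by (rule tendsto_eventually, rule eventually_mono[OF ev[OF elim]]) (simp add: angle_map_def)
  qed
  have 3: "integrable (lebesgue_on cube) (\<lambda>x. pi * H x)" using H(1) by simp
  have 4: "AE x in lebesgue_on cube. norm (jac (?w k) x) \<le> pi * H x" for k
    using good by eventually_elim (simp add: jac_angle_map norm_angle_grad[OF j] H(2))
  have 5: "AE x in lebesgue_on cube. (\<lambda>k. jac (?w k) x) \<longlonglongrightarrow> G x"
    using good
  proof eventually_elim
    case (elim x)
    show ?case unfolding jac_angle_map G_def
      by (rule tendsto_eventually, rule eventually_mono[OF ev[OF elim]]) simp
  qed
  note app = app[OF 1 2 3 4 5 um Gm]
  show "?u \<in> W11 cube" by (rule app(1))
  show "has_weak_gradient cube ?u G" by (rule app(2))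
  show "has_trace ?u (?w 0)"
  proof (rule app(3))
    fix k x assume "x \<in> frontier (cube :: (real^'m) set)"
    then show "?w k x = ?w 0 x" by (simp add: angle_map_def fpart_frontier)
  qed
qed

lemma limit_map_energy_finite:
  fixes j1 j2 :: "'n::finite"
  assumes j: "j1 \<noteq> j2" and p: "0 < p" and rt: "ratio powr p * thinning < 1"
  shows "(\<integral>\<^sup>+ x. ennreal (norm (angle_grad j1 j2 (flim x) (glim x) :: real^'m^'n) powr p) \<partial>lebesgue_on cube) < \<infinity>"
proof -
  have "(\<lambda>x. ennreal (norm (glim x) powr p)) \<in> borel_measurable (lebesgue_on cube)"
    by (rule measurable_lebesgue_on_cube) simp
  then have "(\<integral>\<^sup>+ x. ennreal (pi powr p) * ennreal (norm (glim x) powr p) \<partial>lebesgue_on cube)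
      = ennreal (pi powr p) * (\<integral>\<^sup>+ x. ennreal (norm (glim x) powr p) \<partial>lebesgue_on cube)"
    by (rule nn_integral_cmult)
  also have "\<dots> < \<infinity>"
    using glim_powr_integral_finite[OF p rt] by (simp add: ennreal_mult_less_top)
  finally show ?thesis
    by (simp add: norm_angle_grad[OF j] powr_mult ennreal_mult)
qed

end

section \<open>Distance to the finite stages of the Cantor set on the line\<close>

text \<open>Off the points themselves and the midpoints of any two of them the nearest point is unique, and it
stays the nearest one for all nearby arguments.\<close>

lemma infdist_finite_deriv:
  fixes Z :: "real set"
  assumes Z: "finite Z" "Z \<noteq> {}"
  shows "\<exists>B. finite B \<and> (\<forall>t. t \<notin> B \<longrightarrow> (\<exists>D. \<bar>D\<bar> \<le> 1 \<and> ((\<lambda>t. infdist t Z) has_real_derivative D) (at t)))"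
proof -
  define B where "B = Z \<union> (\<lambda>(a, b). (a + b) / 2) ` (Z \<times> Z)"
  have "\<exists>D. \<bar>D\<bar> \<le> 1 \<and> ((\<lambda>t. infdist t Z) has_real_derivative D) (at t)" if t: "t \<notin> B" for t
  proof -
    obtain e where e: "e \<in> Z" "infdist t Z = dist t e"
      using infdist_attains_inf[of Z t] Z finite_imp_closed by metis
    have te: "t \<noteq> e" using t e by (auto simp: B_def)
    define D where "D = sgn (t - e)"
    have D: "\<bar>D\<bar> = 1" "\<bar>t - e\<bar> = D * (t - e)" using te by (auto simp: D_def abs_sgn_eq sgn_if)
    have strict: "D * (t - e) < \<bar>t - e'\<bar>" if "e' \<in> Z - {e}" for e'
    proof -
      have le: "\<bar>t - e\<bar> \<le> \<bar>t - e'\<bar>" using infdist_le[of e' Z t] that e by (simp add: dist_real_def)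
      have "\<bar>t - e\<bar> \<noteq> \<bar>t - e'\<bar>"
      proof
        assume "\<bar>t - e\<bar> = \<bar>t - e'\<bar>"
        then have "t = (e + e') / 2" using that by (auto simp: abs_if split: if_splits)
        then have "t \<in> (\<lambda>(a, b). (a + b) / 2) ` (Z \<times> Z)"
          using e that by (intro image_eqI[of _ _ "(e, e')"]) auto
        then show False using t by (simp add: B_def)
      qed
      then show ?thesis using le D by simp
    qed
    have "\<forall>\<^sub>F u in nhds t. \<forall>e'\<in>Z - {e}. D * (u - e) < \<bar>u - e'\<bar>"
    proof (rule eventually_ball_finite)
      show "\<forall>e'\<in>Z - {e}. \<forall>\<^sub>F u in nhds t. D * (u - e) < \<bar>u - e'\<bar>"
      proof
        fix e' assume "e' \<in> Z - {e}"
        have "((\<lambda>u. \<bar>u - e'\<bar> - D * (u - e)) \<longlongrightarrow> \<bar>t - e'\<bar> - D * (t - e)) (nhds t)"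
          by (intro tendsto_intros filterlim_ident)
        then have "\<forall>\<^sub>F u in nhds t. 0 < \<bar>u - e'\<bar> - D * (u - e)"
          using strict[OF \<open>e' \<in> Z - {e}\<close>] by (intro order_tendstoD(1)) auto
        then show "\<forall>\<^sub>F u in nhds t. D * (u - e) < \<bar>u - e'\<bar>" by eventually_elim simp
      qed
    qed (use Z in simp)
    moreover have "\<forall>\<^sub>F u in nhds t. \<bar>u - e\<bar> = D * (u - e)"
    proof -
      have "((\<lambda>u. D * (u - e)) \<longlongrightarrow> D * (t - e)) (nhds t)" by (intro tendsto_intros filterlim_ident)
      moreover have "0 < D * (t - e)" using te D(2) by (metis zero_less_abs_iff right_minus_eq)
      ultimately have "\<forall>\<^sub>F u in nhds t. 0 < D * (u - e)" by (rule order_tendstoD(1))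
      then show ?thesis
      proof eventually_elim
        case (elim u)
        then show ?case using D(1) by (auto simp: abs_if zero_less_mult_iff split: if_splits)
      qed
    qed
    ultimately have ev: "\<forall>\<^sub>F u in nhds t. infdist u Z = D * (u - e)"
    proof eventually_elim
      case (elim u)
      obtain e' where e': "e' \<in> Z" "infdist u Z = dist u e'"
        using infdist_attains_inf[of Z u] Z finite_imp_closed by metis
      have "infdist u Z \<le> \<bar>u - e\<bar>" using infdist_le[OF e(1), of u] by (simp add: dist_real_def)
      moreover have "D * (u - e) \<le> infdist u Z"
        using elim(1)[rule_format, of e'] elim(2) e' by (cases "e' = e") (auto simp: dist_real_def)
      ultimately show ?case using elim by simp
    qed
    have "((\<lambda>u. D * (u - e)) has_real_derivative D) (at t)" by (auto intro!: derivative_eq_intros)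
    then have "((\<lambda>u. infdist u Z) has_real_derivative D) (at t)"
      using DERIV_cong_ev[OF refl ev refl] by simp
    then show ?thesis using D by (intro exI[of _ D]) simp
  qed
  moreover have "finite B" using Z by (simp add: B_def)
  ultimately show ?thesis by blast
qed

lemma emeasure_infdist_finite:
  fixes Z :: "real set"
  assumes Z: "finite Z" "Z \<noteq> {}" and r: "0 \<le> r"
  shows "emeasure lborel {t. infdist t Z \<le> r} \<le> ennreal (real (card Z) * (2 * r))"
proof -
  have "{t. infdist t Z \<le> r} \<subseteq> (\<Union>e\<in>Z. {e - r..e + r})"
  proof
    fix t assume t: "t \<in> {t. infdist t Z \<le> r}"
    obtain e where e: "e \<in> Z" "infdist t Z = dist t e"
      using infdist_attains_inf[of Z t] Z finite_imp_closed by metis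
    then have "\<bar>t - e\<bar> \<le> r" using t by (simp add: dist_real_def)
    then have "t \<in> {e - r..e + r}" by (simp add: abs_le_iff)
    then show "t \<in> (\<Union>e\<in>Z. {e - r..e + r})" using e by blast
  qed
  then have "emeasure lborel {t. infdist t Z \<le> r} \<le> emeasure lborel (\<Union>e\<in>Z. {e - r..e + r})"
    by (rule emeasure_mono) (use Z in \<open>auto intro!: sets.finite_UN\<close>)
  also have "\<dots> \<le> (\<Sum>e\<in>Z. emeasure lborel {e - r..e + r})"
    by (rule emeasure_subadditive_finite) (use Z in auto)
  also have "\<dots> = (\<Sum>e\<in>Z. ennreal (2 * r))" using r by (intro sum.cong) auto
  also have "\<dots> = ennreal (real (card Z) * (2 * r))"
    using r by (simp add: ennreal_mult ennreal_of_nat_eq_real_of_nat)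
  finally show ?thesis .
qed

context cantor_scheme
begin

text \<open>A finite stage of the Cantor set is used in place of the set itself, because the distance to a finite set
is differentiable up to finitely many exceptions; this is what the fundamental theorem along the curves requires.\<close>

definition skeleton :: "nat \<Rightarrow> real set" where
  "skeleton N = corner_points L M2 N \<union> {-1, 1}"

definition zdist :: "nat \<Rightarrow> real \<Rightarrow> real" where
  "zdist N t = infdist t (skeleton N)"

lemma finite_skeleton: "finite (skeleton N)" and skeleton_nonempty: "skeleton N \<noteq> {}"
  by (auto simp: skeleton_def corner_points_def)

lemma card_skeleton: "real (card (skeleton N)) \<le> 3 * real M2 ^ N"
proof -
  have "card (corner_points L M2 N) \<le> M2 ^ N"
    unfolding corner_points_def using card_image_le[OF finite_digits, of "\<lambda>a. real a / res L N" L M2 N] card_digits[OF M2_le, of N] by simp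
  then have "card (skeleton N) \<le> M2 ^ N + 2"
    using card_Un_le[of "corner_points L M2 N" "{-1,1}"] by (simp add: skeleton_def)
  then have "real (card (skeleton N)) \<le> real M2 ^ N + 2" by (metis of_nat_le_iff of_nat_add of_nat_numeral of_nat_power)
  moreover have "1 \<le> real M2 ^ N" using M2 by (intro one_le_power) auto
  ultimately show ?thesis by linarith
qed

lemma sdist_le_zdist: "sdist t \<le> zdist N t"
  unfolding sdist_def zdist_def by (rule infdist_mono) (auto simp: skeleton_def corner_set_def skeleton_nonempty[unfolded skeleton_def])

lemma zdist_le_sdist: "zdist N t \<le> sdist t + 1 / res L N"
proof -
  have r: "0 < res L N" by (rule res_pos[OF L_pos])
  let ?E = "corner_set L M2 \<union> {-1, 1}"
  have ne: "?E \<noteq> {}" by simp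
  have "zdist N t - 1 / res L N \<le> dist t e" if eE: "e \<in> ?E" for e
  proof -
    have "\<exists>e'\<in>skeleton N. dist e e' \<le> 1 / res L N"
    proof (cases "e \<in> {-1, 1}")
      case True
      then show ?thesis using r by (intro bexI[of _ e]) (auto simp: skeleton_def)
    next
      case False
      then obtain k where "e \<in> corner_points L M2 k" using eE by (auto simp: corner_set_def)
      from corner_points_cover[OF M2(1) M2_le this, of N] obtain a where
        a: "a \<in> digits L M2 N" "0 \<le> e * res L N - real a" "e * res L N - real a \<le> 1" by blast
      have "dist e (real a / res L N) = \<bar>e * res L N - real a\<bar> / res L N"
        using r by (simp add: dist_real_def field_simps abs_if)
      also have "\<dots> \<le> 1 / res L N" using a r by (intro divide_right_mono) auto
      finally show ?thesis using a by (intro bexI[of _ "real a / res L N"]) (auto simp: skeleton_def corner_points_def)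
    qed
    then obtain e' where e': "e' \<in> skeleton N" "dist e e' \<le> 1 / res L N" by blast
    have "zdist N t \<le> dist t e'" unfolding zdist_def by (rule infdist_le[OF e'(1)])
    also have "\<dots> \<le> dist t e + dist e e'" by (rule dist_triangle)
    finally show ?thesis using e' by simp
  qed
  then have "zdist N t - 1 / res L N \<le> sdist t"
    unfolding sdist_def infdist_notempty[OF ne] by (rule cINF_greatest[OF ne])
  then show ?thesis by simp
qed

lemma zdist_le_1: "\<bar>t\<bar> \<le> 1 \<Longrightarrow> zdist N t \<le> 1 - \<bar>t\<bar>"
proof -
  assume t: "\<bar>t\<bar> \<le> 1"
  have "zdist N t \<le> dist t 1" "zdist N t \<le> dist t (-1)"
    unfolding zdist_def by (auto intro!: infdist_le simp: skeleton_def)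
  then show ?thesis using t by (auto simp: dist_real_def abs_if split: if_splits)
qed

lemma zdist_nonneg: "0 \<le> zdist N t" by (simp add: zdist_def infdist_nonneg)

lemma zdist_pm1: "zdist N 1 = 0" "zdist N (-1) = 0"
  by (auto simp: zdist_def skeleton_def)

lemma continuous_zdist: "continuous_on S (zdist N)"
  unfolding zdist_def[abs_def] by (intro continuous_on_infdist continuous_on_id)

lemma measurable_zdist [measurable]: "zdist N \<in> borel_measurable borel"
  by (intro borel_measurable_continuous_onI continuous_zdist)

lemma measurable_sdist [measurable]: "sdist \<in> borel_measurable borel"
  unfolding sdist_def[abs_def] by (intro borel_measurable_continuous_onI continuous_on_infdist continuous_on_id)

text \<open>One interval for each of the at most \<open>3 M2\<^sup>N\<close> points.\<close>

lemma emeasure_zdist_le: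
  assumes "0 \<le> C"
  shows "emeasure lborel {t. zdist N t \<le> C / real L ^ N} \<le> ennreal (6 * C * (real M2 / real L) ^ N)"
proof -
  have "emeasure lborel {t. zdist N t \<le> C / real L ^ N} \<le> ennreal (real (card (skeleton N)) * (2 * (C / real L ^ N)))"
    unfolding zdist_def by (rule emeasure_infdist_finite[OF finite_skeleton skeleton_nonempty]) (use assms in simp)
  also have "\<dots> \<le> ennreal (6 * C * (real M2 / real L) ^ N)"
  proof (rule ennreal_leI)
    have "real (card (skeleton N)) * (2 * (C / real L ^ N)) \<le> (3 * real M2 ^ N) * (2 * (C / real L ^ N))"
      using card_skeleton assms by (intro mult_right_mono) auto
    then show "real (card (skeleton N)) * (2 * (C / real L ^ N)) \<le> 6 * C * (real M2 / real L) ^ N"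
      by (simp add: power_divide mult_ac)
  qed
  finally show ?thesis .
qed

lemma zdist_small_measure_tendsto_0:
  assumes "0 \<le> C"
  shows "(\<lambda>N. emeasure lborel {t. zdist N t \<le> C / real L ^ N}) \<longlonglongrightarrow> 0"
proof (rule tendsto_sandwich[OF _ _ tendsto_const])
  have "(\<lambda>N. 6 * C * (real M2 / real L) ^ N) \<longlonglongrightarrow> 6 * C * 0"
    using M2 by (intro tendsto_mult tendsto_const LIMSEQ_realpow_zero) auto
  then show "(\<lambda>N. ennreal (6 * C * (real M2 / real L) ^ N)) \<longlonglongrightarrow> 0"
    using tendsto_ennrealI by fastforce
qed (use emeasure_zdist_le[OF assms] in auto)

text \<open>Layer by layer: the distance is at most \<open>L\<^sup>-\<^sup>n\<close> on a set of measure \<open>O((M2 / L)\<^sup>n)\<close>.\<close>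

lemma sdist_powr_integral_finite:
  assumes g: "0 < g" and cond: "real L powr g * (real M2 / real L) < 1"
  shows "(\<integral>\<^sup>+ t. ennreal (sdist t powr (- g)) * indicator {-1<..<1} t \<partial>lborel) < \<infinity>"
proof -
  let ?A = "\<lambda>n. {t. zdist n t \<le> 2 / real L ^ n}"
  let ?l = "real L powr g"
  have L1: "1 < real L" using M2 by simp
  have le: "ennreal (sdist t powr (- g)) * indicator {-1<..<1} t \<le> (\<Sum>n. ennreal (?l ^ Suc n) * indicator (?A n) t)" for t
  proof (cases "sdist t = 0 \<or> t \<notin> {-1<..<1}")
    case False
    then have t: "\<bar>t\<bar> < 1" and s0: "0 < sdist t"
      by (auto simp: sdist_def infdist_nonneg less_le)
    have s1: "sdist t \<le> 1" using sdist_le_zdist[of t 0] zdist_le_1[of t 0] t by linarith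
    have "(\<lambda>n. inverse (real L ^ n)) \<longlonglongrightarrow> 0"
      by (rule LIMSEQ_inverse_realpow_zero[OF L1])
    then have "\<forall>\<^sub>F n in sequentially. inverse (real L ^ n) < sdist t"
      using s0 by (intro order_tendstoD(2)[where y=0]) auto
    then have ex: "\<exists>n. inverse (real L ^ n) < sdist t" by (auto simp: eventually_sequentially)
    define k where "k = (LEAST n. inverse (real L ^ n) < sdist t)"
    have k: "inverse (real L ^ k) < sdist t" unfolding k_def using ex by (rule LeastI_ex)
    have "k \<noteq> 0" using k s1 by (intro notI) simp
    then obtain n where n: "k = Suc n" using not0_implies_Suc by blast
    have "\<not> inverse (real L ^ n) < sdist t" using not_less_Least[of n "\<lambda>n. inverse (real L ^ n) < sdist t"] n unfolding k_def by simp
    then have "sdist t \<le> 1 / real L ^ n" by (simp add: inverse_eq_divide)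
    moreover have "1 / res L n \<le> 1 / real L ^ n" using L1 by (simp add: res_def field_simps)
    ultimately have "zdist n t \<le> 2 / real L ^ n" using zdist_le_sdist[of n t] by (simp add: add_divide_distrib)
    then have An: "t \<in> ?A n" by simp
    have "sdist t powr (- g) \<le> (inverse (real L ^ Suc n)) powr (- g)"
      using k n L1 g by (intro powr_mono2') auto
    also have "inverse (real L ^ Suc n) = real L powr (- real (Suc n))"
      using L1 by (simp only: powr_minus powr_realpow[symmetric])
    also have "(real L powr (- real (Suc n))) powr (- g) = ?l ^ Suc n"
      using L1 by (subst powr_power) (simp_all add: powr_powr del: of_nat_Suc)
    finally have "ennreal (sdist t powr (- g)) \<le> (\<Sum>n\<in>{n}. ennreal (?l ^ Suc n) * indicator (?A n) t)"
      using An by (simp add: ennreal_leI)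
    also have "\<dots> \<le> (\<Sum>n. ennreal (?l ^ Suc n) * indicator (?A n) t)"
      by (rule sum_le_suminf) auto
    finally show ?thesis using t by (simp add: abs_less_iff indicator_def)
  qed (auto simp: indicator_def)
  have m: "(\<lambda>t. ennreal (?l ^ Suc n) * indicator (?A n) t) \<in> borel_measurable lborel" for n
    by (intro borel_measurable_times_ennreal borel_measurable_const borel_measurable_indicator) measurable
  have "(\<integral>\<^sup>+ t. ennreal (sdist t powr (- g)) * indicator {-1<..<1} t \<partial>lborel)
      \<le> (\<integral>\<^sup>+ t. (\<Sum>n. ennreal (?l ^ Suc n) * indicator (?A n) t) \<partial>lborel)"
    by (rule nn_integral_mono) (rule le)
  also have "\<dots> = (\<Sum>n. \<integral>\<^sup>+ t. ennreal (?l ^ Suc n) * indicator (?A n) t \<partial>lborel)"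
    by (rule nn_integral_suminf[OF m])
  also have "\<dots> \<le> (\<Sum>n. ennreal (12 * ?l * (?l * (real M2 / real L)) ^ n))"
  proof (intro suminf_le summableI)
    fix n
    have "(\<integral>\<^sup>+ t. ennreal (?l ^ Suc n) * indicator (?A n) t \<partial>lborel) = ennreal (?l ^ Suc n) * emeasure lborel (?A n)"
      by (rule nn_integral_cmult_indicator) measurable
    also have "\<dots> \<le> ennreal (?l ^ Suc n) * ennreal (6 * 2 * (real M2 / real L) ^ n)"
      by (intro mult_left_mono emeasure_zdist_le) auto
    also have "\<dots> = ennreal (12 * ?l * (?l * (real M2 / real L)) ^ n)"
    proof -
      have "?l ^ Suc n * (6 * 2 * x ^ n) = 12 * ?l * (?l * x) ^ n" for x
        by (simp add: power_mult_distrib)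
      moreover have "ennreal (?l ^ Suc n) * ennreal (6 * 2 * (real M2 / real L) ^ n)
          = ennreal (?l ^ Suc n * (6 * 2 * (real M2 / real L) ^ n))"
        by (rule ennreal_mult[symmetric]) simp_all
      ultimately show ?thesis by metis
    qed
    finally show "(\<integral>\<^sup>+ t. ennreal (?l ^ Suc n) * indicator (?A n) t \<partial>lborel) \<le> ennreal (12 * ?l * (?l * (real M2 / real L)) ^ n)" .
  qed
  also have "\<dots> < top"
    unfolding less_top[symmetric]
  proof (rule ennreal_suminf_neq_top)
    show "summable (\<lambda>n. 12 * ?l * (?l * (real M2 / real L)) ^ n)"
      using cond by (intro summable_mult summable_geometric) (auto simp: abs_mult)
  qed auto
  finally show ?thesis by (simp only: infinity_ennreal_def)
qed

end

section \<open>Curves through the Cantor set\<close>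

text \<open>Extended by zero off the cube in order to integrate over the whole space.\<close>

definition jac_norm :: "(real^'m \<Rightarrow> real^'n) \<Rightarrow> real^'m \<Rightarrow> real" where
  "jac_norm w x = indicator cube x * norm (jac w x)"

lemma jac_norm_nonneg: "0 \<le> jac_norm w x"
  by (simp add: jac_norm_def)

lemma measurable_jac_norm:
  fixes w :: "real^'m \<Rightarrow> real^'n"
  assumes "w \<in> smooth_closure cube" shows "jac_norm w \<in> borel_measurable borel"
  using borel_measurable_continuous_on_indicator[OF cube_sets(1) continuous_on_norm[OF smooth_on_cube_facts(3)[OF assms]]]
  by (simp add: jac_norm_def[abs_def])

lemma jac_norm_bounded:
  fixes w :: "real^'m \<Rightarrow> real^'n"
  assumes "w \<in> smooth_closure cube" shows "\<exists>C>0. \<forall>x. jac_norm w x \<le> C"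
  using smooth_on_cube_facts(4)[OF assms] by (force simp: jac_norm_def indicator_def)

lemma jac_directional_bound:
  fixes w :: "real^'m \<Rightarrow> real^'n"
  assumes "x \<in> cube" shows "\<bar>(jac w x *v u) $ j\<bar> \<le> jac_norm w x * norm u"
proof -
  have "\<bar>(jac w x *v u) $ j\<bar> \<le> norm (jac w x $ j) * norm u"
    unfolding matrix_vector_mul_component by (rule Cauchy_Schwarz_ineq2)
  also have "\<dots> \<le> norm (jac w x) * norm u"
    by (intro mult_right_mono Finite_Cartesian_Product.norm_nth_le) auto
  finally show ?thesis using assms by (simp add: jac_norm_def)
qed

context cantor_scheme
begin

text \<open>A curve from the bottom face to the top face over the base point \<open>c\<close>, displaced in the direction \<open>v\<close> by a
small multiple of the distance of \<open>t\<close> from the Cantor set. The displacement also acts in the distinguished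
coordinate; so for fixed \<open>t\<close> the point depends on \<open>v\<close> through a homothety of the whole space, and
Lebesgue measure transforms by a power of its factor.\<close>

definition probe :: "nat \<Rightarrow> real \<Rightarrow> real^'m \<Rightarrow> real^'m \<Rightarrow> real \<Rightarrow> real^'m" where
  "probe N \<epsilon> c v t = c + t *\<^sub>R axis i0 1 + (\<epsilon> * zdist N t) *\<^sub>R v"

lemma probe_nth: "probe N \<epsilon> c v t $ i = c $ i + (if i = i0 then t else 0) + \<epsilon> * zdist N t * v $ i"
  by (simp add: probe_def axis_def)

lemma probe_in_cube:
  assumes \<epsilon>: "0 < \<epsilon>" "\<epsilon> \<le> 1 / 32" and c: "c $ i0 = 0" "\<And>i. 0 \<le> c $ i \<and> c $ i \<le> 1 / 16"
    and v: "\<And>i. 0 \<le> v $ i \<and> v $ i \<le> 1"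
  shows "\<bar>t\<bar> < 1 \<Longrightarrow> probe N \<epsilon> c v t \<in> cube" "\<bar>t\<bar> \<le> 1 \<Longrightarrow> probe N \<epsilon> c v t \<in> closure cube"
proof -
  have b: "0 \<le> \<epsilon> * zdist N t * v $ i \<and> \<epsilon> * zdist N t * v $ i \<le> (1 - \<bar>t\<bar>) / 32" if "\<bar>t\<bar> \<le> 1" for i
  proof -
    have "\<epsilon> * zdist N t * v $ i \<le> 1 / 32 * (1 - \<bar>t\<bar>) * 1"
      using \<epsilon> v[of i] zdist_le_1[OF that, of N] zdist_nonneg[of N t] that by (intro mult_mono) auto
    then show ?thesis using \<epsilon> v[of i] zdist_nonneg[of N t] by simp
  qed
  have "-1 < probe N \<epsilon> c v t $ i \<and> probe N \<epsilon> c v t $ i < 1" if t: "\<bar>t\<bar> < 1" for i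
    using b[of i] t c(1) c(2)[of i] unfolding probe_nth by (cases "i = i0") (auto simp: abs_if split: if_splits)
  then show "\<bar>t\<bar> < 1 \<Longrightarrow> probe N \<epsilon> c v t \<in> cube" by (simp add: cube_def)
  have "-1 \<le> probe N \<epsilon> c v t $ i \<and> probe N \<epsilon> c v t $ i \<le> 1" if t: "\<bar>t\<bar> \<le> 1" for i
    using b[OF t, of i] t c(1) c(2)[of i] unfolding probe_nth by (cases "i = i0") (auto simp: abs_if split: if_splits)
  then show "\<bar>t\<bar> \<le> 1 \<Longrightarrow> probe N \<epsilon> c v t \<in> closure cube" by (simp add: mem_closure_cube)
qed

lemma continuous_probe: "continuous_on S (probe N \<epsilon> c v)"
  unfolding probe_def[abs_def] by (intro continuous_intros continuous_zdist)

text \<open>The displacement vanishes at both ends, so the curve joins two boundary points.\<close>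

lemma probe_inequality:
  fixes w :: "real^'m \<Rightarrow> real^'n"
  assumes w: "w \<in> smooth_closure cube"
    and \<epsilon>: "0 < \<epsilon>" "\<epsilon> * real CARD('m) \<le> 1 / 32" and c: "c $ i0 = 0" "\<And>i. 0 \<le> c $ i \<and> c $ i \<le> 1 / 16"
    and v: "\<And>i. 0 \<le> v $ i \<and> v $ i \<le> 1"
  shows "ennreal \<bar>w (c + axis i0 1) $ j - w (c - axis i0 1) $ j\<bar>
    \<le> (\<integral>\<^sup>+ t. ennreal (2 * jac_norm w (probe N \<epsilon> c v t)) * indicator {-1<..<1} t \<partial>lborel)"
proof -
  have "\<epsilon> * 1 \<le> \<epsilon> * real CARD('m)" using \<epsilon>(1) by (intro mult_left_mono) (auto simp: Suc_leI)
  then have \<epsilon>1: "\<epsilon> \<le> 1 / 32" using \<epsilon> by linarith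
  note inc = probe_in_cube[OF \<epsilon>(1) \<epsilon>1 c v]
  let ?e = "axis i0 1 :: real^'m" and ?p = "probe N \<epsilon> c v"
  obtain B zd where B: "finite B" "\<And>t. t \<notin> B \<Longrightarrow> \<bar>zd t\<bar> \<le> 1 \<and> (zdist N has_real_derivative zd t) (at t)"
    using infdist_finite_deriv[OF finite_skeleton skeleton_nonempty, of N] unfolding zdist_def[abs_def] by metis
  (* The value 0 at the exceptional times makes the bound by g valid at every time. *)
  define D where "D t = (if t \<in> B \<union> {-1, 1} then 0 else (jac w (?p t) *v (?e + (\<epsilon> * zd t) *\<^sub>R v)) $ j)" for t
  define g where "g t = indicator {-1<..<1} t * (2 * jac_norm w (?p t))" for t :: real
  have nv: "norm v \<le> real CARD('m)"
  proof -
    have "norm v \<le> (\<Sum>i\<in>UNIV. norm (v $ i))" by (rule norm_vec_le_sum)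
    also have "\<dots> \<le> (\<Sum>i\<in>(UNIV::'m set). 1)" using v by (intro sum_mono) simp
    finally show ?thesis by simp
  qed
  have "((\<lambda>t. w (?p t) $ j) has_vector_derivative D t) (at t)" if t: "t \<in> {-1<..<1} - B" for t
  proof -
    have zv: "((\<lambda>t. \<epsilon> * zdist N t) has_vector_derivative \<epsilon> * zd t) (at t)"
      using B(2)[of t] t by (auto simp flip: has_real_derivative_iff_has_vector_derivative intro: DERIV_cmult)
    have "((\<lambda>t. (\<epsilon> * zdist N t) *\<^sub>R v) has_vector_derivative (\<epsilon> * zd t) *\<^sub>R v) (at t)"
      by (rule bounded_linear.has_vector_derivative[OF bounded_linear_scaleR_left zv])
    moreover have "((\<lambda>t. c + t *\<^sub>R ?e) has_vector_derivative ?e) (at t)"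
      by (auto intro!: derivative_eq_intros)
    ultimately have "((\<lambda>t. c + t *\<^sub>R ?e + (\<epsilon> * zdist N t) *\<^sub>R v) has_vector_derivative ?e + (\<epsilon> * zd t) *\<^sub>R v) (at t)"
      by (rule has_vector_derivative_add[rotated])
    then have pd: "(?p has_vector_derivative ?e + (\<epsilon> * zd t) *\<^sub>R v) (at t)"
      by (simp add: probe_def[abs_def])
    have "?p t \<in> cube" using inc(1)[of t N] t by auto
    then have "(w has_derivative (\<lambda>u. jac w (?p t) *v u)) (at (?p t))"
      by (intro has_derivative_jac smooth_on_cube_facts(2)[OF w])
    then have wd: "((\<lambda>x. w x $ j) has_derivative (\<lambda>u. (jac w (?p t) *v u) $ j)) (at (?p t))"
      by (rule bounded_linear.has_derivative[OF bounded_linear_vec_nth])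
    have "((\<lambda>t. w (?p t) $ j) has_derivative (\<lambda>s. (jac w (?p t) *v (s *\<^sub>R (?e + (\<epsilon> * zd t) *\<^sub>R v))) $ j)) (at t)"
      using has_derivative_compose[OF pd[unfolded has_vector_derivative_def] wd] .
    then show ?thesis
      using t by (simp add: D_def has_vector_derivative_def matrix_vector_mult_scaleR)
  qed
  moreover have "continuous_on {-1..1} (\<lambda>t. w (?p t) $ j)"
  proof -
    have "continuous_on {-1..1} (\<lambda>t. w (?p t))"
      by (rule continuous_on_compose2[OF smooth_on_cube_facts(1)[OF w] continuous_probe]) (use inc(2) in auto)
    then show ?thesis by (intro continuous_intros)
  qed
  ultimately have FTC: "(D has_integral (w (?p 1) $ j - w (?p (-1)) $ j)) {-1..1}"
    by (intro fundamental_theorem_of_calculus_interior_strong[OF B(1)]) auto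
  have Dg: "norm (D t) \<le> g t" if t: "t \<in> {-1..1}" for t
  proof (cases "t \<in> B \<union> {-1, 1}")
    case True
    then show ?thesis using jac_norm_nonneg[of w] by (auto simp: D_def g_def)
  next
    case False
    then have t1: "\<bar>t\<bar> < 1" using t by auto
    have "\<bar>zd t\<bar> \<le> 1" using B(2)[of t] False by simp
    then have "\<bar>zd t\<bar> * norm v \<le> norm v" using mult_right_mono[of "\<bar>zd t\<bar>" 1 "norm v"] by simp
    then have "norm (?e + (\<epsilon> * zd t) *\<^sub>R v) \<le> 1 + \<epsilon> * norm v"
      using \<epsilon>(1) by (intro order_trans[OF norm_triangle_ineq] add_mono) (auto simp: norm_axis_1 abs_mult intro!: mult_right_mono mult_left_le)
    also have "\<dots> \<le> 1 + \<epsilon> * real CARD('m)" using nv \<epsilon>(1) by simp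
    also have "\<dots> \<le> 2" using \<epsilon>(2) by simp
    finally have "jac_norm w (?p t) * norm (?e + (\<epsilon> * zd t) *\<^sub>R v) \<le> jac_norm w (?p t) * 2"
      by (intro mult_left_mono jac_norm_nonneg)
    then show ?thesis
      using jac_directional_bound[OF inc(1)[OF t1, of N], of w "?e + (\<epsilon> * zd t) *\<^sub>R v" j] False t1
      by (simp add: D_def g_def abs_less_iff)
  qed
  have gm: "g \<in> borel_measurable borel"
  proof -
    have "(\<lambda>t. jac_norm w (?p t)) \<in> borel_measurable borel"
      by (rule measurable_compose[OF borel_measurable_continuous_onI[OF continuous_probe] measurable_jac_norm[OF w]])
    then show ?thesis unfolding g_def[abs_def] by measurable
  qed
  obtain C where C: "C > 0" "\<And>x. jac_norm w x \<le> C" using jac_norm_bounded[OF w] by blast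
  have gint: "integrable lborel g"
  proof (rule Bochner_Integration.integrable_bound)
    show "integrable lborel (\<lambda>t::real. (2 * C) * indicator {-1<..<1} t)"
      by (intro integrable_mult_right integrable_real_indicator) auto
    show "AE t in lborel. norm (g t) \<le> norm ((2 * C) * indicator {-1<..<1} t)"
      using C jac_norm_nonneg[of w] by (intro AE_I2) (simp add: g_def indicator_def)
  qed (use gm in simp)
  have gHK: "(g has_integral (LINT t|lborel. g t)) {-1..1}"
  proof -
    have "(\<lambda>t. if t \<in> {-1..1} then g t else 0) = g" by (auto simp: g_def fun_eq_iff)
    then show ?thesis using has_integral_integral_lborel[OF gint] has_integral_restrict_UNIV[of "{-1..1}" g] by simp
  qed
  have "\<bar>w (?p 1) $ j - w (?p (-1)) $ j\<bar> \<le> (LINT t|lborel. g t)"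
    using Henstock_Kurzweil_Integration.integral_norm_bound_integral[OF has_integral_integrable[OF FTC] has_integral_integrable[OF gHK] Dg]
      integral_unique[OF FTC] integral_unique[OF gHK] by simp
  then have "ennreal \<bar>w (?p 1) $ j - w (?p (-1)) $ j\<bar> \<le> ennreal (LINT t|lborel. g t)" by (rule ennreal_leI)
  also have "\<dots> = (\<integral>\<^sup>+ t. ennreal (g t) \<partial>lborel)"
    by (rule nn_integral_eq_integral[OF gint, symmetric]) (auto simp: g_def jac_norm_nonneg)
  also have "\<dots> = (\<integral>\<^sup>+ t. ennreal (2 * jac_norm w (?p t)) * indicator {-1<..<1} t \<partial>lborel)"
    by (intro nn_integral_cong) (auto simp: g_def indicator_def)
  finally show ?thesis by (simp add: probe_def zdist_pm1)
qed

end

section \<open>Averages over boxes and over the finite stages\<close>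

text \<open>A form of Young's inequality with explicit threshold; the exponents add up without a conjugate exponent.\<close>

lemma split_at_level:
  fixes X B q :: real
  assumes "0 \<le> X" "0 < B" "1 < q" shows "X \<le> B + B powr (1 - q) * X powr q"
proof (cases "X \<le> B")
  case True
  then show ?thesis using assms by (simp add: add_increasing2)
next
  case False
  then have "X = X powr (1 - q) * X powr q" using assms by (simp flip: powr_add)
  also have "\<dots> \<le> B powr (1 - q) * X powr q"
    using False assms by (intro mult_right_mono powr_mono2') auto
  finally show ?thesis using assms by simp
qed

lemma powr_comparable:
  fixes u v a :: real
  assumes "0 < u" "0 < v" "u \<le> 2 * v" "v \<le> 2 * u"
  shows "u powr a \<le> 2 powr \<bar>a\<bar> * v powr a"
proof (cases "0 \<le> a")
  case True
  then have "u powr a \<le> (2 * v) powr a" using assms by (intro powr_mono2) auto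
  then show ?thesis using True by (simp add: powr_mult)
next
  case False
  then have "u powr a \<le> (v / 2) powr a" using assms by (intro powr_mono2') auto
  also have "\<dots> = 2 powr \<bar>a\<bar> * v powr a" using False by (simp add: powr_divide powr_minus_divide)
  finally show ?thesis .
qed

definition unit_box :: "(real^'m) set" where
  "unit_box = {v. \<forall>i. 0 \<le> v $ i \<and> v $ i \<le> 1}"

lemma unit_box_cbox: "unit_box = cbox 0 (\<chi> i. 1)"
  by (auto simp: unit_box_def mem_box_cart)

lemma emeasure_unit_box: "emeasure lborel (unit_box :: (real^'m) set) = 1"
proof -
  have "measure lborel (unit_box :: (real^'m) set) = 1"
    unfolding unit_box_cbox by (subst content_cbox_cart) (auto simp: interval_ne_empty_cart)
  moreover have "emeasure lborel (unit_box :: (real^'m) set) \<noteq> top"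
    unfolding unit_box_cbox using emeasure_lborel_cbox_finite by (simp add: less_top)
  ultimately show ?thesis using emeasure_eq_ennreal_measure by fastforce
qed

lemma unit_box_borel [measurable]: "unit_box \<in> sets borel"
  by (simp add: unit_box_cbox)

lemma nn_integral_unit_box_affine:
  fixes Y :: "real^'m \<Rightarrow> ennreal"
  assumes Y: "Y \<in> borel_measurable borel" and s: "0 < s"
  shows "(\<integral>\<^sup>+ v. Y (b + s *\<^sub>R v) * indicator unit_box v \<partial>lborel)
    = ennreal ((1 / s) ^ CARD('m)) * (\<integral>\<^sup>+ x. Y x * indicator {x. \<forall>i. 0 \<le> x $ i - b $ i \<and> x $ i - b $ i \<le> s} x \<partial>lborel)"
proof -
  let ?A = "{x. \<forall>i. 0 \<le> x $ i - b $ i \<and> x $ i - b $ i \<le> s}"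
  let ?f = "\<lambda>x. Y x * indicator ?A x"
  have "?A = cbox b (\<chi> i. b $ i + s)" by (auto simp: mem_box_cart algebra_simps)
  then have A: "?A \<in> sets borel" by simp
  have f: "?f \<in> borel_measurable borel"
    by (intro borel_measurable_times_ennreal Y borel_measurable_indicator A)
  have T: "(\<lambda>v. b + s *\<^sub>R v) \<in> borel_measurable borel" by measurable
  have i: "indicator ?A (b + s *\<^sub>R v) = (indicator unit_box v :: ennreal)" for v
    using s by (auto simp: indicator_def unit_box_def mult_le_cancel_left1 zero_le_mult_iff dest: spec)
  have "(\<integral>\<^sup>+ x. ?f x \<partial>lborel) = (\<integral>\<^sup>+ x. ?f x \<partial>density (distr lborel borel (\<lambda>v. b + s *\<^sub>R v)) (\<lambda>_. \<bar>s\<bar> ^ DIM(real^'m)))"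
    using lborel_affine[of s b] s by simp
  also have "\<dots> = (\<integral>\<^sup>+ x. ennreal (s ^ CARD('m)) * ?f x \<partial>distr lborel borel (\<lambda>v. b + s *\<^sub>R v))"
    using f s by (subst nn_integral_density) auto
  also have "\<dots> = (\<integral>\<^sup>+ v. ennreal (s ^ CARD('m)) * ?f (b + s *\<^sub>R v) \<partial>lborel)"
    using f T by (subst nn_integral_distr) auto
  also have "\<dots> = ennreal (s ^ CARD('m)) * (\<integral>\<^sup>+ v. ?f (b + s *\<^sub>R v) \<partial>lborel)"
  proof (rule nn_integral_cmult)
    show "(\<lambda>v. ?f (b + s *\<^sub>R v)) \<in> borel_measurable lborel"
      using measurable_compose[OF T f] by simp
  qed
  finally have "(\<integral>\<^sup>+ x. ?f x \<partial>lborel) = ennreal (s ^ CARD('m)) * (\<integral>\<^sup>+ v. Y (b + s *\<^sub>R v) * indicator unit_box v \<partial>lborel)"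
    unfolding i .
  then have "ennreal ((1 / s) ^ CARD('m)) * (\<integral>\<^sup>+ x. ?f x \<partial>lborel)
      = (ennreal ((1 / s) ^ CARD('m)) * ennreal (s ^ CARD('m))) * (\<integral>\<^sup>+ v. Y (b + s *\<^sub>R v) * indicator unit_box v \<partial>lborel)"
    by (simp add: mult.assoc)
  also have "ennreal ((1 / s) ^ CARD('m)) * ennreal (s ^ CARD('m)) = 1"
    using s by (simp add: ennreal_mult[symmetric] flip: power_mult_distrib)
  finally show ?thesis by simp
qed

context cantor_scheme
begin

definition corners :: "nat \<Rightarrow> ('m \<Rightarrow> nat) set" where
  "corners N = PiE (UNIV - {i0}) (\<lambda>_. digits L M1 N)"

definition corner :: "nat \<Rightarrow> ('m \<Rightarrow> nat) \<Rightarrow> real^'m" where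
  "corner N a = (\<chi> i. if i = i0 then 0 else real (a i) / res L N)"

text \<open>Small enough for the displacements of the curves to be negligible against the distances involved.\<close>

definition slope :: real where "slope = 1 / (32 * real CARD('m))"

lemma slope: "0 < slope" "slope * real CARD('m) \<le> 1 / 32" "slope \<le> 1 / 32"
proof -
  have "1 \<le> real CARD('m)" by (simp add: Suc_leI)
  then show "0 < slope" "slope * real CARD('m) \<le> 1 / 32" "slope \<le> 1 / 32"
    by (simp_all add: slope_def field_simps)
qed

lemma finite_corners: "finite (corners N)"
  unfolding corners_def by (intro finite_PiE) auto

lemma card_corners: "card (corners N) = (M1 ^ N) ^ (CARD('m) - 1)"
  unfolding corners_def using M1 by (subst card_PiE) (simp_all add: card_digits card_Diff_singleton)

lemma corner_bounds:
  assumes "a \<in> corners N" shows "corner N a $ i0 = 0" "0 \<le> corner N a $ i \<and> corner N a $ i \<le> 1 / 16"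
proof -
  show "corner N a $ i0 = 0" by (simp add: corner_def)
  show "0 \<le> corner N a $ i \<and> corner N a $ i \<le> 1 / 16"
  proof (cases "i = i0")
    case False
    then have "a i < L ^ N" using assms digits_less[OF M1(2)] by (auto simp: corners_def)
    then have "real (a i) \<le> real L ^ N" by (metis less_imp_le of_nat_le_iff of_nat_power)
    then show ?thesis using False L_pos by (simp add: corner_def res_def field_simps)
  qed (simp add: corner_def)
qed

lemma card_corners_window:
  assumes n: "n \<le> N" and zeta: "\<zeta> * res L n \<le> 1"
  shows "card {a \<in> corners N. \<forall>i. i \<noteq> i0 \<longrightarrow> 0 \<le> x $ i - corner N a $ i \<and> x $ i - corner N a $ i \<le> \<zeta>}
    \<le> (2 * M1 ^ (N - n)) ^ (CARD('m) - 1)"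
proof -
  let ?W = "\<lambda>i. {b \<in> digits L M1 N. 0 \<le> x $ i - real b / res L N \<and> x $ i - real b / res L N \<le> \<zeta>}"
  have "{a \<in> corners N. \<forall>i. i \<noteq> i0 \<longrightarrow> 0 \<le> x $ i - corner N a $ i \<and> x $ i - corner N a $ i \<le> \<zeta>} \<subseteq> PiE (UNIV - {i0}) ?W"
    by (auto simp: corners_def corner_def PiE_def Pi_def)
  then have "card {a \<in> corners N. \<forall>i. i \<noteq> i0 \<longrightarrow> 0 \<le> x $ i - corner N a $ i \<and> x $ i - corner N a $ i \<le> \<zeta>}
      \<le> card (PiE (UNIV - {i0}) ?W)"
    by (intro card_mono finite_PiE) auto
  also have "\<dots> = (\<Prod>i\<in>UNIV - {i0}. card (?W i))" by (subst card_PiE) auto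
  also have "\<dots> \<le> (\<Prod>i\<in>UNIV - {i0}. 2 * M1 ^ (N - n))"
    using card_digits_window[OF M1(2) L_pos n zeta] by (intro prod_mono) auto
  also have "\<dots> = (2 * M1 ^ (N - n)) ^ (CARD('m) - 1)" by (simp add: card_Diff_singleton)
  finally show ?thesis .
qed

text \<open>The finite form of \<open>\<mu> (ball of radius z) = O(z\<^sup>D)\<close> for the uniform measure \<open>\<mu>\<close> on the product
Cantor set, whose dimension is \<open>D = (m - 1) \<beta>\<close>. It only holds for radii above the scale of the stage.\<close>

lemma card_corners_near:
  assumes \<beta>: "real L powr \<beta> = real M1" "0 \<le> \<beta>" and z: "1 / res L N \<le> z" "z \<le> 1"
  shows "real (card {a \<in> corners N. \<forall>i. i \<noteq> i0 \<longrightarrow> 0 \<le> x $ i - corner N a $ i \<and> x $ i - corner N a $ i \<le> 2 * slope * z})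
    \<le> real (card (corners N)) * ((2 * (16 * real L) powr \<beta>) ^ (CARD('m) - 1) * z powr (real (CARD('m) - 1) * \<beta>))"
    (is "real (card ?W) \<le> _")
proof -
  let ?d = "CARD('m) - 1"
  have L1: "1 \<le> real L" using L_pos by simp
  have r: "0 < res L n" for n by (rule res_pos[OF L_pos])
  have z0: "0 < z" using z(1) r[of N] by (smt (verit) divide_pos_pos)
  let ?\<zeta> = "2 * slope * z"
  let ?S = "{n. n \<le> N \<and> ?\<zeta> * res L n \<le> 1}"
  have "?\<zeta> \<le> 1 / 16" using slope z z0 mult_mono[of slope "1/32" z 1] by simp
  then have S0: "0 \<in> ?S" by (simp add: res_def)
  (* The finest stage, up to N, whose scale is not below the window. *)
  define n where "n = Max ?S"
  have fS: "finite ?S" by (rule finite_subset[of _ "{..N}"]) auto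
  have n: "n \<in> ?S" unfolding n_def using fS S0 by (intro Max_in) auto
  have big: "1 / (real L * z) \<le> res L n"
  proof (cases "n = N")
    case True
    have "1 / (real L * z) \<le> 1 / z" using L1 z0 by (intro divide_left_mono) auto
    also have "\<dots> \<le> res L n" using z(1) z0 r[of N] True by (simp add: field_simps)
    finally show ?thesis .
  next
    case False
    have "\<not> Suc n \<in> ?S" using Max_ge[OF fS, of "Suc n"] unfolding n_def[symmetric] by auto
    then have "1 < ?\<zeta> * (real L * res L n)" using n False by (auto simp: res_Suc)
    also have "\<dots> \<le> z * (real L * res L n)"
      using slope z0 L1 r[of n] by (intro mult_right_mono) auto
    finally show ?thesis using z0 L1 by (simp add: field_simps)
  qed
  have M1n: "1 / real M1 ^ n \<le> (16 * real L) powr \<beta> * z powr \<beta>"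
  proof -
    have "real M1 ^ n = (real L ^ n) powr \<beta>"
      using L1 unfolding \<beta>(1)[symmetric] by (subst powr_power) (auto simp: powr_realpow[symmetric] powr_powr)
    moreover have "1 / real L ^ n \<le> 16 * real L * z"
      using big z0 L1 by (simp add: res_def field_simps)
    then have "(1 / real L ^ n) powr \<beta> \<le> (16 * real L * z) powr \<beta>"
      using \<beta>(2) L1 by (intro powr_mono2) auto
    ultimately show ?thesis by (simp add: powr_divide powr_mult)
  qed
  have "real (card ?W) \<le> (2 * real M1 ^ (N - n)) ^ ?d"
    using card_corners_window[of n N ?\<zeta> x] n by (metis (mono_tags, lifting) mem_Collect_eq of_nat_le_iff of_nat_mult of_nat_numeral of_nat_power)
  also have "\<dots> = real (card (corners N)) * (2 * (1 / real M1 ^ n)) ^ ?d"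
  proof -
    have "real M1 ^ (N - n) = real M1 ^ N * (1 / real M1 ^ n)" using n M1 by (simp add: power_diff)
    then have "2 * real M1 ^ (N - n) = real M1 ^ N * (2 * (1 / real M1 ^ n))" by simp
    moreover have "real (card (corners N)) = (real M1 ^ N) ^ ?d" by (simp add: card_corners)
    ultimately show ?thesis by (simp only: power_mult_distrib)
  qed
  also have "\<dots> \<le> real (card (corners N)) * (2 * ((16 * real L) powr \<beta> * z powr \<beta>)) ^ ?d"
    using M1n by (intro mult_left_mono power_mono) auto
  also have "(2 * ((16 * real L) powr \<beta> * z powr \<beta>)) ^ ?d = (2 * (16 * real L) powr \<beta>) ^ ?d * z powr (real ?d * \<beta>)"
    using z0 by (simp add: power_mult_distrib powr_power)
  finally show ?thesis .
qed

end

section \<open>The weight\<close>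

text \<open>The exponent \<open>\<gamma>\<close> is that of the threshold \<open>(dist t K)\<^sup>-\<^sup>\<gamma>\<close> at which the size of the gradient is split, and
\<open>\<beta>\<close> is the dimension of the Cantor sets in the coordinates other than \<open>i0\<close>. The equation between the exponents makes the averaged
weight equal to \<open>(dist t K)\<^sup>\<alpha>\<close>; the last condition makes the threshold integrable.\<close>

locale lavrentiev_scheme = cantor_scheme L M1 M2 i0
  for L M1 M2 :: nat and i0 :: "'m::finite" +
  fixes \<alpha> q \<gamma> \<beta> :: real
  assumes \<alpha>: "0 < \<alpha>" "\<alpha> \<le> 1" and q: "1 < q" and \<gamma>: "0 < \<gamma>"
    and \<beta>: "real L powr \<beta> = real M1" "0 \<le> \<beta>"
    and exponents: "\<gamma> * (q - 1) = \<alpha> + (real CARD('m) - 1) * (1 - \<beta>)"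
    and thin: "real L powr \<gamma> * (real M2 / real L) < 1"
begin

definition weight :: "real^'m \<Rightarrow> real" where
  "weight x = (max 0 (sdist (x $ i0) - ydist x)) powr \<alpha>"

lemma weight_nonneg: "0 \<le> weight x" by (simp add: weight_def)

lemma continuous_ydist: "continuous_on UNIV ydist"
  unfolding ydist_def[abs_def] by (intro continuous_on_sum continuous_on_infdist continuous_intros)

lemma measurable_weight: "weight \<in> borel_measurable borel"
proof -
  have [measurable]: "ydist \<in> borel_measurable borel"
    by (rule borel_measurable_continuous_onI[OF continuous_ydist])
  have [measurable]: "(\<lambda>x::real^'m. sdist (x $ i0)) \<in> borel_measurable borel"
    by (rule measurable_compose[OF borel_measurable_continuous_onI measurable_sdist]) (intro continuous_intros)
  show ?thesis unfolding weight_def[abs_def] by measurable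
qed

text \<open>At these times the stage \<open>N\<close> is fine enough to be indistinguishable from the Cantor set up to
constants. The remaining times have small measure.\<close>

definition good_time :: "nat \<Rightarrow> real set" where
  "good_time N = {t. \<bar>t\<bar> < 1 \<and> 4 / res L N < zdist N t}"

text \<open>The pairs of a time \<open>t\<close> and a point that is reached at time \<open>t\<close> by a curve over \<open>c\<close> with \<open>v\<close> in the unit box.\<close>

definition tube :: "nat \<Rightarrow> real^'m \<Rightarrow> (real \<times> (real^'m)) set" where
  "tube N c = {p. \<forall>i. 0 \<le> snd p $ i - (c + fst p *\<^sub>R axis i0 1) $ i \<and>
     snd p $ i - (c + fst p *\<^sub>R axis i0 1) $ i \<le> slope * zdist N (fst p)}"

text \<open>The density with respect to Lebesgue measure of the points on the curves over \<open>c\<close>, weighted by the power of the distance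
that results from splitting at the threshold.\<close>

definition kernel :: "nat \<Rightarrow> real^'m \<Rightarrow> real \<Rightarrow> real^'m \<Rightarrow> ennreal" where
  "kernel N c t x = indicator (good_time N) t *
     ennreal (zdist N t powr (\<gamma> * (q - 1)) * (1 / (slope * zdist N t)) ^ CARD('m)) * indicator (tube N c) (t, x)"

definition C1 :: real where
  "C1 = (1 / slope) ^ CARD('m) * 2 powr \<bar>\<gamma> * (q - 1) - real CARD('m)\<bar>"

definition C2 :: real where
  "C2 = (2 * (16 * real L) powr \<beta>) ^ (CARD('m) - 1)"

definition C3 :: real where "C3 = C1 * C2 * 4 powr \<alpha>"

lemma C_pos: "0 < C1" "0 < C2" "0 < C3"
proof -
  show 1: "0 < C1" using slope by (simp add: C1_def)
  show 2: "0 < C2" using L_pos by (simp add: C2_def)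
  show "0 < C3" using 1 2 by (simp add: C3_def)
qed

lemma good_time_borel: "good_time N \<in> sets borel"
  unfolding good_time_def by measurable

lemma tube_borel: "tube N c \<in> sets borel"
proof (rule borel_closed)
  have z: "continuous_on UNIV (\<lambda>p. zdist N (fst p))"
    by (rule continuous_on_compose2[OF continuous_zdist[of UNIV]]) (auto intro: continuous_intros)
  show "closed (tube N c)"
    unfolding tube_def
    by (intro closed_Collect_all closed_Collect_conj closed_Collect_le continuous_intros z)
qed

lemma measurable_kernel: "(\<lambda>(t, x). kernel N c t x) \<in> borel_measurable (borel \<Otimes>\<^sub>M borel)"
proof -
  have 1: "(\<lambda>t. indicator (good_time N) t *
     ennreal (zdist N t powr (\<gamma> * (q - 1)) * (1 / (slope * zdist N t)) ^ CARD('m))) \<in> borel_measurable borel"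
    using good_time_borel[of N] by measurable
  have 2: "(indicator (tube N c) :: _ \<Rightarrow> ennreal) \<in> borel_measurable (borel \<Otimes>\<^sub>M borel)"
    by (rule borel_measurable_indicator, subst borel_prod, rule tube_borel)
  show ?thesis
    unfolding kernel_def[abs_def] split_def
    using borel_measurable_times_ennreal[OF measurable_compose[OF measurable_fst 1] 2] by simp
qed

text \<open>A point \<open>x\<close> is met only at times \<open>t\<close> that differ from its own distinguished coordinate by less than a
small multiple of the distance from the Cantor set. So the distances at both times are comparable, and the
set of such times is no longer than this distance.\<close>

lemma kernel_time_integral:
  assumes x: "\<bar>x $ i0\<bar> < 1" and c: "c $ i0 = 0"
  shows "(\<integral>\<^sup>+ t. kernel N c t x \<partial>lborel)
    \<le> ennreal (C1 * zdist N (x $ i0) powr (\<gamma> * (q - 1) - real CARD('m) + 1)) *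
      indicator {x. 2 / res L N \<le> zdist N (x $ i0) \<and>
        (\<forall>i. i \<noteq> i0 \<longrightarrow> 0 \<le> x $ i - c $ i \<and> x $ i - c $ i \<le> 2 * slope * zdist N (x $ i0))} x"
proof -
  let ?g = "\<gamma> * (q - 1)" and ?d = "real CARD('m)" and ?\<tau> = "x $ i0"
  let ?z = "zdist N ?\<tau>"
  let ?S = "{x. 2 / res L N \<le> zdist N (x $ i0) \<and>
        (\<forall>i. i \<noteq> i0 \<longrightarrow> 0 \<le> x $ i - c $ i \<and> x $ i - c $ i \<le> 2 * slope * zdist N (x $ i0))}"
  have r: "0 < res L N" by (rule res_pos[OF L_pos])
  have le: "kernel N c t x \<le> ennreal (C1 * ?z powr (?g - ?d)) * indicator ?S x * indicator {?\<tau> - ?z..?\<tau>} t" for t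
  proof (cases "t \<in> good_time N \<and> (t, x) \<in> tube N c")
    case True
    let ?y = "zdist N t"
    have g4: "4 / res L N < ?y" using True by (simp add: good_time_def)
    then have y0: "0 < ?y" using r by (smt (verit) divide_pos_pos)
    have tube: "0 \<le> x $ i - (c $ i + (if i = i0 then t else 0)) \<and> x $ i - (c $ i + (if i = i0 then t else 0)) \<le> slope * ?y" for i
    proof -
      have e: "(c + t *\<^sub>R axis i0 1) $ i = c $ i + (if i = i0 then t else 0)" by (simp add: axis_def)
      have "(t, x) \<in> tube N c" using True by simp
      from CollectD[OF this[unfolded tube_def]] show ?thesis
        unfolding fst_conv snd_conv e[symmetric] by blast
    qed
    have sy: "slope * ?y \<le> ?y / 32" using slope(3) y0 mult_right_mono[of slope "1/32" ?y] by simp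
    have t: "0 \<le> ?\<tau> - t" "?\<tau> - t \<le> slope * ?y" using tube[of i0] c by auto
    have "\<bar>?y - ?z\<bar> \<le> \<bar>?\<tau> - t\<bar>"
      unfolding zdist_def using infdist_triangle_abs[of t "skeleton N" ?\<tau>] by (simp add: dist_real_def abs_minus_commute)
    then have yz: "?y \<le> 2 * ?z" "?z \<le> 2 * ?y" "?y / 32 \<le> ?z" using t sy y0 by linarith+
    then have z0: "0 < ?z" using y0 by linarith
    have "slope * ?y \<le> 2 * slope * ?z" using yz(1) slope(1) by simp
    then have "0 \<le> x $ i - c $ i \<and> x $ i - c $ i \<le> 2 * slope * ?z" if "i \<noteq> i0" for i
      using tube[of i] that by auto
    moreover have "2 / res L N \<le> ?z" using g4 yz by simp
    ultimately have xS: "x \<in> ?S" by simp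
    have "?y powr ?g * (1 / (slope * ?y)) ^ CARD('m) = (1 / slope) ^ CARD('m) * ?y powr (?g - ?d)"
      using y0 by (simp add: powr_diff powr_realpow power_mult_distrib power_divide)
    also have "\<dots> \<le> (1 / slope) ^ CARD('m) * (2 powr \<bar>?g - ?d\<bar> * ?z powr (?g - ?d))"
      using y0 z0 yz slope by (intro mult_left_mono powr_comparable) auto
    also have "\<dots> = C1 * ?z powr (?g - ?d)" by (simp add: C1_def)
    finally have "kernel N c t x \<le> ennreal (C1 * ?z powr (?g - ?d))"
      using True by (simp add: kernel_def ennreal_leI)
    moreover have "t \<in> {?\<tau> - ?z..?\<tau>}" using t sy yz by simp
    ultimately show ?thesis using xS by simp
  next
    case False
    then show ?thesis by (auto simp: kernel_def indicator_def)
  qed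
  have "(\<integral>\<^sup>+ t. kernel N c t x \<partial>lborel)
      \<le> (\<integral>\<^sup>+ t. ennreal (C1 * ?z powr (?g - ?d)) * indicator ?S x * indicator {?\<tau> - ?z..?\<tau>} t \<partial>lborel)"
    by (rule nn_integral_mono) (rule le)
  also have "\<dots> = ennreal (C1 * ?z powr (?g - ?d)) * indicator ?S x * emeasure lborel {?\<tau> - ?z..?\<tau>}"
    by (rule nn_integral_cmult_indicator) simp
  also have "\<dots> = ennreal (C1 * ?z powr (?g - ?d)) * indicator ?S x * ennreal ?z"
    using zdist_nonneg[of N ?\<tau>] by simp
  also have "\<dots> = ennreal (C1 * ?z powr (?g - ?d) * ?z) * indicator ?S x"
    using C_pos zdist_nonneg[of N ?\<tau>] by (simp add: ennreal_mult mult_ac)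
  also have "\<dots> = ennreal (C1 * ?z powr (?g - ?d + 1)) * indicator ?S x"
  proof (cases "x \<in> ?S")
    case True
    then have "0 < ?z" using r by (auto intro: less_le_trans[of 0 "2 / res L N"])
    then show ?thesis by (simp add: powr_add mult.assoc)
  qed simp
  finally show ?thesis .
qed

text \<open>Let \<open>z\<close> be the distance of \<open>t\<close> from the stage \<open>N\<close>. Summing over the base points replaces the indicator of a single tube by the number of nearby base
points, which contributes \<open>z\<^sup>D\<close>; altogether the power of \<open>z\<close> becomes \<open>z\<^sup>\<alpha>\<close>. If there is a nearby base point
at all, then the distance of \<open>y\<close> from \<open>S\<close> is at most half of that of \<open>t\<close> from \<open>K\<close>, and the weight is
comparable to \<open>z\<^sup>\<alpha>\<close>.\<close>

lemma sum_kernel_le_weight: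
  assumes x: "x \<in> cube"
  shows "(\<Sum>a\<in>corners N. \<integral>\<^sup>+ t. kernel N (corner N a) t x \<partial>lborel)
    \<le> ennreal (real (card (corners N)) * C3 * weight x)"
proof -
  let ?g = "\<gamma> * (q - 1)" and ?d = "real CARD('m)" and ?\<tau> = "x $ i0"
  let ?z = "zdist N ?\<tau>"
  let ?W = "{a \<in> corners N. \<forall>i. i \<noteq> i0 \<longrightarrow> 0 \<le> x $ i - corner N a $ i \<and> x $ i - corner N a $ i \<le> 2 * slope * ?z}"
  have r: "0 < res L N" by (rule res_pos[OF L_pos])
  have \<tau>: "\<bar>?\<tau>\<bar> < 1" using x by (auto simp: cube_def abs_less_iff minus_less_iff)
  have d1: "1 \<le> CARD('m)" by (simp add: Suc_leI)
  have "(\<Sum>a\<in>corners N. \<integral>\<^sup>+ t. kernel N (corner N a) t x \<partial>lborel)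
      \<le> (\<Sum>a\<in>corners N. if 2 / res L N \<le> ?z \<and> a \<in> ?W then ennreal (C1 * ?z powr (?g - ?d + 1)) else 0)"
  proof (rule sum_mono)
    fix a assume a: "a \<in> corners N"
    show "(\<integral>\<^sup>+ t. kernel N (corner N a) t x \<partial>lborel) \<le> (if 2 / res L N \<le> ?z \<and> a \<in> ?W then ennreal (C1 * ?z powr (?g - ?d + 1)) else 0)"
    proof (cases "2 / res L N \<le> ?z \<and> a \<in> ?W")
      case True
      then show ?thesis
        using kernel_time_integral[OF \<tau> corner_bounds(1)[OF a], of N] by simp
    next
      case False
      then have "x \<notin> {x. 2 / res L N \<le> zdist N (x $ i0) \<and>
        (\<forall>i. i \<noteq> i0 \<longrightarrow> 0 \<le> x $ i - corner N a $ i \<and> x $ i - corner N a $ i \<le> 2 * slope * zdist N (x $ i0))}"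
        using a by blast
      then show ?thesis
        using kernel_time_integral[OF \<tau> corner_bounds(1)[OF a], of N]
        unfolding if_not_P[OF False] indicator_simps(2)[OF \<open>x \<notin> _\<close>] mult_zero_right
        by blast
    qed
  qed
  also have "\<dots> \<le> ennreal (real (card (corners N)) * C3 * weight x)"
  proof (cases "2 / res L N \<le> ?z \<and> ?W \<noteq> {}")
    case False
    then have "(\<Sum>a\<in>corners N. if 2 / res L N \<le> ?z \<and> a \<in> ?W then ennreal (C1 * ?z powr (?g - ?d + 1)) else 0) = 0"
      by (intro sum.neutral) auto
    then show ?thesis by simp
  next
    case True
    then obtain a where a: "a \<in> ?W" by blast
    have z2: "2 / res L N \<le> ?z" using True by blast
    then have z0: "0 < ?z" using r by (auto intro: less_le_trans[of 0 "2 / res L N"])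
    have z1: "?z \<le> 1" using zdist_le_1[of ?\<tau> N] \<tau> by simp
    have zr: "1 / res L N \<le> ?z" using z2 r by (smt (verit) divide_right_mono)
    have yd: "ydist x \<le> ?z / 4"
    proof -
      have "infdist (x $ i) (corner_set L M1) \<le> 2 * slope * ?z" if i: "i \<in> UNIV - {i0}" for i
      proof -
        have "corner N a $ i \<in> corner_set L M1"
          using a i by (auto simp: corner_def corners_def corner_set_def corner_points_def)
        then have "infdist (x $ i) (corner_set L M1) \<le> dist (x $ i) (corner N a $ i)" by (rule infdist_le)
        also have "\<dots> \<le> 2 * slope * ?z" using a i by (simp add: dist_real_def)
        finally show ?thesis .
      qed
      then have "ydist x \<le> (\<Sum>i\<in>UNIV - {i0}. 2 * slope * ?z)" unfolding ydist_def by (rule sum_mono)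
      also have "\<dots> \<le> ?d * (2 * slope * ?z)"
        using slope z0 by (simp add: card_Diff_singleton mult_right_mono)
      also have "\<dots> \<le> ?z / 4" using mult_right_mono[OF slope(2), of ?z] z0 by (simp add: mult_ac)
      finally show ?thesis .
    qed
    moreover have "?z / 2 \<le> sdist ?\<tau>"
    proof -
      have "1 / res L N \<le> ?z / 2" using z2 by simp
      then show ?thesis using zdist_le_sdist[of N ?\<tau>] by linarith
    qed
    ultimately have mz: "?z / 4 \<le> max 0 (sdist ?\<tau> - ydist x)" by linarith
    have "(?z / 4) powr \<alpha> \<le> weight x"
      unfolding weight_def by (rule powr_mono2[OF _ _ mz]) (use \<alpha> z0 in auto)
    then have wz: "?z powr \<alpha> \<le> 4 powr \<alpha> * weight x" by (simp add: powr_divide divide_le_eq mult.commute)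
    have "(\<Sum>a\<in>corners N. if 2 / res L N \<le> ?z \<and> a \<in> ?W then ennreal (C1 * ?z powr (?g - ?d + 1)) else 0)
        = (\<Sum>a\<in>?W. ennreal (C1 * ?z powr (?g - ?d + 1)))"
      using z2 finite_corners[of N] by (intro sum.mono_neutral_cong_right) auto
    also have "\<dots> = ennreal (real (card ?W) * (C1 * ?z powr (?g - ?d + 1)))"
      using C_pos by (simp add: ennreal_mult ennreal_of_nat_eq_real_of_nat)
    also have "\<dots> \<le> ennreal (real (card (corners N)) * C3 * weight x)"
    proof (rule ennreal_leI)
      have "real (card ?W) * (C1 * ?z powr (?g - ?d + 1))
          \<le> real (card (corners N)) * (C2 * ?z powr (real (CARD('m) - 1) * \<beta>)) * (C1 * ?z powr (?g - ?d + 1))"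
        unfolding C2_def using C_pos by (intro mult_right_mono card_corners_near[OF \<beta> zr z1]) auto
      also have "\<dots> = real (card (corners N)) * (C1 * C2) * ?z powr (real (CARD('m) - 1) * \<beta> + (?g - ?d + 1))"
        by (simp add: powr_add mult_ac)
      also have "real (CARD('m) - 1) * \<beta> + (?g - ?d + 1) = \<alpha>"
        unfolding exponents using d1 by (simp add: of_nat_diff algebra_simps)
      also have "real (card (corners N)) * (C1 * C2) * ?z powr \<alpha> \<le> real (card (corners N)) * (C1 * C2) * (4 powr \<alpha> * weight x)"
        using C_pos by (intro mult_left_mono wz) auto
      finally show "real (card ?W) * (C1 * ?z powr (?g - ?d + 1)) \<le> real (card (corners N)) * C3 * weight x"
        by (simp add: C3_def mult_ac)
    qed
    finally show ?thesis .
  qed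
  finally show ?thesis .
qed

end

section \<open>The jump of a smooth map costs energy\<close>

context lavrentiev_scheme
begin

text \<open>The three terms on the right belong to the times at which the stage \<open>N\<close> is not fine enough, to gradients below
the threshold and to gradients above it.\<close>

lemma slice_bound:
  fixes w :: "real^'m \<Rightarrow> real^'n"
  assumes w: "w \<in> smooth_closure cube" and Cw: "0 < Cw" "\<And>x. jac_norm w x \<le> Cw" and \<delta>: "0 < \<delta>"
  shows "(\<integral>\<^sup>+ v. ennreal (2 * jac_norm w (probe N slope c v t)) * indicator {-1<..<1} t * indicator unit_box v \<partial>lborel)
    \<le> ennreal (2 * Cw) * indicator {t. zdist N t \<le> 4 / res L N} t
      + ennreal (2 * \<delta>) * (ennreal (sdist t powr (- \<gamma>)) * indicator {-1<..<1} t)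
      + ennreal (2 * \<delta> powr (1 - q)) * (\<integral>\<^sup>+ x. ennreal (jac_norm w x powr q) * kernel N c t x \<partial>lborel)"
    (is "?lhs \<le> ?A + ?B + ?C")
proof (cases "t \<in> {-1<..<1}")
  case t: True
  let ?X = "jac_norm w"
  have um: "(indicator unit_box :: (real^'m) \<Rightarrow> ennreal) \<in> borel_measurable lborel"
    by (intro borel_measurable_indicator) simp
  have pm: "(\<lambda>v. probe N slope c v t) \<in> borel_measurable borel"
    unfolding probe_def by measurable
  show ?thesis
  proof (cases "zdist N t \<le> 4 / res L N")
    case True
    have "?lhs \<le> (\<integral>\<^sup>+ v. ennreal (2 * Cw) * indicator unit_box (v :: real^'m) \<partial>lborel)"
    proof (rule nn_integral_mono)
      fix v :: "real^'m"
      have "2 * ?X (probe N slope c v t) \<le> 2 * Cw" using Cw by simp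
      then have "ennreal (2 * ?X (probe N slope c v t)) \<le> ennreal (2 * Cw)" by (rule ennreal_leI)
      then show "ennreal (2 * ?X (probe N slope c v t)) * indicator {-1<..<1} t * indicator unit_box v
          \<le> ennreal (2 * Cw) * indicator unit_box v"
        using t by (cases "v \<in> unit_box") simp_all
    qed
    also have "\<dots> = ennreal (2 * Cw) * emeasure lborel (unit_box :: (real^'m) set)"
      by (rule nn_integral_cmult_indicator) simp
    also have "\<dots> = ?A" using True by (simp add: emeasure_unit_box)
    finally show ?thesis by (simp add: add_increasing2)
  next
    case False
    let ?z = "zdist N t"
    let ?g = "\<gamma> * (q - 1)"
    have r: "0 < res L N" by (rule res_pos[OF L_pos])
    have z0: "0 < ?z" using False r by (smt (verit) divide_pos_pos)
    have good: "t \<in> good_time N" using t False by (auto simp: good_time_def abs_less_iff)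
    have s0: "0 < sdist t"
    proof -
      have "1 / res L N \<le> 4 / res L N" using r by (intro divide_right_mono) auto
      then show ?thesis using zdist_le_sdist[of N t] False by linarith
    qed
    let ?Bd = "\<delta> * ?z powr (- \<gamma>)"
    have B0: "0 < ?Bd" using \<delta> z0 by simp
    (* The power of the threshold that is left in front of the q-th power of the gradient. *)
    have Bq: "?Bd powr (1 - q) = \<delta> powr (1 - q) * ?z powr ?g"
      by (simp add: powr_mult powr_powr algebra_simps)
    have zs: "?z powr (- \<gamma>) \<le> sdist t powr (- \<gamma>)"
      using s0 sdist_le_zdist[of t N] \<gamma> by (intro powr_mono2') auto
    have pt: "ennreal (2 * ?X (probe N slope c v t)) \<le> ennreal (2 * ?Bd)
        + ennreal (2 * \<delta> powr (1 - q) * ?z powr ?g) * ennreal (?X (probe N slope c v t) powr q)" for v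
    proof -
      have "2 * ?X (probe N slope c v t) \<le> 2 * (?Bd + ?Bd powr (1 - q) * ?X (probe N slope c v t) powr q)"
        using split_at_level[OF jac_norm_nonneg B0 q, of w "probe N slope c v t"] by simp
      also have "\<dots> = 2 * ?Bd + (2 * \<delta> powr (1 - q) * ?z powr ?g) * ?X (probe N slope c v t) powr q"
        unfolding Bq by (simp add: algebra_simps)
      finally have "ennreal (2 * ?X (probe N slope c v t)) \<le> ennreal (2 * ?Bd + (2 * \<delta> powr (1 - q) * ?z powr ?g) * ?X (probe N slope c v t) powr q)"
        by (rule ennreal_leI)
      also have "\<dots> = ennreal (2 * ?Bd) + ennreal (2 * \<delta> powr (1 - q) * ?z powr ?g) * ennreal (?X (probe N slope c v t) powr q)"
        using B0 \<delta> by (subst ennreal_plus) (auto simp: ennreal_mult)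
      finally show ?thesis .
    qed
    let ?k = "ennreal (2 * \<delta> powr (1 - q) * ?z powr ?g)"
    have Xq: "(\<lambda>x. ennreal (?X x powr q)) \<in> borel_measurable borel"
      using measurable_jac_norm[OF w] by measurable
    have Xp: "(\<lambda>v. ennreal (?X (probe N slope c v t) powr q) * indicator unit_box v) \<in> borel_measurable lborel"
      using measurable_compose[OF pm Xq] um by (intro borel_measurable_times_ennreal) auto
    have "?lhs \<le> (\<integral>\<^sup>+ v. ennreal (2 * ?Bd) * indicator unit_box v + ?k * (ennreal (?X (probe N slope c v t) powr q) * indicator unit_box v) \<partial>lborel)"
    proof (rule nn_integral_mono)
      fix v :: "real^'m"
      show "ennreal (2 * ?X (probe N slope c v t)) * indicator {-1<..<1} t * indicator unit_box v
         \<le> ennreal (2 * ?Bd) * indicator unit_box v + ?k * (ennreal (?X (probe N slope c v t) powr q) * indicator unit_box v)"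
        using pt[of v] t by (cases "v \<in> unit_box") simp_all
    qed
    also have "\<dots> = (\<integral>\<^sup>+ v. ennreal (2 * ?Bd) * indicator unit_box (v :: real^'m) \<partial>lborel)
        + (\<integral>\<^sup>+ v. ?k * (ennreal (?X (probe N slope c v t) powr q) * indicator unit_box v) \<partial>lborel)"
      by (rule nn_integral_add) (use um Xp in \<open>auto intro!: borel_measurable_times_ennreal\<close>)
    also have "(\<integral>\<^sup>+ v. ennreal (2 * ?Bd) * indicator unit_box (v :: real^'m) \<partial>lborel) = ennreal (2 * ?Bd) * emeasure lborel (unit_box :: (real^'m) set)"
      by (rule nn_integral_cmult_indicator) simp
    also have "\<dots> = ennreal (2 * ?Bd)" by (simp add: emeasure_unit_box)
    also have "(\<integral>\<^sup>+ v. ?k * (ennreal (?X (probe N slope c v t) powr q) * indicator unit_box v) \<partial>lborel)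
        = ?k * (\<integral>\<^sup>+ v. ennreal (?X (probe N slope c v t) powr q) * indicator unit_box v \<partial>lborel)"
      by (rule nn_integral_cmult[OF Xp])
    also have "(\<integral>\<^sup>+ v. ennreal (?X (probe N slope c v t) powr q) * indicator unit_box v \<partial>lborel)
        = ennreal ((1 / (slope * ?z)) ^ CARD('m)) * (\<integral>\<^sup>+ x. ennreal (?X x powr q) * indicator {x. \<forall>i. 0 \<le> x $ i - (c + t *\<^sub>R axis i0 1) $ i \<and> x $ i - (c + t *\<^sub>R axis i0 1) $ i \<le> slope * ?z} x \<partial>lborel)"
      unfolding probe_def using z0 slope by (intro nn_integral_unit_box_affine[OF Xq]) simp
    also have "ennreal (2 * ?Bd) \<le> ?B"
    proof -
      have "2 * ?Bd \<le> 2 * \<delta> * sdist t powr (- \<gamma>)" using zs \<delta> by simp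
      then show ?thesis using t \<delta> by (simp add: ennreal_mult[symmetric] ennreal_leI)
    qed
    also have "?k * (ennreal ((1 / (slope * ?z)) ^ CARD('m)) * (\<integral>\<^sup>+ x. ennreal (?X x powr q) * indicator {x. \<forall>i. 0 \<le> x $ i - (c + t *\<^sub>R axis i0 1) $ i \<and> x $ i - (c + t *\<^sub>R axis i0 1) $ i \<le> slope * ?z} x \<partial>lborel)) = ?C"
    proof -
      let ?m = "ennreal (?z powr ?g * (1 / (slope * ?z)) ^ CARD('m))"
      have ker: "kernel N c t x = ?m * indicator {x. \<forall>i. 0 \<le> x $ i - (c + t *\<^sub>R axis i0 1) $ i \<and> x $ i - (c + t *\<^sub>R axis i0 1) $ i \<le> slope * ?z} x" for x
        using good by (simp add: kernel_def tube_def indicator_def)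
      let ?I = "indicator {x. \<forall>i. 0 \<le> x $ i - (c + t *\<^sub>R axis i0 1) $ i \<and> x $ i - (c + t *\<^sub>R axis i0 1) $ i \<le> slope * ?z} :: (real^'m) \<Rightarrow> ennreal"
      have "{x. \<forall>i. 0 \<le> x $ i - (c + t *\<^sub>R axis i0 1) $ i \<and> x $ i - (c + t *\<^sub>R axis i0 1) $ i \<le> slope * ?z}
          = cbox (c + t *\<^sub>R axis i0 1) (\<chi> i. (c + t *\<^sub>R axis i0 1) $ i + slope * ?z)"
        by (auto simp: mem_box_cart algebra_simps)
      then have Im: "?I \<in> borel_measurable lborel" by (intro borel_measurable_indicator) simp
      have "(\<integral>\<^sup>+ x. ennreal (?X x powr q) * kernel N c t x \<partial>lborel) = (\<integral>\<^sup>+ x. ?m * (ennreal (?X x powr q) * ?I x) \<partial>lborel)"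
        unfolding ker by (intro nn_integral_cong) (simp add: mult_ac)
      also have "\<dots> = ?m * (\<integral>\<^sup>+ x. ennreal (?X x powr q) * ?I x \<partial>lborel)"
        by (rule nn_integral_cmult) (use Xq Im in \<open>auto intro!: borel_measurable_times_ennreal\<close>)
      finally have e: "(\<integral>\<^sup>+ x. ennreal (?X x powr q) * kernel N c t x \<partial>lborel) = ?m * (\<integral>\<^sup>+ x. ennreal (?X x powr q) * ?I x \<partial>lborel)" .
      have "?k * ennreal ((1 / (slope * ?z)) ^ CARD('m)) = ennreal (2 * \<delta> powr (1 - q)) * ?m"
        using slope z0 by (simp add: ennreal_mult[symmetric] mult.assoc)
      then show ?thesis unfolding e by (simp only: mult.assoc[symmetric])
    qed
    finally have fin: "?lhs \<le> ?B + ?C" by (simp add: add_right_mono)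
    have "?B + ?C \<le> ?A + ?B + ?C" unfolding add.assoc by (rule add_increasing) simp_all
    then show ?thesis using fin by (rule order_trans[rotated])
  qed
next
  case False
  then have "?lhs = 0" by simp
  then show ?thesis by simp
qed

text \<open>The inequality along single curves is integrated over \<open>v\<close> and the order of integration is exchanged twice:
first to fix \<open>t\<close> and change variables from \<open>v\<close> to the point on the curve, and then to fix this point and integrate
over \<open>t\<close>.\<close>

lemma corner_inequality:
  fixes w :: "real^'m \<Rightarrow> real^'n"
  assumes w: "w \<in> smooth_closure cube" and Cw: "0 < Cw" "\<And>x. jac_norm w x \<le> Cw" and \<delta>: "0 < \<delta>"
    and c: "c $ i0 = 0" "\<And>i. 0 \<le> c $ i \<and> c $ i \<le> 1 / 16"
    and jump: "\<bar>w (c + axis i0 1) $ j - w (c - axis i0 1) $ j\<bar> = 2"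
  shows "2 \<le> ennreal (2 * Cw) * emeasure lborel {t. zdist N t \<le> 4 / res L N}
      + ennreal (2 * \<delta>) * (\<integral>\<^sup>+ t. ennreal (sdist t powr (- \<gamma>)) * indicator {-1<..<1} t \<partial>lborel)
      + ennreal (2 * \<delta> powr (1 - q)) * (\<integral>\<^sup>+ x. ennreal (jac_norm w x powr q) * (\<integral>\<^sup>+ t. kernel N c t x \<partial>lborel) \<partial>lborel)"
proof -
  let ?X = "jac_norm w"
  let ?F = "\<lambda>t v. ennreal (2 * ?X (probe N slope c v t)) * indicator {-1<..<1} t * indicator unit_box v"
  have Xm: "?X \<in> borel_measurable borel" by (rule measurable_jac_norm[OF w])
  have Xq: "(\<lambda>x. ennreal (?X x powr q)) \<in> borel_measurable borel"
    using Xm by measurable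
  have pm: "(\<lambda>p. probe N slope c (snd p) (fst p)) \<in> borel_measurable (borel :: (real \<times> (real^'m)) measure)"
    unfolding probe_def
    by (intro borel_measurable_continuous_onI continuous_intros continuous_on_compose2[OF continuous_zdist[of UNIV]]) auto
  have Fm: "case_prod ?F \<in> borel_measurable ((lborel :: real measure) \<Otimes>\<^sub>M (lborel :: (real^'m) measure))"
  proof -
    have "(\<lambda>p. ennreal (2 * ?X (probe N slope c (snd p) (fst p)))) \<in> borel_measurable (borel :: (real \<times> (real^'m)) measure)"
      using measurable_compose[OF pm Xm] by measurable
    then have 1: "(\<lambda>p. ennreal (2 * ?X (probe N slope c (snd p) (fst p)))) \<in> borel_measurable ((lborel :: real measure) \<Otimes>\<^sub>M (lborel :: (real^'m) measure))"
      by (simp add: lborel_prod)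
    have 2: "(\<lambda>p. indicator {-1<..<1} (fst p) :: ennreal) \<in> borel_measurable ((lborel :: real measure) \<Otimes>\<^sub>M (lborel :: (real^'m) measure))"
      by (rule measurable_compose[OF measurable_fst]) (rule borel_measurable_indicator, simp)
    have 3: "(\<lambda>p. indicator unit_box (snd p) :: ennreal) \<in> borel_measurable ((lborel :: real measure) \<Otimes>\<^sub>M (lborel :: (real^'m) measure))"
      by (rule measurable_compose[OF measurable_snd]) (rule borel_measurable_indicator, simp)
    show ?thesis unfolding split_def
      by (intro borel_measurable_times_ennreal 1 2 3)
  qed
  have Km: "(\<lambda>p. ennreal (?X (snd p) powr q) * kernel N c (fst p) (snd p)) \<in> borel_measurable ((lborel :: real measure) \<Otimes>\<^sub>M (lborel :: (real^'m) measure))"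
  proof -
    have "(\<lambda>p. ennreal (?X (snd p) powr q)) \<in> borel_measurable ((lborel :: real measure) \<Otimes>\<^sub>M (lborel :: (real^'m) measure))"
      by (rule measurable_compose[OF measurable_snd]) (simp add: Xq)
    moreover have "(\<lambda>p. kernel N c (fst p) (snd p)) \<in> borel_measurable ((lborel :: real measure) \<Otimes>\<^sub>M (lborel :: (real^'m) measure))"
      using measurable_kernel[of N c] by (simp add: split_def cong: measurable_cong_sets sets_pair_measure_cong)
    ultimately show ?thesis by (rule borel_measurable_times_ennreal)
  qed
  have k1: "kernel N c t \<in> borel_measurable lborel" for t
    using measurable_compose[OF measurable_Pair1'[of t borel borel] measurable_kernel[of N c]] by simp
  have k2: "(\<lambda>t. kernel N c t x) \<in> borel_measurable lborel" for x
    using measurable_compose[OF measurable_Pair2'[of x borel borel] measurable_kernel[of N c]] by simp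
  have "2 = (\<integral>\<^sup>+ v. 2 * indicator unit_box (v :: real^'m) \<partial>lborel)"
    by (subst nn_integral_cmult_indicator) (simp_all add: emeasure_unit_box)
  also have "\<dots> \<le> (\<integral>\<^sup>+ v. \<integral>\<^sup>+ t. ?F t v \<partial>lborel \<partial>lborel)"
  proof (rule nn_integral_mono)
    fix v :: "real^'m"
    show "2 * indicator unit_box v \<le> (\<integral>\<^sup>+ t. ?F t v \<partial>lborel)"
    proof (cases "v \<in> unit_box")
      case True
      then have v: "\<And>i. 0 \<le> v $ i \<and> v $ i \<le> 1" by (simp add: unit_box_def)
      from probe_inequality[OF w slope(1,2) c v, of j N] jump True
      show ?thesis by simp
    qed simp
  qed
  also have "\<dots> = (\<integral>\<^sup>+ t. \<integral>\<^sup>+ v. ?F t v \<partial>lborel \<partial>lborel)"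
    by (rule lborel_pair.Fubini'[OF Fm])
  also have "\<dots> \<le> (\<integral>\<^sup>+ t. ennreal (2 * Cw) * indicator {t. zdist N t \<le> 4 / res L N} t
      + ennreal (2 * \<delta>) * (ennreal (sdist t powr (- \<gamma>)) * indicator {-1<..<1} t)
      + ennreal (2 * \<delta> powr (1 - q)) * (\<integral>\<^sup>+ x. ennreal (?X x powr q) * kernel N c t x \<partial>lborel) \<partial>lborel)"
    by (rule nn_integral_mono) (rule slice_bound[OF w Cw \<delta>])
  also have "\<dots> = ennreal (2 * Cw) * emeasure lborel {t. zdist N t \<le> 4 / res L N}
      + ennreal (2 * \<delta>) * (\<integral>\<^sup>+ t. ennreal (sdist t powr (- \<gamma>)) * indicator {-1<..<1} t \<partial>lborel)
      + ennreal (2 * \<delta> powr (1 - q)) * (\<integral>\<^sup>+ t. \<integral>\<^sup>+ x. ennreal (?X x powr q) * kernel N c t x \<partial>lborel \<partial>lborel)"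
  proof -
    have bm: "{t. zdist N t \<le> 4 / res L N} \<in> sets lborel" by measurable
    have m1: "(\<lambda>t. ennreal (2 * Cw) * indicator {t. zdist N t \<le> 4 / res L N} t) \<in> borel_measurable lborel"
      using bm by (intro borel_measurable_times_ennreal borel_measurable_const borel_measurable_indicator)
    have m2': "(\<lambda>t. ennreal (sdist t powr (- \<gamma>)) * indicator {-1<..<1} t) \<in> borel_measurable lborel"
      by (intro borel_measurable_times_ennreal borel_measurable_indicator) measurable
    have m3': "(\<lambda>t. \<integral>\<^sup>+ x. ennreal (?X x powr q) * kernel N c t x \<partial>lborel) \<in> borel_measurable lborel"
      using lborel.borel_measurable_nn_integral_fst[OF Km] by simp
    have m2: "(\<lambda>t. ennreal (2 * \<delta>) * (ennreal (sdist t powr (- \<gamma>)) * indicator {-1<..<1} t)) \<in> borel_measurable lborel"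
      by (intro borel_measurable_times_ennreal borel_measurable_const m2')
    have m3: "(\<lambda>t. ennreal (2 * \<delta> powr (1 - q)) * (\<integral>\<^sup>+ x. ennreal (?X x powr q) * kernel N c t x \<partial>lborel)) \<in> borel_measurable lborel"
      by (intro borel_measurable_times_ennreal borel_measurable_const m3')
    show ?thesis
      unfolding nn_integral_add[OF borel_measurable_add[OF m1 m2] m3] nn_integral_add[OF m1 m2]
        nn_integral_cmult[OF m2'] nn_integral_cmult[OF m3'] nn_integral_cmult_indicator[OF bm] ..
  qed
  also have "(\<integral>\<^sup>+ t. \<integral>\<^sup>+ x. ennreal (?X x powr q) * kernel N c t x \<partial>lborel \<partial>lborel)
      = (\<integral>\<^sup>+ x. \<integral>\<^sup>+ t. ennreal (?X x powr q) * kernel N c t x \<partial>lborel \<partial>lborel)"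
    by (rule lborel_pair.Fubini'[symmetric]) (use Km in \<open>simp add: split_def\<close>)
  also have "\<dots> = (\<integral>\<^sup>+ x. ennreal (?X x powr q) * (\<integral>\<^sup>+ t. kernel N c t x \<partial>lborel) \<partial>lborel)"
    by (intro nn_integral_cong nn_integral_cmult k2)
  finally show ?thesis .
qed

end

section \<open>The uniform lower bound\<close>

lemma powr_subadditive:
  fixes u v a :: real
  assumes "0 \<le> u" "0 \<le> v" "0 < a" "a \<le> 1"
  shows "(u + v) powr a \<le> u powr a + v powr a"
proof (cases "u + v = 0")
  case False
  let ?s = "u + v"
  have s: "0 < ?s" using assms False by simp
  have "u / ?s \<le> (u / ?s) powr a" "v / ?s \<le> (v / ?s) powr a"
    using powr_mono'[of a 1 "u / ?s"] powr_mono'[of a 1 "v / ?s"] assms s by auto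
  then have "u / ?s + v / ?s \<le> u powr a / ?s powr a + v powr a / ?s powr a"
    using assms s by (simp add: powr_divide)
  then have "1 \<le> (u powr a + v powr a) / ?s powr a"
    using s by (simp flip: add_divide_distrib)
  then show ?thesis using s by (simp add: le_divide_eq)
qed (use assms in simp)

lemma abs_powr_diff_le:
  fixes u v a :: real
  assumes "0 \<le> u" "0 \<le> v" "0 < a" "a \<le> 1"
  shows "\<bar>u powr a - v powr a\<bar> \<le> \<bar>u - v\<bar> powr a"
proof -
  have *: "u powr a - v powr a \<le> \<bar>u - v\<bar> powr a" "v powr a \<le> u powr a" if "v \<le> u" "0 \<le> v" for u v :: real
    using powr_subadditive[of "u - v" v a] that assms by (auto intro: powr_mono2)
  show ?thesis
  proof (cases "v \<le> u")
    case True
    then show ?thesis using *[of v u] assms by simp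
  next
    case False
    then show ?thesis using *[of u v] assms by (simp add: abs_minus_commute)
  qed
qed

context lavrentiev_scheme
begin

text \<open>Only after averaging over the base points the kernels are dominated by the weight.\<close>

lemma averaged_inequality:
  fixes w :: "real^'m \<Rightarrow> real^'n"
  assumes w: "w \<in> smooth_closure cube" and Cw: "0 < Cw" "\<And>x. jac_norm w x \<le> Cw" and \<delta>: "0 < \<delta>"
    and jump: "\<And>c. c $ i0 = 0 \<Longrightarrow> (\<And>i. 0 \<le> c $ i \<and> c $ i \<le> 1 / 16) \<Longrightarrow> \<bar>w (c + axis i0 1) $ j - w (c - axis i0 1) $ j\<bar> = 2"
  shows "2 \<le> ennreal (2 * Cw) * emeasure lborel {t. zdist N t \<le> 4 / res L N}
      + ennreal (2 * \<delta>) * (\<integral>\<^sup>+ t. ennreal (sdist t powr (- \<gamma>)) * indicator {-1<..<1} t \<partial>lborel)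
      + ennreal (2 * \<delta> powr (1 - q)) * (ennreal C3 * (\<integral>\<^sup>+ x. ennreal (weight x * jac_norm w x powr q) \<partial>lborel))"
    (is "2 \<le> ?R0 + ?K * (ennreal C3 * ?I)")
proof -
  let ?X = "jac_norm w"
  let ?T = "\<lambda>a. \<integral>\<^sup>+ x. ennreal (?X x powr q) * (\<integral>\<^sup>+ t. kernel N (corner N a) t x \<partial>lborel) \<partial>lborel"
  let ?n = "of_nat (card (corners N)) :: ennreal"
  have card0: "card (corners N) \<noteq> 0" using M1 by (simp add: card_corners)
  have Xq: "(\<lambda>x. ennreal (?X x powr q)) \<in> borel_measurable lborel"
    using measurable_jac_norm[OF w] by measurable
  have Tm: "(\<lambda>x. ennreal (?X x powr q) * (\<integral>\<^sup>+ t. kernel N c t x \<partial>lborel)) \<in> borel_measurable lborel" for c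
  proof (rule borel_measurable_times_ennreal[OF Xq])
    have "(\<lambda>p. kernel N c (snd p) (fst p)) \<in> borel_measurable (borel \<Otimes>\<^sub>M borel)"
      using measurable_compose[OF measurable_pair_swap' measurable_kernel[of N c]] by (simp add: split_def)
    then have "case_prod (\<lambda>x t. kernel N c t x) \<in> borel_measurable ((lborel :: (real^'m) measure) \<Otimes>\<^sub>M (lborel :: real measure))"
      by (simp add: split_def cong: measurable_cong_sets sets_pair_measure_cong)
    then show "(\<lambda>x. \<integral>\<^sup>+ t. kernel N c t x \<partial>lborel) \<in> borel_measurable lborel"
      by (rule lborel.borel_measurable_nn_integral)
  qed
  have "?n * 2 = (\<Sum>a\<in>corners N. 2)" by simp
  also have "\<dots> \<le> (\<Sum>a\<in>corners N. ?R0 + ?K * ?T a)"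
    by (intro sum_mono corner_inequality[OF w Cw \<delta>, where j=j] corner_bounds jump)
  also have "\<dots> = ?n * ?R0 + ?K * (\<Sum>a\<in>corners N. ?T a)"
    by (simp add: sum.distrib sum_distrib_left)
  finally have sum: "?n * 2 \<le> ?n * ?R0 + ?K * (\<Sum>a\<in>corners N. ?T a)" .
  have "(\<Sum>a\<in>corners N. ?T a) = (\<integral>\<^sup>+ x. (\<Sum>a\<in>corners N. ennreal (?X x powr q) * (\<integral>\<^sup>+ t. kernel N (corner N a) t x \<partial>lborel)) \<partial>lborel)"
    by (rule nn_integral_sum[symmetric]) (rule Tm)
  also have "\<dots> \<le> (\<integral>\<^sup>+ x. (?n * ennreal C3) * ennreal (weight x * ?X x powr q) \<partial>lborel)"
  proof (rule nn_integral_mono)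
    fix x :: "real^'m"
    show "(\<Sum>a\<in>corners N. ennreal (?X x powr q) * (\<integral>\<^sup>+ t. kernel N (corner N a) t x \<partial>lborel))
        \<le> (?n * ennreal C3) * ennreal (weight x * ?X x powr q)"
    proof (cases "x \<in> cube")
      case True
      have "(\<Sum>a\<in>corners N. ennreal (?X x powr q) * (\<integral>\<^sup>+ t. kernel N (corner N a) t x \<partial>lborel))
          \<le> ennreal (?X x powr q) * ennreal (real (card (corners N)) * C3 * weight x)"
        unfolding sum_distrib_left[symmetric] by (intro mult_left_mono sum_kernel_le_weight True) simp
      also have "\<dots> = (?n * ennreal C3) * ennreal (weight x * ?X x powr q)"
        using C_pos weight_nonneg[of x] by (simp add: ennreal_mult ennreal_of_nat_eq_real_of_nat mult_ac)
      finally show ?thesis .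
    next
      case False
      then show ?thesis using q by (simp add: jac_norm_def)
    qed
  qed
  also have "\<dots> = (?n * ennreal C3) * ?I"
  proof (rule nn_integral_cmult)
    show "(\<lambda>x. ennreal (weight x * ?X x powr q)) \<in> borel_measurable lborel"
      using measurable_jac_norm[OF w] measurable_weight by measurable
  qed
  finally have "(\<Sum>a\<in>corners N. ?T a) \<le> (?n * ennreal C3) * ?I" .
  then have "?n * ?R0 + ?K * (\<Sum>a\<in>corners N. ?T a) \<le> ?n * ?R0 + ?K * ((?n * ennreal C3) * ?I)"
    by (intro add_left_mono mult_left_mono) simp_all
  also have "\<dots> = ?n * (?R0 + ?K * (ennreal C3 * ?I))"
    by (simp only: distrib_left mult_ac)
  finally have "?n * 2 \<le> ?n * (?R0 + ?K * (ennreal C3 * ?I))"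
    using sum by (rule order_trans[rotated])
  then show ?thesis using card0 by (subst (asm) ennreal_mult_le_mult_iff) auto
qed

text \<open>The parameter \<open>\<delta>\<close> makes the contribution of small gradients at most 1/2. Then \<open>N\<close> is chosen in dependence on the
map, so that the contribution of bad times is at most 1/2, too. The third term has to account for the
rest of the jump, and its constant depends neither on \<open>N\<close> nor on the map.\<close>

theorem smooth_lower_bound:
  "\<exists>c0>0. \<forall>w \<in> (smooth_closure cube :: (real^'m \<Rightarrow> real^'n) set). \<forall>j.
    (\<forall>c. c $ i0 = 0 \<longrightarrow> (\<forall>i. 0 \<le> c $ i \<and> c $ i \<le> 1 / 16) \<longrightarrow> \<bar>w (c + axis i0 1) $ j - w (c - axis i0 1) $ j\<bar> = 2) \<longrightarrow>
    ennreal c0 \<le> (\<integral>\<^sup>+ x. ennreal (weight x * norm (jac w x) powr q) \<partial>lebesgue_on cube)"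
proof -
  let ?J = "\<integral>\<^sup>+ t. ennreal (sdist t powr (- \<gamma>)) * indicator {-1<..<1} t \<partial>lborel"
  have "?J < \<infinity>" by (rule sdist_powr_integral_finite[OF \<gamma> thin])
  then obtain J where J: "0 \<le> J" "?J = ennreal J"
    by (metis infinity_ennreal_def less_top_ennreal)
  define \<delta> where "\<delta> = 1 / (4 * (J + 1))"
  have \<delta>: "0 < \<delta>" using J by (simp add: \<delta>_def)
  have \<delta>J: "2 * \<delta> * J \<le> 1 / 2" using J by (simp add: \<delta>_def field_simps)
  let ?K = "2 * \<delta> powr (1 - q) * C3"
  have K0: "0 < ?K" using \<delta> C_pos by simp
  have "ennreal (1 / ?K) \<le> (\<integral>\<^sup>+ x. ennreal (weight x * norm (jac w x) powr q) \<partial>lebesgue_on cube)"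
    if w: "w \<in> smooth_closure cube" and jump: "\<forall>c. c $ i0 = 0 \<longrightarrow> (\<forall>i. 0 \<le> c $ i \<and> c $ i \<le> 1 / 16) \<longrightarrow> \<bar>w (c + axis i0 1) $ j - w (c - axis i0 1) $ j\<bar> = 2"
    for w :: "real^'m \<Rightarrow> real^'n" and j
  proof -
    let ?I = "\<integral>\<^sup>+ x. ennreal (weight x * jac_norm w x powr q) \<partial>lborel"
    obtain Cw where Cw: "0 < Cw" "\<And>x. jac_norm w x \<le> Cw" using jac_norm_bounded[OF w] by blast
    let ?b = "\<lambda>N. emeasure lborel {t. zdist N t \<le> (1 / 4) / real L ^ N}"
    have "?b \<longlonglongrightarrow> 0" by (rule zdist_small_measure_tendsto_0) simp
    then have "(\<lambda>N. ennreal (2 * Cw) * ?b N) \<longlonglongrightarrow> ennreal (2 * Cw) * 0"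
      by (intro ennreal_tendsto_cmult) simp_all
    moreover have "ennreal (2 * Cw) * 0 < ennreal (1 / 2)"
      unfolding mult_zero_right ennreal_less_zero_iff by simp
    ultimately have "\<forall>\<^sub>F N in sequentially. ennreal (2 * Cw) * ?b N < ennreal (1 / 2)"
      by (rule order_tendstoD(2))
    then obtain N where N: "ennreal (2 * Cw) * ?b N < ennreal (1 / 2)" by (auto simp: eventually_sequentially)
    have "4 / res L N = (1 / 4) / real L ^ N" by (simp add: res_def)
    then have "2 \<le> ennreal (2 * Cw) * ?b N + ennreal (2 * \<delta>) * ennreal J + ennreal (2 * \<delta> powr (1 - q)) * (ennreal C3 * ?I)"
      using averaged_inequality[OF w Cw \<delta>, of j N] jump J by simp
    also have "\<dots> \<le> ennreal (1 / 2) + ennreal (1 / 2) + ennreal ?K * ?I"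
    proof (intro add_mono)
      show "ennreal (2 * Cw) * ?b N \<le> ennreal (1 / 2)" using N by simp
      show "ennreal (2 * \<delta>) * ennreal J \<le> ennreal (1 / 2)"
      proof -
        have "ennreal (2 * \<delta>) * ennreal J = ennreal (2 * \<delta> * J)" using \<delta> J by (simp add: ennreal_mult)
        also have "\<dots> \<le> ennreal (1 / 2)" by (rule ennreal_leI[OF \<delta>J])
        finally show ?thesis .
      qed
      show "ennreal (2 * \<delta> powr (1 - q)) * (ennreal C3 * ?I) \<le> ennreal ?K * ?I"
        using \<delta> C_pos by (simp add: ennreal_mult mult.assoc)
    qed
    also have "ennreal (1 / 2) + ennreal (1 / 2) = 1"
      by (subst ennreal_plus[symmetric]) simp_all
    finally have "1 + 1 \<le> 1 + ennreal ?K * ?I" by simp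
    then have "1 \<le> ennreal ?K * ?I" by (subst (asm) ennreal_add_left_cancel_le) auto
    then have "ennreal (1 / ?K) * 1 \<le> ennreal (1 / ?K) * (ennreal ?K * ?I)" by (intro mult_left_mono) auto
    also have "\<dots> = (ennreal (1 / ?K) * ennreal ?K) * ?I" by (simp only: mult.assoc)
    also have "ennreal (1 / ?K) * ennreal ?K = 1"
    proof -
      have "1 / ?K * ?K = 1" using \<delta> C_pos by simp
      then show ?thesis using K0 by (metis ennreal_1 ennreal_mult less_imp_le zero_le_divide_1_iff)
    qed
    also have "?I = (\<integral>\<^sup>+ x. ennreal (weight x * norm (jac w x) powr q) \<partial>lebesgue_on cube)"
      unfolding nn_integral_lebesgue_on_cube using q
      by (intro nn_integral_cong) (simp add: jac_norm_def indicator_def)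
    finally show ?thesis by simp
  qed
  then show ?thesis using K0 by (intro exI[of _ "1 / ?K"]) auto
qed

text \<open>A power with exponent \<open>\<alpha> \<le> 1\<close> of a nonnegative Lipschitz function.\<close>

lemma weight_holder: "holder_on \<alpha> S weight"
  unfolding holder_on_def
proof (intro exI ballI)
  fix x y :: "real^'m"
  let ?u = "\<lambda>x. max 0 (sdist (x $ i0) - ydist x)"
  have comp: "\<bar>x $ i - y $ i\<bar> \<le> dist x y" for i
    using component_le_norm_cart[of "x - y" i] by (simp add: dist_norm)
  have "\<bar>sdist (x $ i0) - sdist (y $ i0)\<bar> \<le> dist x y"
    unfolding sdist_def by (rule order_trans[OF infdist_triangle_abs]) (simp add: dist_real_def comp)
  moreover have "\<bar>ydist x - ydist y\<bar> \<le> real CARD('m) * dist x y"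
  proof -
    have "\<bar>ydist x - ydist y\<bar> \<le> (\<Sum>i\<in>UNIV - {i0}. \<bar>infdist (x $ i) (corner_set L M1) - infdist (y $ i) (corner_set L M1)\<bar>)"
      unfolding ydist_def sum_subtractf[symmetric] by (rule sum_abs)
    also have "\<dots> \<le> (\<Sum>i\<in>UNIV - {i0}. dist x y)"
      by (intro sum_mono order_trans[OF infdist_triangle_abs]) (simp add: dist_real_def comp)
    also have "\<dots> \<le> real CARD('m) * dist x y" by (simp add: card_Diff_singleton mult_right_mono)
    finally show ?thesis .
  qed
  ultimately have u: "\<bar>?u x - ?u y\<bar> \<le> (real CARD('m) + 1) * dist x y"
    unfolding distrib_right by (auto simp: max_def abs_if split: if_splits)
  have "\<bar>weight x - weight y\<bar> \<le> \<bar>?u x - ?u y\<bar> powr \<alpha>"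
    unfolding weight_def using \<alpha> by (intro abs_powr_diff_le) auto
  also have "\<dots> \<le> ((real CARD('m) + 1) * dist x y) powr \<alpha>"
    using u \<alpha> by (intro powr_mono2) auto
  also have "\<dots> = (real CARD('m) + 1) powr \<alpha> * dist x y powr \<alpha>"
    by (simp add: powr_mult)
  finally show "\<bar>weight x - weight y\<bar> \<le> (real CARD('m) + 1) powr \<alpha> * dist x y powr \<alpha>" .
qed

lemma weight_pos_imp_glim_0: "weight x \<noteq> 0 \<Longrightarrow> glim x = 0"
  by (rule glim_eq_0) (use \<alpha> in \<open>auto simp: weight_def max_def split: if_splits\<close>)

end

section \<open>Exponents and conclusion\<close>

text \<open>Here \<open>s = 1 - k2 / k\<close> and \<open>r = 1 - k1 / k\<close>. First a rational \<open>s\<close> between \<open>\<alpha> / (q - p)\<close> and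
\<open>min 1 (d / (p - 1))\<close> is fixed, which leaves a nonempty interval for \<open>r\<close>.\<close>

lemma exponents_exist:
  fixes p q \<alpha> d :: real
  assumes p: "1 < p" and d: "0 < d" and \<alpha>: "0 < \<alpha>" and gap: "q > p + \<alpha> * max 1 ((p - 1) / d)"
  shows "\<exists>(k::nat) k1 k2. 0 < k \<and> k1 < k \<and> k2 < k \<and>
    (p - 1) * (1 - real k2 / real k) < d * (1 - real k1 / real k) \<and>
    \<alpha> + d * (1 - real k1 / real k) < (q - 1) * (1 - real k2 / real k)"
proof -
  define b where "b = min 1 (d / (p - 1))"
  have b0: "0 < b" using p d by (simp add: b_def)
  have "max 1 ((p - 1) / d) = 1 / b"
  proof (cases "p - 1 \<le> d")
    case True
    then have "(p - 1) / d \<le> 1" "1 \<le> d / (p - 1)" using p d by simp_all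
    then show ?thesis by (simp add: b_def max_def min_def)
  next
    case False
    then have "1 \<le> (p - 1) / d" "d / (p - 1) \<le> 1" using p d by simp_all
    then show ?thesis by (simp add: b_def max_def min_def)
  qed
  then have "\<alpha> / b < q - p" using gap by simp
  moreover have "0 < \<alpha> / b" using \<alpha> b0 by simp
  ultimately have qp: "0 < q - p" by linarith
  have "\<alpha> < (q - p) * b" using \<open>\<alpha> / b < q - p\<close> b0 by (simp only: pos_divide_less_eq)
  then have ab: "\<alpha> / (q - p) < b" using qp by (simp only: pos_divide_less_eq mult.commute)
  obtain s where s: "s \<in> \<rat>" "\<alpha> / (q - p) < s" "s < b" using Rats_dense_in_real[OF ab] by blast
  have "0 < \<alpha> / (q - p)" using \<alpha> qp by simp
  then have s0: "0 < s" using s(2) by linarith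
  have s1: "s < 1" "(p - 1) * s < d"
    using s(3) p by (auto simp: b_def pos_less_divide_eq mult.commute)
  have "\<alpha> < (q - p) * s" using s(2) qp by (simp add: pos_divide_less_eq mult.commute)
  then have "(p - 1) * s < (q - 1) * s - \<alpha>" by (simp add: algebra_simps)
  then have "(p - 1) * s / d < min 1 (((q - 1) * s - \<alpha>) / d)"
    using s1 d by (simp add: divide_less_eq divide_strict_right_mono)
  then obtain r where r: "r \<in> \<rat>" "(p - 1) * s / d < r" "r < min 1 (((q - 1) * s - \<alpha>) / d)"
    using Rats_dense_in_real by blast
  have "0 < (p - 1) * s / d" using p s0 d by simp
  then have r0: "0 < r" using r(2) by linarith
  obtain m1 n1 :: nat where rr: "n1 \<noteq> 0" "r = real m1 / real n1"
    using Rats_abs_nat_div_natE[OF r(1)] r0 by (metis abs_of_pos)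
  obtain m2 n2 :: nat where ss: "n2 \<noteq> 0" "s = real m2 / real n2"
    using Rats_abs_nat_div_natE[OF s(1)] s0 by (metis abs_of_pos)
  have m1: "0 < m1" "m1 \<le> n1" using r0 r(3) rr by (auto simp: zero_less_divide_iff divide_less_eq)
  have m2: "0 < m2" "m2 \<le> n2" using s0 s1 ss by (auto simp: zero_less_divide_iff divide_less_eq)
  define k where "k = n1 * n2"
  define k1 where "k1 = (n1 - m1) * n2"
  define k2 where "k2 = n1 * (n2 - m2)"
  have k0: "0 < k" using rr ss by (simp add: k_def)
  have e1: "1 - real k1 / real k = r" using rr ss m1 by (simp add: k_def k1_def of_nat_diff field_simps)
  have e2: "1 - real k2 / real k = s" using rr ss m2 by (simp add: k_def k2_def of_nat_diff field_simps)
  have "k1 < k" "k2 < k" using rr ss m1 m2 by (auto simp: k_def k1_def k2_def)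
  moreover have "(p - 1) * s < d * r" using r(2) d by (simp add: pos_divide_less_eq mult.commute)
  moreover have "\<alpha> + d * r < (q - 1) * s" using r(3) d by (simp add: pos_less_divide_eq mult.commute)
  ultimately show ?thesis using k0 e1 e2 by (intro exI[of _ k] exI[of _ k1] exI[of _ k2]) simp
qed

lemma power_two_powr: "real (2 ^ n) powr x = 2 powr (real n * x)"
  by (simp add: powr_realpow[symmetric] powr_powr)

theorem theorem1p4:
  fixes p q \<alpha> :: real
  assumes "CARD('m::finite) \<ge> 2" and "CARD('n::finite) \<ge> 2"
    and "p > 1" and "q > 1" and "0 < \<alpha>" and "\<alpha> \<le> 1"
    and "q > p + \<alpha> * max 1 ((p - 1) / (real CARD('m) - 1))"
  shows "\<exists>(\<Lambda>::real) (a :: real^'m \<Rightarrow> real) (u0 :: real^'m \<Rightarrow> real^'n) (ubar :: real^'m \<Rightarrow> real^'n).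
    \<Lambda> \<ge> 1 \<and>
    (\<forall>x\<in>closure cube. 0 \<le> a x) \<and> holder_on \<alpha> (closure cube) a \<and>
    u0 \<in> smooth_sphere \<Lambda> \<and>
    ubar \<in> W1phi_sphere_bd (double_phase p q a) \<Lambda> u0 \<and>
    (INF u \<in> W1phi_sphere_bd (double_phase p q a) \<Lambda> u0. energy (double_phase p q a) u)
      < (INF u \<in> smooth_sphere_bd \<Lambda> u0. energy (double_phase p q a) u) \<and>
    \<not> (\<exists>u :: nat \<Rightarrow> real^'m \<Rightarrow> real^'n.
         (\<forall>l. u l \<in> smooth_sphere_bd \<Lambda> u0) \<and>
         (\<lambda>l. modular (double_phase p q a)
                (\<lambda>x. weak_grad cube (u l) x - weak_grad cube ubar x)) \<longlonglongrightarrow> 0)"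
proof -
  let ?d = "real CARD('m) - 1"
  have d0: "0 < ?d" using assms(1) by simp
  obtain k k1 k2 :: nat where k: "0 < k" "k1 < k" "k2 < k"
    and ex1: "(p - 1) * (1 - real k2 / real k) < ?d * (1 - real k1 / real k)"
    and ex2: "\<alpha> + ?d * (1 - real k1 / real k) < (q - 1) * (1 - real k2 / real k)"
    using exponents_exist[OF assms(3) d0 assms(5,7)] by blast
  define r where "r = 1 - real k1 / real k"
  define s where "s = 1 - real k2 / real k"
  (* The exponent that is forced by the equation between the exponents. *)
  define \<gamma> where "\<gamma> = (\<alpha> + ?d * r) / (q - 1)"
  have r0: "0 < r" and s0: "0 < s" using k by (auto simp: r_def s_def)
  have kr: "real k1 = real k * (1 - r)" and ks: "real k2 = real k * (1 - s)"
    using k by (auto simp: r_def s_def field_simps)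
  have \<gamma>s: "\<gamma> < s" using ex2 assms(4) by (simp add: \<gamma>_def r_def s_def pos_divide_less_eq mult.commute)
  have \<gamma>0: "0 < \<gamma>" using assms(4,5) r0 d0 by (simp add: \<gamma>_def add_pos_pos)
  obtain i0 :: 'm where True by simp
  interpret lavrentiev_scheme "2 ^ k" "2 ^ k1" "2 ^ k2" i0 \<alpha> q \<gamma> "1 - r"
  proof
    show "real (2 ^ k) powr (1 - r) = real (2 ^ k1)"
      unfolding power_two_powr kr[symmetric] by (simp add: powr_realpow)
    show "\<gamma> * (q - 1) = \<alpha> + (real CARD('m) - 1) * (1 - (1 - r))"
      using assms(4) by (simp add: \<gamma>_def)
    have "real (2 ^ k2) / real (2 ^ k) = 2 powr (- (real k * s))"
    proof -
      have "- (real k * s) = real k2 - real k" unfolding ks by (simp add: algebra_simps)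
      then show ?thesis by (simp add: powr_realpow[symmetric] powr_diff)
    qed
    then have "real (2 ^ k) powr \<gamma> * (real (2 ^ k2) / real (2 ^ k)) = 2 powr (real k * (\<gamma> - s))"
      unfolding power_two_powr by (simp add: powr_add[symmetric] algebra_simps)
    also have "\<dots> < 2 powr 0" using k \<gamma>s by (intro powr_less_mono) (auto simp: mult_less_0_iff)
    finally show "real (2 ^ k) powr \<gamma> * (real (2 ^ k2) / real (2 ^ k)) < 1" by simp
  qed (use k assms \<gamma>0 in \<open>auto simp: r_def\<close>)
  have rat: "ratio = 2 powr (real k * s)"
  proof -
    have "real k * s = real k - real k2" unfolding ks by (simp add: algebra_simps)
    then show ?thesis by (simp add: ratio_def powr_realpow[symmetric] powr_diff)
  qed
  have thi: "thinning = 2 powr (- (real k * (?d * r + s)))"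
  proof -
    have c: "real (CARD('m) - 1) = ?d" using assms(1) by (simp add: of_nat_diff)
    have pow: "real (2 ^ a) ^ b = 2 powr (real a * real b)" for a b :: nat
    proof -
      have "real (2 ^ a) ^ b = 2 ^ (a * b)" by (simp add: power_mult)
      also have "\<dots> = 2 powr real (a * b)" by (simp only: powr_realpow zero_less_numeral)
      finally show ?thesis by simp
    qed
    have "real (2 ^ k2) = 2 powr real k2" by (simp add: powr_realpow)
    then have "thinning = 2 powr (real k1 * ?d + real k2 - real k * real CARD('m))"
      unfolding thinning_def pow c by (simp only: powr_add powr_diff)
    also have "real k1 * ?d + real k2 - real k * real CARD('m) = - (real k * (?d * r + s))"
      unfolding kr ks by (simp add: algebra_simps)
    finally show ?thesis .
  qed
  have rt: "ratio powr p * thinning < 1"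
  proof -
    have "ratio powr p * thinning = 2 powr (real k * ((p - 1) * s - ?d * r))"
      unfolding rat thi by (simp add: powr_powr powr_add[symmetric] algebra_simps)
    also have "\<dots> < 2 powr 0"
      using k ex1 by (intro powr_less_mono) (auto simp: mult_less_0_iff r_def s_def)
    finally show ?thesis by simp
  qed
  have "ratio powr 1 \<le> ratio powr p" using ratio_gt_1 assms(3) by (intro powr_mono) auto
  then have rt1: "ratio * thinning < 1"
    using mult_right_mono[OF _ thinning_nonneg, of "ratio powr 1" "ratio powr p"] rt ratio_gt_1 by simp
  have "\<exists>j1 j2 :: 'n. j1 \<noteq> j2"
  proof (rule ccontr)
    assume "\<nexists>j1 j2 :: 'n. j1 \<noteq> j2"
    then have "(UNIV :: 'n set) \<subseteq> {undefined}" by auto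
    then have "CARD('n) \<le> 1" using card_mono[of "{undefined}" "UNIV :: 'n set"] by simp
    then show False using assms(2) by simp
  qed
  then obtain j1 j2 :: 'n where j: "j1 \<noteq> j2" by blast
  define u0 :: "real^'m \<Rightarrow> real^'n" where "u0 = angle_map j1 j2 (fpart 0)"
  define ubar :: "real^'m \<Rightarrow> real^'n" where "ubar = angle_map j1 j2 flim"
  define G :: "real^'m \<Rightarrow> real^'m^'n" where "G = (\<lambda>x. angle_grad j1 j2 (flim x) (glim x))"
  note lim = limit_map[OF j rt1, folded u0_def ubar_def, folded G_def]
  let ?E = "\<integral>\<^sup>+ x. ennreal (norm (G x) powr p) \<partial>lebesgue_on cube"
  have "?E < \<infinity>" using limit_map_energy_finite[OF j _ rt] assms(3) by (simp add: G_def)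
  then obtain E where E: "0 \<le> E" "?E = ennreal E"
    by (metis infinity_ennreal_def less_top_ennreal)
  obtain c0 where c0: "0 < c0" and low: "\<forall>w \<in> (smooth_closure cube :: (real^'m \<Rightarrow> real^'n) set). \<forall>j.
    (\<forall>c. c $ i0 = 0 \<longrightarrow> (\<forall>i. 0 \<le> c $ i \<and> c $ i \<le> 1 / 16) \<longrightarrow> \<bar>w (c + axis i0 1) $ j - w (c - axis i0 1) $ j\<bar> = 2) \<longrightarrow>
    ennreal c0 \<le> (\<integral>\<^sup>+ x. ennreal (weight x * norm (jac w x) powr q) \<partial>lebesgue_on cube)"
    using smooth_lower_bound[where 'n='n] by (elim exE conjE) (rule that)
  (* The multiple of the weight that lifts the lower bound c0 above the energy E. *)
  define K where "K = (E + 1) / c0"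
  have K0: "0 < K" using E c0 by (simp add: K_def)
  have Kc0: "K * c0 = E + 1" using c0 by (simp add: K_def)
  define a where "a = (\<lambda>x. K * weight x)"
  let ?\<phi> = "double_phase p q a"
  have a0: "0 \<le> a x" for x using K0 weight_nonneg by (simp add: a_def)
  have aG: "a x = 0 \<or> G x = 0" for x
  proof (cases "weight x = 0")
    case False
    then have "norm (G x) = 0" by (simp add: G_def norm_angle_grad[OF j] weight_pos_imp_glim_0)
    then show ?thesis by simp
  qed (simp add: a_def)
  have wg: "AE x in lebesgue_on cube. weak_grad cube ubar x = G x"
    by (rule weak_grad_AE_eq[OF lim(3)])
  have E_ubar: "energy ?\<phi> ubar = ennreal E"
  proof -
    have "energy ?\<phi> ubar = ?E"
      unfolding energy_def modular_def
    proof (rule nn_integral_cong_AE)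
      show "AE x in lebesgue_on cube. ennreal (?\<phi> x (norm (weak_grad cube ubar x))) = ennreal (norm (G x) powr p)"
        using wg
      proof eventually_elim
        case (elim x)
        then show ?case using aG[of x] by (auto simp: double_phase_def)
      qed
    qed
    then show ?thesis using E by simp
  qed
  have low_K: "ennreal (E + 1) \<le> (\<integral>\<^sup>+ x. ennreal (a x * norm (jac w x) powr q) \<partial>lebesgue_on cube)"
    if w: "w \<in> smooth_sphere_bd 1 u0" for w
  proof -
    have wsm: "w \<in> smooth_closure cube" and wbd: "\<And>x. x \<in> frontier cube \<Longrightarrow> w x = u0 x"
      using w by (auto simp: smooth_sphere_bd_def smooth_sphere_def)
    have u0v: "u0 x $ j1 = cos (pi * stair (2 ^ k) (2 ^ k2) 0 (x $ i0))" for x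
      by (simp add: u0_def angle_map_def pair_vec_nth fpart_def)
    have "\<bar>w (c + axis i0 1) $ j1 - w (c - axis i0 1) $ j1\<bar> = 2"
      if c: "c $ i0 = 0" "\<forall>i. 0 \<le> c $ i \<and> c $ i \<le> 1 / 16" for c
    proof -
      have nth: "(c + axis i0 1) $ i = (if i = i0 then 1 else c $ i)" "(c - axis i0 1) $ i = (if i = i0 then -1 else c $ i)" for i
        using c(1) by (auto simp: axis_def)
      have "-1 \<le> c $ i" "c $ i \<le> 1" for i using c(2)[rule_format, of i] by auto
      then have "c + axis i0 1 \<in> frontier cube" "c - axis i0 1 \<in> frontier cube"
        by (auto intro!: frontier_cubeI[where j=i0] simp: nth simp del: vector_add_component vector_minus_component)
      then have "w (c + axis i0 1) $ j1 = cos (pi * stair (2 ^ k) (2 ^ k2) 0 1)"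
        "w (c - axis i0 1) $ j1 = cos (pi * stair (2 ^ k) (2 ^ k2) 0 (-1))"
        using wbd by (simp_all only: u0v nth if_True simp_thms)
      moreover have "stair (2 ^ k) (2 ^ k2) 0 1 = 1" "stair (2 ^ k) (2 ^ k2) 0 (-1) = 0"
        using M2 M2_le by (auto intro: stair_1 stair_0)
      ultimately show ?thesis by simp
    qed
    then have "ennreal c0 \<le> (\<integral>\<^sup>+ x. ennreal (weight x * norm (jac w x) powr q) \<partial>lebesgue_on cube)"
      by (intro low[rule_format, OF wsm]) blast
    then have "ennreal K * ennreal c0 \<le> ennreal K * (\<integral>\<^sup>+ x. ennreal (weight x * norm (jac w x) powr q) \<partial>lebesgue_on cube)"
      by (rule mult_left_mono) simp
    also have "\<dots> = (\<integral>\<^sup>+ x. ennreal K * ennreal (weight x * norm (jac w x) powr q) \<partial>lebesgue_on cube)"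
    proof (rule nn_integral_cmult[symmetric])
      have "jac w \<in> borel_measurable (lebesgue_on cube)"
        using integrable_jac[OF wsm] by (rule borel_measurable_integrable)
      moreover have "weight \<in> borel_measurable (lebesgue_on cube)"
        by (rule measurable_lebesgue_on_cube[OF measurable_weight])
      ultimately show "(\<lambda>x. ennreal (weight x * norm (jac w x) powr q)) \<in> borel_measurable (lebesgue_on cube)"
        by measurable
    qed
    also have "\<dots> = (\<integral>\<^sup>+ x. ennreal (a x * norm (jac w x) powr q) \<partial>lebesgue_on cube)"
      using K0 weight_nonneg by (intro nn_integral_cong) (simp add: a_def ennreal_mult[symmetric] mult.assoc)
    finally show ?thesis using Kc0 K0 c0 by (simp add: ennreal_mult[symmetric])
  qed
  have jacw: "AE x in lebesgue_on cube. weak_grad cube w x = jac w x" if "w \<in> smooth_sphere_bd 1 u0" for w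
    using that by (intro weak_grad_AE_eq has_weak_gradient_jac) (simp add: smooth_sphere_bd_def smooth_sphere_def)
  have E_smooth: "ennreal (E + 1) \<le> energy ?\<phi> w" if w: "w \<in> smooth_sphere_bd 1 u0" for w
    unfolding energy_def modular_def
  proof (rule order_trans[OF low_K[OF w] nn_integral_mono_AE])
    show "AE x in lebesgue_on cube. ennreal (a x * norm (jac w x) powr q) \<le> ennreal (?\<phi> x (norm (weak_grad cube w x)))"
      using jacw[OF w] by eventually_elim (auto simp: double_phase_def intro!: ennreal_leI)
  qed
  have E_diff: "ennreal (E + 1) \<le> modular ?\<phi> (\<lambda>x. weak_grad cube w x - weak_grad cube ubar x)"
    if w: "w \<in> smooth_sphere_bd 1 u0" for w
    unfolding modular_def
  proof (rule order_trans[OF low_K[OF w] nn_integral_mono_AE])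
    show "AE x in lebesgue_on cube. ennreal (a x * norm (jac w x) powr q)
        \<le> ennreal (?\<phi> x (norm (weak_grad cube w x - weak_grad cube ubar x)))"
      using jacw[OF w] wg
    proof eventually_elim
      case (elim x)
      then show ?case using aG[of x] by (auto simp: double_phase_def intro!: ennreal_leI)
    qed
  qed
  have ubar_in: "ubar \<in> W1phi_sphere_bd ?\<phi> 1 u0"
    using lim(2,4) E_ubar norm_angle_map[OF j]
    by (simp add: W1phi_sphere_bd_def W1phi_sphere_def ubar_def)
  have inf: "(INF u \<in> W1phi_sphere_bd ?\<phi> 1 u0. energy ?\<phi> u) < (INF u \<in> smooth_sphere_bd 1 u0. energy ?\<phi> u)"
  proof -
    have "(INF u \<in> W1phi_sphere_bd ?\<phi> 1 u0. energy ?\<phi> u) \<le> ennreal E"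
      using INF_lower[OF ubar_in, of "energy ?\<phi>"] E_ubar by simp
    also have "\<dots> < ennreal (E + 1)" using E by (simp add: ennreal_lessI)
    also have "\<dots> \<le> (INF u \<in> smooth_sphere_bd 1 u0. energy ?\<phi> u)"
      by (rule INF_greatest) (rule E_smooth)
    finally show ?thesis .
  qed
  have noseq: "\<not> (\<exists>u :: nat \<Rightarrow> real^'m \<Rightarrow> real^'n. (\<forall>l. u l \<in> smooth_sphere_bd 1 u0) \<and>
         (\<lambda>l. modular ?\<phi> (\<lambda>x. weak_grad cube (u l) x - weak_grad cube ubar x)) \<longlonglongrightarrow> 0)"
  proof
    assume "\<exists>u :: nat \<Rightarrow> real^'m \<Rightarrow> real^'n. (\<forall>l. u l \<in> smooth_sphere_bd 1 u0) \<and>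
         (\<lambda>l. modular ?\<phi> (\<lambda>x. weak_grad cube (u l) x - weak_grad cube ubar x)) \<longlonglongrightarrow> 0"
    then obtain u :: "nat \<Rightarrow> real^'m \<Rightarrow> real^'n" where u: "\<And>l. u l \<in> smooth_sphere_bd 1 u0"
      and l: "(\<lambda>l. modular ?\<phi> (\<lambda>x. weak_grad cube (u l) x - weak_grad cube ubar x)) \<longlonglongrightarrow> 0" by blast
    have "ennreal (E + 1) \<le> 0"
      by (rule tendsto_lowerbound[OF l]) (use E_diff[OF u] in auto)
    then show False using E by simp
  qed
  have hol: "holder_on \<alpha> (closure cube) a"
  proof -
    obtain C where C: "\<And>x y. \<bar>weight x - weight y\<bar> \<le> C * dist x y powr \<alpha>"
      using weight_holder[of UNIV] by (auto simp: holder_on_def)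
    have "\<bar>a x - a y\<bar> \<le> (K * C) * dist x y powr \<alpha>" for x y
    proof -
      have "\<bar>a x - a y\<bar> = K * \<bar>weight x - weight y\<bar>"
        using K0 by (simp add: a_def abs_mult flip: right_diff_distrib)
      also have "\<dots> \<le> K * (C * dist x y powr \<alpha>)" using K0 C by (intro mult_left_mono) auto
      finally show ?thesis by (simp add: mult.assoc)
    qed
    then show ?thesis unfolding holder_on_def by blast
  qed
  show ?thesis
    using lim(1) ubar_in inf noseq hol a0
    by (intro exI[of _ 1] exI[of _ a] exI[of _ u0] exI[of _ ubar]) simp
qed

end
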